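(* Let $p$ be a prime and $\alpha,\beta$ integers different from $1$, and assume that either $p>3$, or $p=3$ and neither $\alpha$ nor $\beta$ is congruent to $7$ modulo $9$. Suppose $v_p(\alpha-1)=v_p(\beta-1)=m>0$ and that $\ell=v_p(\alpha-\beta)$ satisfies $m<\ell<2m$ and $2\ell<3m$. Then $|G_p|=p^{2m+3\ell}$, the nilpotency class of $G_p$ is $5$, $o(a)=o(b)=p^{m+\ell}$ and $o(c)=p^{2\ell-m}$.
   Context: $G(\alpha,\beta)=\langle A,B\mid A^{[A,B]}=A^{\alpha},\ B^{[B,A]}=B^{\beta}\rangle$ with $[x,y]=x^{-1}y^{-1}xy$, $y^x=x^{-1}yx$, and $C=[A,B]$. The group $G(\alpha,\beta)$ is finite and nilpotent, hence the direct product of its Sylow subgroups; $G_p$ denotes its Sylow $p$-subgroup and $a,b,c$ denote the images of $A,B,C$ under the canonical projection $G(\alpha,\beta)\to G_p$. $v_p$ is the $p$-adic valuation and $o(x)$ the order of $x$. *)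

theory Defs
  imports "HOL-Computational_Algebra.Primes" "HOL-Number_Theory.Cong" "HOL-Algebra.Algebra"
begin

text \<open>Words over the letters A^{+-1}, B^{+-1}. A letter is a pair (g, i):
 g = False means A, g = True means B; i = True means the inverse letter.\<close>

type_synonym letter = "bool \<times> bool"

definition inv_letter :: "letter \<Rightarrow> letter" where
  "inv_letter x = (fst x, \<not> snd x)"

definition gA :: letter where "gA = (False, False)"
definition gAi :: letter where "gAi = (False, True)"
definition gB :: letter where "gB = (True, False)"
definition gBi :: letter where "gBi = (True, True)"

definition word_pow :: "bool \<Rightarrow> int \<Rightarrow> letter list" where
  "word_pow g k = (if 0 \<le> k then replicate (nat k) (g, False)
                   else replicate (nat (- k)) (g, True))"

definition word_C :: "letter list" where "word_C = [gAi, gBi, gA, gB]"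
definition word_Ci :: "letter list" where "word_Ci = [gBi, gAi, gB, gA]"

definition relators :: "int \<Rightarrow> int \<Rightarrow> letter list set" where
  "relators \<alpha> \<beta> = { word_Ci @ [gA] @ word_C @ word_pow False (- \<alpha>),
                     word_C @ [gB] @ word_Ci @ word_pow True (- \<beta>) }"

inductive pres_eq :: "letter list set \<Rightarrow> letter list \<Rightarrow> letter list \<Rightarrow> bool"
  for R where
  refl: "pres_eq R u u"
| sym: "pres_eq R u v \<Longrightarrow> pres_eq R v u"
| trans: "pres_eq R u v \<Longrightarrow> pres_eq R v w \<Longrightarrow> pres_eq R u w"
| cancel: "pres_eq R (u @ [x, inv_letter x] @ v) (u @ v)"
| relator: "r \<in> R \<Longrightarrow> pres_eq R (u @ r @ v) (u @ v)"

definition pres_class :: "letter list set \<Rightarrow> letter list \<Rightarrow> letter list set" where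
  "pres_class R w = {v. pres_eq R w v}"

definition presented_group :: "letter list set \<Rightarrow> letter list set monoid" where
  "presented_group R =
     \<lparr> carrier = range (pres_class R),
       monoid.mult = (\<lambda>U V. {z. \<exists>x\<in>U. \<exists>y\<in>V. pres_eq R (x @ y) z}),
       monoid.one = pres_class R [] \<rparr>"

definition Gab :: "int \<Rightarrow> int \<Rightarrow> letter list set monoid" where
  "Gab \<alpha> \<beta> = presented_group (relators \<alpha> \<beta>)"

definition elA :: "int \<Rightarrow> int \<Rightarrow> letter list set" where
  "elA \<alpha> \<beta> = pres_class (relators \<alpha> \<beta>) [gA]"
definition elB :: "int \<Rightarrow> int \<Rightarrow> letter list set" where
  "elB \<alpha> \<beta> = pres_class (relators \<alpha> \<beta>) [gB]"
definition elC :: "int \<Rightarrow> int \<Rightarrow> letter list set" where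
  "elC \<alpha> \<beta> = pres_class (relators \<alpha> \<beta>) word_C"

definition is_sylow :: "('a, 'b) monoid_scheme \<Rightarrow> nat \<Rightarrow> 'a set \<Rightarrow> bool" where
  "is_sylow G p P \<longleftrightarrow> subgroup P G \<and> card P = p ^ multiplicity p (order G)"

text \<open>Image of x under the canonical projection of a finite nilpotent group onto
 its Sylow p-subgroup: the unique element y of the cyclic group generated by x
 with p-power order such that x y^-1 has order prime to p (the p-part of x).\<close>
definition ppart :: "('a, 'b) monoid_scheme \<Rightarrow> nat \<Rightarrow> 'a \<Rightarrow> 'a" where
  "ppart G p x = (THE y. y \<in> generate G {x} \<and> (\<exists>k. group.ord G y = p ^ k)
                     \<and> coprime (group.ord G (x \<otimes>\<^bsub>G\<^esub> inv\<^bsub>G\<^esub> y)) p)"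

definition comm :: "('a, 'b) monoid_scheme \<Rightarrow> 'a \<Rightarrow> 'a \<Rightarrow> 'a" where
  "comm H x y = inv\<^bsub>H\<^esub> x \<otimes>\<^bsub>H\<^esub> inv\<^bsub>H\<^esub> y \<otimes>\<^bsub>H\<^esub> x \<otimes>\<^bsub>H\<^esub> y"

text \<open>Lower central series: lcs H 0 = gamma_1(H) = H,
  lcs H (Suc n) = gamma_(n+2)(H) = [gamma_(n+1)(H), H].\<close>
fun lcs :: "('a, 'b) monoid_scheme \<Rightarrow> nat \<Rightarrow> 'a set" where
  "lcs H 0 = carrier H"
| "lcs H (Suc n) = generate H {comm H x y | x y. x \<in> lcs H n \<and> y \<in> carrier H}"

definition nilpotency_class :: "('a, 'b) monoid_scheme \<Rightarrow> nat \<Rightarrow> bool" where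
  "nilpotency_class H c \<longleftrightarrow> lcs H c = {\<one>\<^bsub>H\<^esub>} \<and> (\<forall>k<c. lcs H k \<noteq> {\<one>\<^bsub>H\<^esub>})"

end

theory Submission
  imports Defs
begin

text \<open>
  Conjugating \<open>C\<close> by \<open>A B = B A C\<close> in two ways gives a relation
  \<open>B^x = C^i A^y C^-j\<close> with \<open>i - j = \<alpha> - \<beta>\<close>. Conjugating it by \<open>C\<close> puts a power of \<open>C\<close>
  into \<open>\<langle>A\<rangle>\<close>, so \<open>A\<close>, \<open>B\<close>, \<open>C\<close> have finite order, and since
  \<open>A^i B = B C^i A^(\<alpha> + \<dots> + \<alpha>^i)\<close> the group equals \<open>\<langle>B\<rangle>\<langle>C\<rangle>\<langle>A\<rangle>\<close>; hence it is finite.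
  Here \<open>x\<close> and \<open>y\<close> have \<open>p\<close>-adic valuation \<open>2m\<close>. Commuting the relation with \<open>A\<close> and \<open>B\<close> and
  comparing \<open>p\<close>-parts bounds the \<open>p\<close>-parts of the orders of \<open>A\<close>, \<open>B\<close>, \<open>C\<close> by \<open>p^(m+l)\<close>, \<open>p^(m+l)\<close>,
  \<open>p^(2l-m)\<close>; as \<open>A^y\<close> lies in \<open>\<langle>B\<rangle>\<langle>C\<rangle>\<close>, at most \<open>p^(2m+3l)\<close> divides the order.

  Conversely, right multiplication by the generators on \<open>B^j C^k A^i\<close> is
  \<open>(j, k, i) \<mapsto> (j, k, i + 1)\<close> and \<open>(j, k, i) \<mapsto> (j + \<beta>^k, k + i, \<alpha> + \<dots> + \<alpha>^i)\<close>. These maps descend to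
  the quotient of \<open>\<int>^3\<close> by the lattice spanned by \<open>(p^(m+l), 0, 0)\<close>, \<open>(0, 0, p^(m+l))\<close> and
  \<open>(h, -p^l, h)\<close>, where \<open>2 h (\<alpha> - \<beta>) = p^l (\<alpha> - 1)^2\<close> modulo \<open>p^(m+2l)\<close>, and satisfy the relations there.
  They generate a transitive \<open>p\<close>-group on \<open>p^(2m+3l)\<close> points, which therefore is the Sylow
  \<open>p\<close>-subgroup, and its class is read off from the upper and lower central series.
\<close>

section \<open>Expansions of powers and geometric sums\<close>

text \<open>The bounds on the orders are circular: one on \<open>A\<close> and \<open>B\<close>
  yields one on \<open>C\<close>, and conversely. A round trip lowers the exponent by 3m - 2l until
  m + l is reached, which is where 2l < 3m enters. The vector (h, -p^l, h) is the relation solved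
  for a power of \<open>C\<close>: to leading order x and -y are both (\<alpha> - 1)^2 / 2, and
  \<alpha> - \<beta> = p^l d, so that C^(p^l) should equal B^h A^h with 2 h d = (\<alpha> - 1)^2.
  Using permutations instead of a multiplication of triples makes associativity free: only
  compatibility with the lattice and the relations have to be verified. These congruences are modulo
  p^(m+l), and expansions to second order reach them, since their errors are divisible by p^(3m-1);
  the missing factor p is the price of dividing by 6 when p = 3.\<close>

lemma one_plus_power_cube_dvd:
  fixes x :: int
  shows "x ^ 3 dvd (1 + x) ^ k - (1 + int k * x + int (k choose 2) * x ^ 2)"
proof (induction k)
  case (Suc k)
  then obtain z where z: "(1 + x) ^ k = 1 + int k * x + int (k choose 2) * x ^ 2 + x ^ 3 * z"
    by (auto simp: dvd_def algebra_simps)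
  have "Suc k choose 2 = (k choose 2) + k"
    by (simp add: numeral_2_eq_2)
  then have "(1 + x) ^ Suc k - (1 + int (Suc k) * x + int (Suc k choose 2) * x ^ 2)
      = x ^ 3 * (int (k choose 2) + z + x * z)"
    by (simp add: z algebra_simps power2_eq_square power3_eq_cube)
  then show ?case by simp
qed (simp add: numeral_2_eq_2)

lemma odd_power_dvd_choose_2:
  fixes p :: nat
  assumes "odd p" "p ^ r dvd k"
  shows "p ^ r dvd (k choose 2)"
proof -
  have "2 * (k choose 2) = k * (k - 1)"
    unfolding choose_two by (rule dvd_mult_div_cancel) auto
  then have "p ^ r dvd 2 * (k choose 2)" using assms(2) by simp
  moreover have "coprime (p ^ r) 2" using assms(1) by simp
  ultimately show ?thesis using coprime_dvd_mult_right_iff by blast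
qed

text \<open>Induction on r, passing from an exponent j to p j. With w = (1+x)^j - 1, divisible by
  p^(r+m), the quadratic coefficient of (1+w)^p is divisible by the odd prime p, and the cubic error
  by p^(3(r+m)), which suffices because m > 0.\<close>

lemma one_plus_power_cong:
  fixes x :: int and p m r k :: nat
  assumes "Factorial_Ring.prime p" "odd p" "0 < m" "int p ^ m dvd x" "p ^ r dvd k"
  shows "int p ^ (r + 2 * m) dvd (1 + x) ^ k - (1 + int k * x)"
  using assms(5)
proof (induction r arbitrary: k)
  case 0
  obtain z where z: "(1 + x) ^ k - (1 + int k * x + int (k choose 2) * x ^ 2) = x ^ 3 * z"
    using one_plus_power_cube_dvd[of x k] by (auto simp: dvd_def)
  have "(1 + x) ^ k - (1 + int k * x) = x ^ 2 * (int (k choose 2) + x * z)"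
    using z by (simp add: algebra_simps power2_eq_square power3_eq_cube)
  moreover have "int p ^ (2 * m) dvd x ^ 2"
    using dvd_power_same[OF assms(4), of 2] by (simp add: power_mult[symmetric] mult.commute)
  ultimately show ?case by simp
next
  case (Suc r)
  from Suc.prems obtain k' where "k = p ^ Suc r * k'" by (rule dvdE)
  then have k: "k = p * (p ^ r * k')" by simp
  define j where "j = p ^ r * k'"
  define w where "w = (1 + x) ^ j - 1"
  have "int p ^ (r + 2 * m) dvd (1 + x) ^ j - (1 + int j * x)"
    by (rule Suc.IH) (simp add: j_def)
  then obtain z where z: "w = int j * x + int p ^ (r + 2 * m) * z"
    by (auto simp: w_def dvd_def algebra_simps)
  have "int p ^ (r + m) dvd int j * x"
    using assms(4) by (simp add: j_def power_add mult_dvd_mono)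
  moreover have "int p ^ (r + m) dvd int p ^ (r + 2 * m)"
    by (simp add: le_imp_power_dvd)
  ultimately have w: "int p ^ (r + m) dvd w" using z by simp
  have "int p ^ (2 * (r + m)) dvd w ^ 2"
    using dvd_power_same[OF w, of 2] by (simp add: power_mult[symmetric] mult.commute)
  moreover have "int p dvd int (p choose 2)"
    using odd_power_dvd_choose_2[OF assms(2), of 1 p] by simp
  ultimately have "int p ^ (2 * (r + m)) * int p dvd w ^ 2 * int (p choose 2)"
    by (rule mult_dvd_mono)
  moreover have "int p ^ (Suc r + 2 * m) dvd int p ^ (2 * (r + m)) * int p"
    using le_imp_power_dvd[of "Suc r + 2 * m" "Suc (2 * (r + m))" "int p"] by (simp add: mult.commute)
  ultimately have "int p ^ (Suc r + 2 * m) dvd w ^ 2 * int (p choose 2)"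
    by (rule dvd_trans[rotated])
  then have c2: "int p ^ (Suc r + 2 * m) dvd int (p choose 2) * w ^ 2"
    by (simp only: mult.commute)
  have "int p ^ (3 * (r + m)) dvd w ^ 3"
    using dvd_power_same[OF w, of 3] by (simp add: power_mult[symmetric] mult.commute)
  moreover have "int p ^ (Suc r + 2 * m) dvd int p ^ (3 * (r + m))"
    using assms(3) by (intro le_imp_power_dvd) simp
  ultimately have "int p ^ (Suc r + 2 * m) dvd w ^ 3" by (rule dvd_trans[rotated])
  then have c3: "int p ^ (Suc r + 2 * m) dvd (1 + w) ^ p - (1 + int p * w + int (p choose 2) * w ^ 2)"
    by (rule dvd_trans[OF _ one_plus_power_cube_dvd])
  have pz: "int p * w = int k * x + int p ^ (Suc r + 2 * m) * z"
    by (simp add: z k j_def algebra_simps)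
  have "(1 + x) ^ k = (1 + w) ^ p"
    by (simp add: w_def k j_def power_mult[symmetric] mult.commute)
  then have "(1 + x) ^ k - (1 + int k * x)
     = ((1 + w) ^ p - (1 + int p * w + int (p choose 2) * w ^ 2)) + int (p choose 2) * w ^ 2
       + int p ^ (Suc r + 2 * m) * z"
    using pz by simp
  then show ?case by (simp only:) (intro dvd_add c2 c3 dvd_triv_left)
qed

lemma one_plus_power_dvd:
  fixes x :: int and p m r k :: nat
  assumes "Factorial_Ring.prime p" "odd p" "0 < m" "int p ^ m dvd x" "p ^ r dvd k"
  shows "int p ^ (r + m) dvd (1 + x) ^ k - 1"
proof -
  have "int p ^ (r + m) dvd (1 + x) ^ k - (1 + int k * x)"
    using one_plus_power_cong[OF assms] by (rule dvd_trans[rotated]) (simp add: le_imp_power_dvd)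
  moreover have "int p ^ (r + m) dvd int k * x"
    using assms(4,5) by (metis mult_dvd_mono of_nat_dvd_iff of_nat_power power_add)
  ultimately show ?thesis
    using dvd_add[of _ "(1 + x) ^ k - (1 + int k * x)" "int k * x"] by simp
qed

text \<open>Lifting the exponent: modulo p^(r+m+1) only the linear term k x of (1+x)^k - 1 survives,
  and its valuation is r + m.\<close>

lemma one_plus_power_not_dvd:
  fixes x :: int and p m r k :: nat
  assumes "Factorial_Ring.prime p" "odd p" "0 < m" "int p ^ m dvd x" "p ^ r dvd k"
    and "\<not> int p ^ Suc m dvd x" "\<not> p ^ Suc r dvd k"
  shows "\<not> int p ^ Suc (r + m) dvd (1 + x) ^ k - 1"
proof
  assume a: "int p ^ Suc (r + m) dvd (1 + x) ^ k - 1"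
  have "int p ^ Suc (r + m) dvd (1 + x) ^ k - (1 + int k * x)"
    using one_plus_power_cong[OF assms(1-5)] assms(3)
    by (elim dvd_trans[rotated]) (intro le_imp_power_dvd, simp)
  with a have d: "int p ^ Suc (r + m) dvd int k * x"
    using dvd_diff[OF a, of "(1 + x) ^ k - (1 + int k * x)"] by simp
  obtain y where y: "x = int p ^ m * y" using assms(4) by (auto simp: dvd_def)
  obtain j where j: "k = p ^ r * j" using assms(5) by (auto simp: dvd_def)
  have p0: "int p \<noteq> 0" using assms(1) by auto
  have "int p ^ (r + m) * int p dvd int p ^ (r + m) * (int j * y)"
    using d by (simp add: y j power_add mult.assoc mult.left_commute mult.commute)
  then have "int p dvd int j * y"
    using p0 by (simp only: dvd_mult_cancel_left) simp
  then have "int p dvd int j \<or> int p dvd y"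
    using assms(1) prime_dvd_mult_iff[of "int p"] by simp
  then show False
    using assms(6,7) by (auto simp: y j mult_dvd_mono)
qed

text \<open>For p > 3 the factor 6 is invertible, for p = 3 it costs one power of p. Admitting the
  loss for every p treats both cases at once; it is the source of the exponents \<open>m - 1\<close>
  and \<open>3 * m - 1\<close> below.\<close>

lemma prime_power_dvd_times_6:
  fixes z :: int
  assumes "Factorial_Ring.prime p" "odd p" "int p ^ Suc r dvd 6 * z"
  shows "int p ^ r dvd z"
proof (cases "p = 3")
  case True
  then have "3 * 3 ^ r dvd 3 * (2 * z)" using assms(3) by simp
  then have "(3::int) ^ r dvd 2 * z" by (simp only: dvd_mult_cancel_left) simp
  moreover have "coprime ((3::int) ^ r) 2" by simp
  ultimately show ?thesis using True coprime_dvd_mult_right_iff by fastforce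
next
  case False
  have "\<not> p dvd 6"
  proof
    assume "p dvd 6"
    then have "p dvd 2 * 3" by simp
    then have "p dvd 2 \<or> p dvd 3" using assms(1) prime_dvd_mult_iff by blast
    then have "p \<le> 3" using dvd_imp_le[of p 2] dvd_imp_le[of p 3] by auto
    moreover have "2 \<le> p" using assms(1) by (rule prime_ge_2_nat)
    ultimately have "p = 2" using False by linarith
    then show False using assms(2) by simp
  qed
  then have "coprime p 6" using assms(1) prime_imp_coprime by blast
  then have "coprime (int p) 6"
    using coprime_int_iff[of p 6] by simp
  then have "coprime (int p ^ r) 6" by simp
  moreover have "int p ^ r dvd 6 * z" using assms(3) by (simp add: dvd_mult_right)
  ultimately show ?thesis using coprime_dvd_mult_right_iff by blast
qed

lemma odd_power_dvd_times_2:
  fixes z :: int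
  assumes "odd p" "int p ^ r dvd 2 * z"
  shows "int p ^ r dvd z"
proof -
  have "coprime (int p ^ r) 2" using assms(1) by simp
  then show ?thesis using assms(2) coprime_dvd_mult_right_iff by blast
qed

lemma two_choose_2: "2 * int (n choose 2) = int n * (int n - 1)"
proof -
  have "2 * (n choose 2) = n * (n - 1)"
    unfolding choose_two by (rule dvd_mult_div_cancel) auto
  then show ?thesis by (cases n) (simp_all flip: of_nat_mult add: algebra_simps)
qed

lemma six_choose_3: "6 * int (n choose 3) = int n * (int n - 1) * (int n - 2)"
proof (induction n)
  case (Suc n)
  have "Suc n choose 3 = (n choose 3) + (n choose 2)"
    by (simp add: numeral_3_eq_3 numeral_2_eq_2)
  then show ?case using Suc two_choose_2[of n] by (simp add: algebra_simps)
qed (simp add: numeral_3_eq_3)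

lemma prime_power_dvd_choose_3:
  assumes "Factorial_Ring.prime p" "odd p" "int p ^ Suc r dvd int n * (int n - 1) * (int n - 2)"
  shows "int p ^ r dvd int (n choose 3)"
  using prime_power_dvd_times_6[OF assms(1,2), of r "int (n choose 3)"] assms(3)
  by (simp add: six_choose_3)

text \<open>The exponent of \<open>A\<close> in (A C)^n = C^n A^(gsum \<alpha> n). The sum starts at
  exponent 1 because each new \<open>A\<close> is moved past at least one \<open>C\<close>.\<close>

definition gsum :: "int \<Rightarrow> nat \<Rightarrow> int" where
  "gsum a n = (\<Sum>i=1..n. a ^ i)"

lemma gsum_0 [simp]: "gsum a 0 = 0"
  by (simp add: gsum_def)

lemma gsum_Suc: "gsum a (Suc n) = gsum a n + a ^ Suc n"
  by (simp add: gsum_def)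

lemma gsum_Suc_left: "gsum a (Suc n) = a * (gsum a n + 1)"
proof (induction n)
  case (Suc n)
  have "gsum a (Suc (Suc n)) = a * (gsum a n + 1) + a ^ Suc (Suc n)"
    by (simp only: gsum_Suc[of a "Suc n"] Suc)
  also have "\<dots> = a * ((gsum a n + a ^ Suc n) + 1)" by (simp add: algebra_simps)
  finally show ?case by (simp only: gsum_Suc)
qed (simp add: gsum_Suc)

lemma gsum_add: "gsum a (n + k) = gsum a n + a ^ n * gsum a k"
  by (induction k) (simp_all add: gsum_Suc algebra_simps power_add)

text \<open>The second order expansions of (1+x)^i are added up; the hockey-stick identity turns the
  coefficients i and C(i,2) into C(n+1,2) and C(n+1,3).\<close>

lemma gsum_cube_dvd:
  fixes x :: int
  shows "x ^ 3 dvd gsum (1 + x) n - (int n + int (Suc n choose 2) * x + int (Suc n choose 3) * x ^ 2)"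
proof (induction n)
  case 0
  then show ?case by (simp add: numeral_2_eq_2 numeral_3_eq_3)
next
  case (Suc n)
  have c: "Suc (Suc n) choose 2 = (Suc n choose 2) + Suc n"
    "Suc (Suc n) choose 3 = (Suc n choose 3) + (Suc n choose 2)"
    by (simp_all add: numeral_2_eq_2 numeral_3_eq_3)
  have "gsum (1 + x) (Suc n) - (int (Suc n) + int (Suc (Suc n) choose 2) * x + int (Suc (Suc n) choose 3) * x ^ 2)
     = (gsum (1 + x) n - (int n + int (Suc n choose 2) * x + int (Suc n choose 3) * x ^ 2))
       + ((1 + x) ^ Suc n - (1 + int (Suc n) * x + int (Suc n choose 2) * x ^ 2))"
    unfolding c by (simp add: gsum_Suc algebra_simps)
  then show ?case
    using dvd_add[OF Suc one_plus_power_cube_dvd[of x "Suc n"]] by metis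
qed

text \<open>For \<open>\<alpha> = 1 + e\<close> this is the exponent \<open>y\<close> of \<open>A\<close> in the fundamental relation
  \<open>B^x C^(\<beta>+1) = C^(\<alpha>+1) A^y\<close>; it is \<open>- e\<^sup>2 / 2\<close> up to terms of higher valuation.\<close>

definition yval :: "nat \<Rightarrow> int" where
  "yval e = gsum (1 + int e) e - int e * (1 + int e) ^ Suc e"

text \<open>The terms of first order cancel and 2 \<open>yval e\<close> = e^2 (w - 1) remains, with
  p dividing w. From \<open>2 \<le> m\<close> comes p^2 | e, so that p divides the binomial C(e+1,3)
  inside w even when p = 3.\<close>

lemma yval_valuation:
  assumes "Factorial_Ring.prime p" "odd p" "2 \<le> m" "p ^ m dvd e" "\<not> p ^ Suc m dvd e"
  shows "int p ^ (2 * m) dvd yval e" "\<not> int p ^ Suc (2 * m) dvd yval e"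
proof -
  let ?e = "int e"
  define c2 c3 where "c2 = int (Suc e choose 2)" and "c3 = int (Suc e choose 3)"
  obtain z1 where "gsum (1 + ?e) e - (?e + c2 * ?e + c3 * ?e ^ 2) = ?e ^ 3 * z1"
    using gsum_cube_dvd[of ?e e] unfolding c2_def c3_def by (rule dvdE)
  then have z1: "gsum (1 + ?e) e = ?e + c2 * ?e + c3 * ?e ^ 2 + ?e ^ 3 * z1" by linarith
  obtain z2 where "(1 + ?e) ^ Suc e - (1 + int (Suc e) * ?e + c2 * ?e ^ 2) = ?e ^ 3 * z2"
    using one_plus_power_cube_dvd[of ?e "Suc e"] unfolding c2_def by (rule dvdE)
  then have z2: "(1 + ?e) ^ Suc e = 1 + (?e + 1) * ?e + c2 * ?e ^ 2 + ?e ^ 3 * z2" by (simp add: algebra_simps)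
  define w where "w = 2 * c3 + ?e * (2 * z1 - 1 - (?e + 1) * ?e - 2 * ?e * z2)"
  have t: "2 * c2 = (?e + 1) * ?e" using two_choose_2[of "Suc e"] by (simp add: c2_def)
  have "2 * yval e = 2 * ?e + (2 * c2) * ?e + 2 * c3 * ?e ^ 2 + 2 * ?e ^ 3 * z1
      - 2 * ?e * (1 + (?e + 1) * ?e) - (2 * c2) * ?e ^ 3 - 2 * ?e ^ 4 * z2"
    unfolding yval_def z1 z2 by (simp add: algebra_simps eval_nat_numeral)
  also have "\<dots> = ?e ^ 2 * (w - 1)"
    unfolding t w_def by (simp add: algebra_simps eval_nat_numeral)
  finally have y2: "2 * yval e = ?e ^ 2 * (w - 1)" .
  have pe: "int p ^ m dvd ?e" using assms(4) by (metis of_nat_dvd_iff of_nat_power)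
  have "int p ^ Suc 1 dvd ?e"
    using pe assms(3) dvd_trans[OF le_imp_power_dvd[of "Suc 1" m "int p"]] by simp
  then have "int p ^ 1 dvd c3" unfolding c3_def
    by (intro prime_power_dvd_choose_3[OF assms(1,2)]) simp
  moreover have "int p dvd ?e" using pe assms(3) dvd_trans[OF le_imp_power_dvd[of 1 m "int p"] pe] by simp
  ultimately have pw: "int p dvd w" unfolding w_def by simp
  have "int p ^ (2 * m) dvd ?e ^ 2"
    using dvd_power_same[OF pe, of 2] by (simp add: power_mult[symmetric] mult.commute)
  then have "int p ^ (2 * m) dvd 2 * yval e" unfolding y2 by (rule dvd_mult2)
  then show "int p ^ (2 * m) dvd yval e" by (rule odd_power_dvd_times_2[OF assms(2)])
  show "\<not> int p ^ Suc (2 * m) dvd yval e"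
  proof
    assume "int p ^ Suc (2 * m) dvd yval e"
    then have d: "int p ^ Suc (2 * m) dvd ?e ^ 2 * (w - 1)" 
      using dvd_mult[of _ "yval e" 2] by (simp only: y2)
    obtain v where v: "?e = int p ^ m * v" using pe by (auto simp: dvd_def)
    have "int p ^ (2 * m) * int p dvd int p ^ (2 * m) * (v ^ 2 * (w - 1))"
    proof -
      have "(int p ^ m) ^ 2 = int p ^ (2 * m)" by (simp add: power_mult[symmetric] mult.commute)
      then show ?thesis using d by (simp add: v power_mult_distrib mult.assoc mult.commute[of "int p"])
    qed
    then have "int p dvd v ^ 2 * (w - 1)"
      using assms(1) by (simp only: dvd_mult_cancel_left) (auto simp: prime_gt_0_nat)
    moreover have "Factorial_Ring.prime (int p)" using assms(1) by simp
    ultimately have "int p dvd v \<or> int p dvd w - 1"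
      using prime_dvd_mult_iff prime_dvd_power by blast
    then show False
    proof
      assume "int p dvd v"
      then have "int p ^ Suc m dvd ?e" by (simp add: v)
      then show False using assms(5) by (metis of_nat_dvd_iff of_nat_power)
    next
      assume "int p dvd w - 1"
      then have "int p dvd 1" using dvd_diff[OF pw, of "w - 1"] by simp
      then show False using assms(1) by (metis not_prime_1 of_nat_1 of_nat_dvd_iff nat_dvd_1_iff_1)
    qed
  qed
qed

text \<open>Both terms are k modulo p^(3m). The difference is the exponent of \<open>B\<close> left
  over in \<open>cj_A_relation\<close>; its divisibility by p^(3m) is what allows that power of
  \<open>B\<close> to be traded for a power of \<open>C\<close>.\<close>

lemma gsum_minus_power_dvd:
  assumes "Factorial_Ring.prime p" "odd p" "2 \<le> m" "int p ^ m dvd x" "p ^ (2 * m) dvd k"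
  shows "int p ^ (3 * m) dvd gsum (1 + x) k - int k * (1 + x) ^ k"
proof -
  have k: "int p ^ (2 * m) dvd int k" using assms(5) by (metis of_nat_dvd_iff of_nat_power)
  have x3: "int p ^ (3 * m) dvd x ^ 3"
    using dvd_power_same[OF assms(4), of 3] by (simp add: power_mult[symmetric] mult.commute)
  have x2: "int p ^ (2 * m) dvd x ^ 2"
    using dvd_power_same[OF assms(4), of 2] by (simp add: power_mult[symmetric] mult.commute)
  have s: "3 * m = 2 * m + m" by simp
  have "int p ^ (2 * m) dvd 2 * int (Suc k choose 2)" using k by (simp add: two_choose_2)
  then have "int p ^ (2 * m) dvd int (Suc k choose 2)" by (rule odd_power_dvd_times_2[OF assms(2)])
  then have a1: "int p ^ (3 * m) dvd int (Suc k choose 2) * x"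
    unfolding s power_add using assms(4) by (rule mult_dvd_mono)
  have "int p ^ Suc m dvd int k"
    using k assms(3) dvd_trans[OF le_imp_power_dvd[of "Suc m" "2 * m" "int p"]] by simp
  then have "int p ^ m dvd int (Suc k choose 3)"
    by (intro prime_power_dvd_choose_3[OF assms(1,2)]) simp
  then have a2: "int p ^ (3 * m) dvd int (Suc k choose 3) * x ^ 2"
    unfolding s power_add using x2 mult_dvd_mono by (metis mult.commute)
  have "int p ^ m dvd (1 + x) ^ k - 1"
    using one_plus_power_dvd[OF assms(1,2) _ assms(4), of 0 k] assms(3) by simp
  then have a3: "int p ^ (3 * m) dvd int k * ((1 + x) ^ k - 1)"
    unfolding s power_add using k mult_dvd_mono by blast
  have "gsum (1 + x) k - int k * (1 + x) ^ k
    = (gsum (1 + x) k - (int k + int (Suc k choose 2) * x + int (Suc k choose 3) * x ^ 2))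
      + int (Suc k choose 2) * x + int (Suc k choose 3) * x ^ 2 - int k * ((1 + x) ^ k - 1)"
    by (simp add: algebra_simps)
  then show ?thesis
    by (simp only:) (intro dvd_diff dvd_add a1 a2 a3 dvd_trans[OF x3 gsum_cube_dvd[of x k]])
qed

section \<open>Consequences of the relations\<close>

context group
begin

lemma mult_inv_cancel_left [simp]:
  "g \<in> carrier G \<Longrightarrow> z \<in> carrier G \<Longrightarrow> g \<otimes> (inv g \<otimes> z) = z"
  "g \<in> carrier G \<Longrightarrow> z \<in> carrier G \<Longrightarrow> inv g \<otimes> (g \<otimes> z) = z"
  by (simp_all add: m_assoc[symmetric])

definition cj :: "'a \<Rightarrow> 'a \<Rightarrow> 'a" where
  "cj g x = inv g \<otimes> x \<otimes> g"

lemma cj_closed [simp]: "g \<in> carrier G \<Longrightarrow> x \<in> carrier G \<Longrightarrow> cj g x \<in> carrier G"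
  by (simp add: cj_def)

lemma cj_eqI: "g \<in> carrier G \<Longrightarrow> x \<in> carrier G \<Longrightarrow> y \<in> carrier G \<Longrightarrow> x \<otimes> g = g \<otimes> y \<Longrightarrow> cj g x = y"
  by (simp add: cj_def m_assoc inv_solve_left')

lemma cj_swap: "g \<in> carrier G \<Longrightarrow> x \<in> carrier G \<Longrightarrow> x \<otimes> g = g \<otimes> cj g x"
  by (simp add: cj_def m_assoc[symmetric])

lemma cj_mult: "g \<in> carrier G \<Longrightarrow> x \<in> carrier G \<Longrightarrow> y \<in> carrier G \<Longrightarrow> cj g (x \<otimes> y) = cj g x \<otimes> cj g y"
  by (simp add: cj_def m_assoc)

lemma cj_int_pow: "g \<in> carrier G \<Longrightarrow> x \<in> carrier G \<Longrightarrow> cj g (x [^] (i::int)) = cj g x [^] i"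
  using hom_int_pow[of "cj g" G G x i] by (simp add: hom_def cj_mult group_axioms)

lemma cj_cj: "g \<in> carrier G \<Longrightarrow> h \<in> carrier G \<Longrightarrow> x \<in> carrier G \<Longrightarrow> cj h (cj g x) = cj (g \<otimes> h) x"
  by (simp add: cj_def m_assoc inv_mult_group)

lemma cj_inv_cancel: "g \<in> carrier G \<Longrightarrow> x \<in> carrier G \<Longrightarrow> cj g (cj (inv g) x) = x"
  by (simp add: cj_cj) (simp add: cj_def)

lemma cj_commute: "g \<in> carrier G \<Longrightarrow> x \<in> carrier G \<Longrightarrow> x \<otimes> g = g \<otimes> x \<Longrightarrow> cj g x = x"
  by (rule cj_eqI) auto

lemma int_pow_commute: "x \<in> carrier G \<Longrightarrow> x [^] (i::int) \<otimes> x [^] (j::int) = x [^] j \<otimes> x [^] i"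
  by (simp add: int_pow_mult[symmetric] add.commute)

lemma int_pow_add_left: "x \<in> carrier G \<Longrightarrow> z \<in> carrier G \<Longrightarrow>
    x [^] (i::int) \<otimes> (x [^] (j::int) \<otimes> z) = x [^] (i + j) \<otimes> z"
  by (simp add: int_pow_mult m_assoc)

end

text \<open>The relations written without inverses: \<open>AB\<close> says C = [A,B],
  \<open>AC\<close> says A^C = A^\<alpha>, and \<open>CB\<close> says that C^-1 = [B,A] conjugates B
  to B^\<beta>. The locale serves the presented group, the permutation model, and one group under
  several pairs of exponents.\<close>

locale macdonald_group = group G for G (structure) +
  fixes A B C :: 'a and \<alpha> \<beta> :: int
  assumes closed [simp]: "A \<in> carrier G" "B \<in> carrier G" "C \<in> carrier G"
    and AB: "A \<otimes> B = B \<otimes> A \<otimes> C"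
    and AC: "A \<otimes> C = C \<otimes> A [^] \<alpha>"
    and CB: "C \<otimes> B = B [^] \<beta> \<otimes> C"
begin

text \<open>Since [B,A] is the inverse of [A,B], the relations are symmetric. Results on
  \<open>A\<close> and \<alpha> are transferred to \<open>B\<close> and \<beta> through this
  instance.\<close>

lemma swap: "macdonald_group G B A (inv C) \<beta> \<alpha>"
proof unfold_locales
  show "B \<otimes> A = A \<otimes> B \<otimes> inv C" by (simp add: AB m_assoc)
  have "C \<otimes> B \<otimes> inv C = B [^] \<beta>" by (simp add: CB m_assoc)
  then show "B \<otimes> inv C = inv C \<otimes> B [^] \<beta>"
    by (simp add: inv_solve_left m_assoc)
  have "inv C \<otimes> A \<otimes> C = A [^] \<alpha>" by (simp add: AC m_assoc inv_solve_left')
  then show "inv C \<otimes> A = A [^] \<alpha> \<otimes> inv C"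
    by (metis AC closed inv_closed int_pow_closed m_assoc m_closed r_inv r_one l_inv l_one)
qed simp_all

lemma cj_C_A: "cj C (A [^] i) = A [^] (i * \<alpha>)"
  using cj_eqI[of C A "A [^] \<alpha>"] by (simp add: AC cj_int_pow int_pow_pow mult.commute)

lemma cj_invC_B: "cj (inv C) (B [^] i) = B [^] (i * \<beta>)"
  by (rule macdonald_group.cj_C_A[OF swap])

lemma cj_B_A: "cj B A = A \<otimes> C"
  by (rule cj_eqI) (simp_all add: AB m_assoc)

lemma cj_A_B: "cj A B = B \<otimes> inv C"
  by (rule macdonald_group.cj_B_A[OF swap])

lemma A_C_pow: "A [^] i \<otimes> C [^] int k = C [^] int k \<otimes> A [^] (i * \<alpha> ^ k)"
proof (induction k)
  case (Suc k)
  have "A [^] i \<otimes> C [^] int (Suc k) = (A [^] i \<otimes> C [^] int k) \<otimes> C"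
    by (simp add: int_pow_mult m_assoc add.commute[of 1])
  also have "\<dots> = C [^] int k \<otimes> (A [^] (i * \<alpha> ^ k) \<otimes> C)"
    by (simp add: Suc m_assoc)
  also have "A [^] (i * \<alpha> ^ k) \<otimes> C = C \<otimes> A [^] (i * \<alpha> ^ k * \<alpha>)"
    using cj_swap[of C "A [^] (i * \<alpha> ^ k)"] by (simp add: cj_C_A)
  also have "C [^] int k \<otimes> (C \<otimes> A [^] (i * \<alpha> ^ k * \<alpha>)) = C [^] int (Suc k) \<otimes> A [^] (i * \<alpha> ^ Suc k)"
    by (simp add: int_pow_mult m_assoc add.commute[of 1] mult_ac)
  finally show ?case .
qed simp

lemma AC_pow: "(A \<otimes> C) [^] int k = C [^] int k \<otimes> A [^] gsum \<alpha> k"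
proof (induction k)
  case (Suc k)
  have "(A \<otimes> C) [^] int (Suc k) = (C [^] int k \<otimes> A [^] gsum \<alpha> k) \<otimes> (A \<otimes> C)"
    by (simp add: int_pow_mult Suc[symmetric] add.commute[of 1])
  also have "\<dots> = C [^] int k \<otimes> (A [^] (gsum \<alpha> k + 1) \<otimes> C [^] int 1)"
    by (simp add: int_pow_mult m_assoc)
  also have "\<dots> = C [^] int (Suc k) \<otimes> A [^] gsum \<alpha> (Suc k)"
    unfolding A_C_pow by (simp add: int_pow_mult m_assoc add.commute[of 1] gsum_Suc_left mult.commute)
  finally show ?case .
qed simp

lemma cj_B_A_pow: "cj B (A [^] int k) = C [^] int k \<otimes> A [^] gsum \<alpha> k"
  by (simp add: cj_int_pow cj_B_A AC_pow)

lemma cj_A_B_pow: "cj A (B [^] int k) = C [^] (- int k) \<otimes> B [^] gsum \<beta> k"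
  using macdonald_group.cj_B_A_pow[OF swap, of k] by (simp add: int_pow_inv int_pow_neg)

lemma C_B_pow: "C [^] int k \<otimes> B [^] i = B [^] (i * \<beta> ^ k) \<otimes> C [^] int k"
proof -
  have e: "inv C [^] int k = C [^] (- int k)"
    by (simp add: int_pow_inv int_pow_neg)
  have "B [^] i \<otimes> C [^] (- int k) = C [^] (- int k) \<otimes> B [^] (i * \<beta> ^ k)"
    using macdonald_group.A_C_pow[OF swap, of i k] unfolding e .
  then have "C [^] int k \<otimes> (B [^] i \<otimes> C [^] (- int k)) \<otimes> C [^] int k
      = C [^] int k \<otimes> (C [^] (- int k) \<otimes> B [^] (i * \<beta> ^ k)) \<otimes> C [^] int k" by simp
  then show ?thesis
    by (simp add: m_assoc int_pow_mult[symmetric]) (simp add: int_pow_add_left)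
qed

lemma B_C_neg_pow: "B [^] i \<otimes> C [^] (- int k) = C [^] (- int k) \<otimes> B [^] (i * \<beta> ^ k)"
  using macdonald_group.A_C_pow[OF swap, of i k] by (simp add: int_pow_inv int_pow_neg)

lemma C_neg_A_pow: "C [^] (- int k) \<otimes> A [^] i = A [^] (i * \<alpha> ^ k) \<otimes> C [^] (- int k)"
  using macdonald_group.C_B_pow[OF swap, of k i] by (simp add: int_pow_inv int_pow_neg)

lemma cj_A_C: "cj A C = C \<otimes> A [^] (1 - \<alpha>)"
proof (rule cj_eqI)
  have "A \<otimes> (C \<otimes> A [^] (1 - \<alpha>)) = C \<otimes> (A [^] \<alpha> \<otimes> A [^] (1 - \<alpha>))"
    by (simp add: AC m_assoc[symmetric])
  then show "C \<otimes> A = A \<otimes> (C \<otimes> A [^] (1 - \<alpha>))" by (simp add: int_pow_mult[symmetric])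
qed simp_all

lemma cj_B_C: "cj B C = B [^] (\<beta> - 1) \<otimes> C"
proof (rule cj_eqI)
  have "B \<otimes> (B [^] (\<beta> - 1) \<otimes> C) = B [^] (1::int) \<otimes> (B [^] (\<beta> - 1) \<otimes> C)" by simp
  also have "\<dots> = B [^] \<beta> \<otimes> C" by (simp only: int_pow_add_left closed int_pow_closed) simp
  finally show "C \<otimes> B = B \<otimes> (B [^] (\<beta> - 1) \<otimes> C)" by (simp add: CB)
qed simp_all

text \<open>Both sides are the conjugate of \<open>C\<close> by \<open>A B = B A C\<close>.\<close>

lemma key_identity:
  "B [^] (\<beta> - 1) \<otimes> C \<otimes> (A \<otimes> C) [^] (1 - \<alpha>)
    = inv C \<otimes> (B \<otimes> inv C) [^] (\<beta> - 1) \<otimes> C \<otimes> C \<otimes> A [^] ((1 - \<alpha>) * \<alpha>)"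
proof -
  have "cj (A \<otimes> B) C = cj B (C \<otimes> A [^] (1 - \<alpha>))" by (simp add: cj_cj[symmetric] cj_A_C)
  also have "\<dots> = B [^] (\<beta> - 1) \<otimes> C \<otimes> (A \<otimes> C) [^] (1 - \<alpha>)"
    by (simp add: cj_mult cj_B_C cj_int_pow cj_B_A)
  finally have 1: "cj (A \<otimes> B) C = B [^] (\<beta> - 1) \<otimes> C \<otimes> (A \<otimes> C) [^] (1 - \<alpha>)" .
  have "cj (B \<otimes> A \<otimes> C) C = cj C (cj A (B [^] (\<beta> - 1) \<otimes> C))"
    by (simp add: cj_cj[symmetric] cj_B_C)
  also have "cj A (B [^] (\<beta> - 1) \<otimes> C) = (B \<otimes> inv C) [^] (\<beta> - 1) \<otimes> (C \<otimes> A [^] (1 - \<alpha>))"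
    by (simp add: cj_mult cj_int_pow cj_A_B cj_A_C)
  also have "cj C \<dots> = inv C \<otimes> (B \<otimes> inv C) [^] (\<beta> - 1) \<otimes> C \<otimes> (cj C C \<otimes> cj C (A [^] (1 - \<alpha>)))"
    by (simp add: cj_mult) (simp add: cj_def)
  also have "cj C C \<otimes> cj C (A [^] (1 - \<alpha>)) = C \<otimes> A [^] ((1 - \<alpha>) * \<alpha>)"
    by (simp add: cj_C_A cj_commute)
  finally have 2: "cj (B \<otimes> A \<otimes> C) C = inv C \<otimes> (B \<otimes> inv C) [^] (\<beta> - 1) \<otimes> C \<otimes> C \<otimes> A [^] ((1 - \<alpha>) * \<alpha>)"
    by (simp add: m_assoc)
  show ?thesis using 1 2 AB by simp
qed

end

section \<open>Finiteness\<close>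

context macdonald_group
begin

text \<open>The index \<open>k\<close> is the exponent of \<open>C\<close> modulo the normal closure of \<open>A\<close> in \<open>\<langle>A, C\<rangle>\<close>. The form
  \<open>C^u A^y C^-v\<close> is needed because \<open>C A C^-1\<close> need not be a power of \<open>A\<close> before \<open>A\<close> is known to have
  finite order.\<close>

definition VA :: "int \<Rightarrow> 'a set" where
  "VA k = {C [^] int u \<otimes> A [^] (y::int) \<otimes> C [^] (- int v) | u v y. int u - int v = k}"

lemma VA_closed: "x \<in> VA k \<Longrightarrow> x \<in> carrier G"
  by (auto simp: VA_def)

lemma VA_I: "int u - int v = k \<Longrightarrow> C [^] int u \<otimes> A [^] (y::int) \<otimes> C [^] (- int v) \<in> VA k"
  by (auto simp: VA_def)

lemma A_pow_VA: "A [^] (i::int) \<in> VA 0"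
  using VA_I[of 0 0 0 i] by simp

lemma C_pow_VA: "C [^] (i::int) \<in> VA i"
proof (cases i rule: int_cases2)
  case (nonneg k)
  then show ?thesis using VA_I[of k 0 i 0] by simp
next
  case (nonpos k)
  then show ?thesis using VA_I[of 0 k i 0] by simp
qed

text \<open>Only the middle factor C^(u'-v) is in the way. If its exponent is nonnegative it moves
  left past a power of \<open>A\<close>, otherwise it moves right; in both cases \<open>A\<close> is
  raised to a natural power of \<alpha>, so no inverse of \<alpha> is required.\<close>

lemma mult_VA:
  assumes "x \<in> VA k" "y \<in> VA k'"
  shows "x \<otimes> y \<in> VA (k + k')"
proof -
  obtain u v i where x: "x = C [^] int u \<otimes> A [^] (i::int) \<otimes> C [^] (- int v)" "int u - int v = k"
    using assms(1) by (auto simp: VA_def)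
  obtain u' v' i' where y: "y = C [^] int u' \<otimes> A [^] (i'::int) \<otimes> C [^] (- int v')" "int u' - int v' = k'"
    using assms(2) by (auto simp: VA_def)
  have xy: "x \<otimes> y = C [^] int u \<otimes> (A [^] i \<otimes> (C [^] (int u' - int v) \<otimes> (A [^] i' \<otimes> C [^] (- int v'))))"
    unfolding x y by (simp add: m_assoc int_pow_add_left)
  show ?thesis
  proof (cases "v \<le> u'")
    case True
    define w where "w = u' - v"
    have w: "int u' - int v = int w" using True by (simp add: w_def)
    have "A [^] i \<otimes> (C [^] int w \<otimes> (A [^] i' \<otimes> C [^] (- int v')))
       = (A [^] i \<otimes> C [^] int w) \<otimes> (A [^] i' \<otimes> C [^] (- int v'))"
      by (simp add: m_assoc)
    also have "\<dots> = C [^] int w \<otimes> (A [^] (i * \<alpha> ^ w + i') \<otimes> C [^] (- int v'))"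
      by (simp add: A_C_pow m_assoc int_pow_add_left)
    finally have "x \<otimes> y = C [^] int (u + w) \<otimes> A [^] (i * \<alpha> ^ w + i') \<otimes> C [^] (- int v')"
      unfolding xy w by (simp add: int_pow_add_left m_assoc)
    moreover have "int (u + w) - int v' = k + k'" using x(2) y(2) w by simp
    ultimately show ?thesis using VA_I by metis
  next
    case False
    define w where "w = v - u'"
    have w: "int u' - int v = - int w" using False by (simp add: w_def)
    have "C [^] (- int w) \<otimes> (A [^] i' \<otimes> C [^] (- int v')) = (C [^] (- int w) \<otimes> A [^] i') \<otimes> C [^] (- int v')"
      by (simp add: m_assoc)
    also have "\<dots> = A [^] (i' * \<alpha> ^ w) \<otimes> (C [^] (- int w) \<otimes> C [^] (- int v'))"
      by (simp add: C_neg_A_pow m_assoc)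
    also have "C [^] (- int w) \<otimes> C [^] (- int v') = C [^] (- int (w + v'))"
      by (simp add: int_pow_mult[symmetric])
    finally have "x \<otimes> y = C [^] int u \<otimes> A [^] (i + i' * \<alpha> ^ w) \<otimes> C [^] (- int (w + v'))"
      unfolding xy w by (simp add: int_pow_add_left m_assoc)
    moreover have "int u - int (w + v') = k + k'" using x(2) y(2) w by simp
    ultimately show ?thesis using VA_I by metis
  qed
qed

lemma inv_VA:
  assumes "x \<in> VA k"
  shows "inv x \<in> VA (- k)"
proof -
  obtain u v i where x: "x = C [^] int u \<otimes> A [^] (i::int) \<otimes> C [^] (- int v)" "int u - int v = k"
    using assms(1) by (auto simp: VA_def)
  have "inv x = C [^] int v \<otimes> A [^] (- i) \<otimes> C [^] (- int u)"
    unfolding x by (simp add: inv_mult_group m_assoc int_pow_neg)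
  then show ?thesis using VA_I[of v u "- k" "- i"] x(2) by simp
qed

lemma int_pow_VA:
  assumes "x \<in> VA k"
  shows "x [^] (i::int) \<in> VA (k * i)"
proof -
  have x: "x \<in> carrier G" using assms by (rule VA_closed)
  have *: "x [^] int t \<in> VA (k * int t)" for t
  proof (induction t)
    case 0
    then show ?case using C_pow_VA[of 0] by simp
  next
    case (Suc t)
    have "x [^] int (Suc t) = x [^] int t \<otimes> x" using x by (simp add: int_pow_mult add.commute[of 1])
    then show ?case
      using mult_VA[OF Suc assms] by (simp add: algebra_simps)
  qed
  show ?thesis
  proof (cases i rule: int_cases2)
    case (nonneg t)
    then show ?thesis using * by simp
  next
    case (nonpos t)
    then show ?thesis using inv_VA[OF *[of t]] x by (simp add: int_pow_neg)
  qed
qed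

lemma VA_one:
  assumes "\<one> \<in> VA k"
  shows "\<exists>y::int. C [^] (- k) = A [^] y"
proof -
  obtain u v y where y: "\<one> = C [^] int u \<otimes> A [^] (y::int) \<otimes> C [^] (- int v)" "int u - int v = k"
    using assms by (auto simp: VA_def)
  have "C [^] (- int u) \<otimes> \<one> \<otimes> C [^] int v = C [^] (- int u) \<otimes> (C [^] int u \<otimes> A [^] y \<otimes> C [^] (- int v)) \<otimes> C [^] int v"
    by (simp only: y(1))
  also have "\<dots> = A [^] y"
    by (simp add: m_assoc int_pow_mult[symmetric]) (simp add: int_pow_add_left)
  finally have "C [^] (- int u + int v) = A [^] y" by (simp add: int_pow_mult[symmetric])
  then show ?thesis using y(2) by (auto simp: algebra_simps)
qed

text \<open>By the mirrored form of \<open>VA\<close>, the factor (B C^-1)^(\<beta>-1) of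
  \<open>key_identity\<close> has the shape C^-u B^x C^v with u - v = \<beta> - 1. Pulling the
  powers of \<open>C\<close> on the left through B^(\<beta>-1) separates the powers of
  \<open>B\<close> from factors lying in \<open>VA\<close>, and the indices add up to \<alpha> -
  \<beta>.\<close>

lemma B_pow_VA: "\<exists>x::int. B [^] x \<in> VA (\<alpha> - \<beta>)"
proof -
  interpret S: macdonald_group G B A "inv C" \<beta> \<alpha> by (rule swap)
  have "B \<otimes> inv C \<in> S.VA 1"
    using S.mult_VA[OF S.A_pow_VA[of 1] S.C_pow_VA[of 1]] by simp
  then have "(B \<otimes> inv C) [^] (\<beta> - 1) \<in> S.VA (\<beta> - 1)" using S.int_pow_VA by fastforce
  then obtain u v x where x: "(B \<otimes> inv C) [^] (\<beta> - 1) = C [^] (- int u) \<otimes> B [^] (x::int) \<otimes> C [^] int v"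
      "int u - int v = \<beta> - 1"
    by (auto simp: S.VA_def int_pow_inv int_pow_neg)
  define v1 where "v1 = C \<otimes> (A \<otimes> C) [^] (1 - \<alpha>)"
  define v2 where "v2 = C [^] (int v + 2) \<otimes> A [^] ((1 - \<alpha>) * \<alpha>)"
  have "A \<otimes> C \<in> VA 1" using mult_VA[OF A_pow_VA[of 1] C_pow_VA[of 1]] by simp
  then have v1: "v1 \<in> VA (2 - \<alpha>)"
    using mult_VA[OF C_pow_VA[of 1] int_pow_VA[of "A \<otimes> C" 1 "1 - \<alpha>"]] by (simp add: v1_def)
  have v2: "v2 \<in> VA (int v + 2)"
    using mult_VA[OF C_pow_VA[of "int v + 2"] A_pow_VA] by (simp add: v2_def)
  have v1c: "v1 \<in> carrier G" and v2c: "v2 \<in> carrier G" using v1 v2 VA_closed by auto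
  let ?w = "1 + u"
  have "B [^] (\<beta> - 1) \<otimes> v1 = inv C \<otimes> (C [^] (- int u) \<otimes> B [^] x \<otimes> C [^] int v) \<otimes> C \<otimes> C \<otimes> A [^] ((1 - \<alpha>) * \<alpha>)"
    using key_identity by (simp add: v1_def m_assoc x(1))
  also have "\<dots> = C [^] (- 1 :: int) \<otimes> (C [^] (- int u) \<otimes> (B [^] x \<otimes> (C [^] int v \<otimes>
      (C [^] (1::int) \<otimes> (C [^] (1::int) \<otimes> A [^] ((1 - \<alpha>) * \<alpha>))))))"
    by (simp add: m_assoc int_pow_neg)
  also have "\<dots> = C [^] (- int ?w) \<otimes> (B [^] x \<otimes> v2)"
    by (simp add: v2_def int_pow_add_left del: int_pow_1)
  finally have e: "B [^] (\<beta> - 1) \<otimes> v1 = C [^] (- int ?w) \<otimes> (B [^] x \<otimes> v2)" .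
  have "C [^] int ?w \<otimes> (B [^] (\<beta> - 1) \<otimes> v1) = B [^] x \<otimes> v2"
    unfolding e using v2c by (simp add: int_pow_add_left del: of_nat_add)
  moreover have "C [^] int ?w \<otimes> (B [^] (\<beta> - 1) \<otimes> v1) = (C [^] int ?w \<otimes> B [^] (\<beta> - 1)) \<otimes> v1"
    using v1c by (simp add: m_assoc)
  ultimately have "B [^] ((\<beta> - 1) * \<beta> ^ ?w) \<otimes> (C [^] int ?w \<otimes> v1) = B [^] x \<otimes> v2"
    using v1c unfolding C_B_pow by (simp add: m_assoc)
  then have "B [^] (- x) \<otimes> (B [^] ((\<beta> - 1) * \<beta> ^ ?w) \<otimes> (C [^] int ?w \<otimes> v1)) = v2"
    using v2c by (simp add: int_pow_add_left)
  then have "B [^] (- x + (\<beta> - 1) * \<beta> ^ ?w) \<otimes> (C [^] int ?w \<otimes> v1) = v2"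
    using v1c by (simp only: int_pow_add_left closed int_pow_closed m_closed)
  then have "B [^] (- x + (\<beta> - 1) * \<beta> ^ ?w) = v2 \<otimes> inv (C [^] int ?w \<otimes> v1)"
    using v1c v2c inv_solve_right by simp
  also have "\<dots> \<in> VA (int v + 2 + - (int ?w + (2 - \<alpha>)))"
    by (intro mult_VA inv_VA v1 v2 C_pow_VA)
  also have "int v + 2 + - (int ?w + (2 - \<alpha>)) = \<alpha> - \<beta>" using x(2) by simp
  finally show ?thesis by blast
qed

text \<open>Conjugation by C^-1 keeps the index of an element of \<open>VA\<close>, but it also
  raises B^x to the power \<beta> and so multiplies the index by \<beta>. One element with two
  indices puts the neutral element into \<open>VA\<close> with their difference as index, and
  \<open>VA_one\<close> applies.\<close>

lemma C_pow_in_A: "\<exists>y::int. C [^] ((\<alpha> - \<beta>) * (\<beta> - 1)) = A [^] y"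
proof -
  obtain x :: int where x: "B [^] x \<in> VA (\<alpha> - \<beta>)" using B_pow_VA by blast
  have "(B [^] x) [^] \<beta> \<in> VA ((\<alpha> - \<beta>) * \<beta>)" using int_pow_VA[OF x] .
  moreover have "(B [^] x) [^] \<beta> = cj (inv C) (B [^] x)"
    by (simp add: cj_invC_B int_pow_pow)
  moreover have "cj (inv C) (B [^] x) \<in> VA (1 + (\<alpha> - \<beta>) + - 1)"
    using mult_VA[OF mult_VA[OF C_pow_VA[of 1] x] C_pow_VA[of "- 1"]]
    by (simp add: cj_def int_pow_neg)
  ultimately have g: "cj (inv C) (B [^] x) \<in> VA ((\<alpha> - \<beta>) * \<beta>)" "cj (inv C) (B [^] x) \<in> VA (\<alpha> - \<beta>)"
    by simp_all
  have "\<one> = inv (cj (inv C) (B [^] x)) \<otimes> cj (inv C) (B [^] x)" by simp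
  also have "\<dots> \<in> VA (- ((\<alpha> - \<beta>) * \<beta>) + (\<alpha> - \<beta>))"
    by (intro mult_VA inv_VA g)
  finally show ?thesis using VA_one by (force simp: algebra_simps)
qed

text \<open>Some C^k with k > 0 is a power of \<open>A\<close>, hence commutes with
  \<open>A\<close>, while it conjugates A to A^(\<alpha>^k). So A^(\<alpha>^k - 1) is trivial, and
  this exponent is not 0 because \<alpha> has absolute value above 1.\<close>

lemma A_finite_order:
  assumes "\<alpha> \<noteq> \<beta>" "\<beta> \<noteq> 1" "1 < \<bar>\<alpha>\<bar>"
  shows "\<exists>N>0. A [^] int N = \<one>" "\<exists>N>0. C [^] int N = \<one>"
proof -
  obtain y where y: "C [^] ((\<alpha> - \<beta>) * (\<beta> - 1)) = A [^] (y::int)" using C_pow_in_A by blast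
  define k where "k = nat \<bar>(\<alpha> - \<beta>) * (\<beta> - 1)\<bar>"
  have k0: "0 < k" using assms by (simp add: k_def)
  obtain z where z: "C [^] int k = A [^] (z::int)"
  proof (cases "0 \<le> (\<alpha> - \<beta>) * (\<beta> - 1)")
    case True
    then show ?thesis using y that by (simp add: k_def)
  next
    case False
    then have "int k = - ((\<alpha> - \<beta>) * (\<beta> - 1))" by (simp add: k_def)
    then have "C [^] int k = A [^] (- y)" using y by (simp add: int_pow_neg)
    then show ?thesis using that by blast
  qed
  have "A [^] (1::int) \<otimes> C [^] int k = C [^] int k \<otimes> A [^] (1 * \<alpha> ^ k)" by (rule A_C_pow)
  then have "A [^] (1 + z) = A [^] (z + \<alpha> ^ k)" unfolding z by (simp add: int_pow_mult)
  then have d: "int (ord A) dvd \<alpha> ^ k - 1"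
    by (simp add: int_pow_eq)
  have "1 < \<bar>\<alpha>\<bar> ^ k" using assms(3) k0 by simp
  then have "\<alpha> ^ k \<noteq> 1" by (auto simp: power_abs[symmetric])
  with d have o: "0 < ord A" by (intro gr0I) auto
  then show "\<exists>N>0. A [^] int N = \<one>"
    by (intro exI[of _ "ord A"]) (simp add: int_pow_eq_id)
  have "C [^] (int k * int (ord A)) = (C [^] int k) [^] int (ord A)" by (simp add: int_pow_pow)
  also have "\<dots> = A [^] (z * int (ord A))" unfolding z by (simp add: int_pow_pow)
  also have "\<dots> = \<one>" by (simp add: int_pow_eq_id)
  finally show "\<exists>N>0. C [^] int N = \<one>"
    using k0 o by (intro exI[of _ "k * ord A"]) simp
qed

text \<open>The set of these products contains the neutral element and is stable under right
  multiplication by the generators. Finite orders of \<open>A\<close> and \<open>B\<close> turn all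
  their exponents, including those of the inverses, into natural numbers, for which the commutation
  rules are available.\<close>

lemma carrier_BCA:
  assumes gen: "carrier G = generate G {A, B}"
    and NA: "0 < NA" "A [^] int NA = \<one>" and NB: "0 < NB" "B [^] int NB = \<one>"
    and g: "g \<in> carrier G"
  shows "\<exists>j k i :: nat. g = B [^] int j \<otimes> C [^] int k \<otimes> A [^] int i"
proof -
  define S where "S = {B [^] int j \<otimes> C [^] int k \<otimes> A [^] int i | j k i. True}"
  have SG: "S \<subseteq> carrier G" by (auto simp: S_def)
  have SA: "s \<otimes> A [^] int t \<in> S" if s: "s \<in> S" for s t
  proof -
    obtain j k i where "s = B [^] int j \<otimes> C [^] int k \<otimes> A [^] int i" using s by (auto simp: S_def)
    then have "s \<otimes> A [^] int t = B [^] int j \<otimes> C [^] int k \<otimes> A [^] int (i + t)"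
      by (simp add: m_assoc int_pow_mult)
    then show ?thesis by (auto simp: S_def simp del: of_nat_add)
  qed
  have A_nat: "\<exists>t::nat. A [^] (i::int) = A [^] int t" for i
  proof -
    have "int (ord A) dvd int NA" using NA(2) by (simp add: int_pow_eq_id)
    then have "A [^] i = A [^] (i mod int NA)"
      unfolding int_pow_eq[OF closed(1)] by (meson dvd_minus_mod dvd_trans dvd_diff_commute)
    moreover have "0 \<le> i mod int NA" using NA(1) by simp
    ultimately show ?thesis by (metis nonneg_int_cases)
  qed
  have B_nat: "\<exists>t::nat. B [^] (i::int) = B [^] int t" for i
  proof -
    have "int (ord B) dvd int NB" using NB(2) by (simp add: int_pow_eq_id)
    then have "B [^] i = B [^] (i mod int NB)"
      unfolding int_pow_eq[OF closed(2)] by (meson dvd_minus_mod dvd_trans dvd_diff_commute)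
    moreover have "0 \<le> i mod int NB" using NB(1) by simp
    ultimately show ?thesis by (metis nonneg_int_cases)
  qed
  \<comment> \<open>The rewriting uses A^i B = B C^i A^(gsum \<alpha> i) and C^k B = B^(\<beta>^k)
    C^k. The resulting triple is the map \<open>fB\<close> of the permutation model.\<close>
  have SB1: "s \<otimes> B \<in> S" if s: "s \<in> S" for s
  proof -
    obtain j k i where s: "s = B [^] int j \<otimes> C [^] int k \<otimes> A [^] int i" using s by (auto simp: S_def)
    obtain i' where i': "A [^] gsum \<alpha> i = A [^] int i'" using A_nat by blast
    obtain j' where j': "B [^] (int j + \<beta> ^ k) = B [^] int j'" using B_nat by blast
    have "s \<otimes> B = B [^] int j \<otimes> (C [^] int k \<otimes> (A [^] int i \<otimes> B))"
      by (simp add: s m_assoc)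
    also have "A [^] int i \<otimes> B = B \<otimes> (C [^] int i \<otimes> A [^] int i')"
      using cj_swap[of B "A [^] int i"] by (simp add: cj_B_A_pow i')
    also have "C [^] int k \<otimes> (B \<otimes> (C [^] int i \<otimes> A [^] int i'))
       = (C [^] int k \<otimes> B [^] (1::int)) \<otimes> (C [^] int i \<otimes> A [^] int i')" by (simp add: m_assoc)
    also have "\<dots> = B [^] (\<beta> ^ k) \<otimes> (C [^] (int k + int i) \<otimes> A [^] int i')"
      unfolding C_B_pow by (simp add: m_assoc int_pow_add_left)
    also have "B [^] int j \<otimes> (B [^] (\<beta> ^ k) \<otimes> (C [^] (int k + int i) \<otimes> A [^] int i'))
       = B [^] int j' \<otimes> C [^] int (k + i) \<otimes> A [^] int i'"
      by (simp add: int_pow_add_left j' m_assoc)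
    finally show ?thesis by (auto simp: S_def simp del: of_nat_add)
  qed
  have SB: "s \<otimes> B [^] int t \<in> S" if s: "s \<in> S" for s t
  proof (induction t)
    case (Suc t)
    have sc: "s \<in> carrier G" using s SG by blast
    have "s \<otimes> B [^] int (Suc t) = s \<otimes> B [^] int t \<otimes> B"
      using sc by (simp add: m_assoc int_pow_mult add.commute[of 1])
    then show ?case using SB1[OF Suc] by simp
  qed (use s SG in auto)
  have "\<forall>s\<in>S. s \<otimes> x \<in> S" if "x \<in> generate G {A, B}" for x
    using that
  proof (induction rule: generate.induct)
    case one
    then show ?case using SG by auto
  next
    case (incl h)
    then show ?case using SA[of _ 1] SB1 by auto
  next
    case (inv h)
    have "inv A = A [^] (- 1 :: int)" "inv B = B [^] (- 1 :: int)" by (simp_all add: int_pow_neg)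
    then show ?case using inv A_nat[of "-1"] B_nat[of "-1"] SA SB by auto
  next
    case (eng h1 h2)
    then have "h1 \<in> carrier G" "h2 \<in> carrier G" using gen by auto
    then show ?case using eng.IH SG by (auto simp: m_assoc[symmetric])
  qed
  moreover have "\<one> \<in> S" by (auto simp: S_def intro!: exI[of _ "0::nat"])
  ultimately have "\<one> \<otimes> g \<in> S" using g gen by blast
  then show ?thesis using g by (auto simp: S_def)
qed

lemma finite_carrier:
  assumes gen: "carrier G = generate G {A, B}"
    and "\<alpha> \<noteq> \<beta>" "\<alpha> \<noteq> 1" "\<beta> \<noteq> 1" "1 < \<bar>\<alpha>\<bar>" "1 < \<bar>\<beta>\<bar>"
  shows "finite (carrier G)"
proof -
  interpret S: macdonald_group G B A "inv C" \<beta> \<alpha> by (rule swap)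
  obtain NA where NA: "0 < NA" "A [^] int NA = \<one>" using A_finite_order assms by blast
  obtain NC where NC: "0 < NC" "C [^] int NC = \<one>" using A_finite_order assms by blast
  obtain NB where NB: "0 < NB" "B [^] int NB = \<one>" using S.A_finite_order(1) assms by metis
  have *: "\<exists>t<N. x [^] int k = x [^] int t" if "x \<in> carrier G" "0 < N" "x [^] int N = \<one>" for x N k
  proof -
    have "int (ord x) dvd int N" using that by (simp add: int_pow_int pow_eq_id)
    moreover have "int N dvd int (k mod N) - int k" by (simp add: mod_eq_dvd_iff[symmetric] zmod_int)
    ultimately have "int (ord x) dvd int (k mod N) - int k" by (rule dvd_trans)
    then have "x [^] int k = x [^] int (k mod N)"
      using int_pow_eq[OF that(1)] by blast
    then show ?thesis using that(2) mod_less_divisor by blast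
  qed
  have "carrier G \<subseteq> (\<lambda>(j, k, i). B [^] int j \<otimes> C [^] int k \<otimes> A [^] int i) ` ({..<NB} \<times> {..<NC} \<times> {..<NA})"
  proof
    fix g assume "g \<in> carrier G"
    then obtain j k i where g: "g = B [^] int j \<otimes> C [^] int k \<otimes> A [^] int i"
      using carrier_BCA[OF gen NA NB] by blast
    obtain j' k' i' where "j' < NB" "B [^] int j = B [^] int j'" "k' < NC" "C [^] int k = C [^] int k'"
      "i' < NA" "A [^] int i = A [^] int i'"
      using *[OF closed(2) NB] *[OF closed(3) NC] *[OF closed(1) NA] by metis
    then show "g \<in> (\<lambda>(j, k, i). B [^] int j \<otimes> C [^] int k \<otimes> A [^] int i) ` ({..<NB} \<times> {..<NC} \<times> {..<NA})"
      using g by force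
  qed
  then show ?thesis by (rule finite_subset) simp
qed

end

lemma (in group) cj_inj:
  assumes "g \<in> carrier G" "x \<in> carrier G" "y \<in> carrier G" "cj g x = cj g y"
  shows "x = y"
proof -
  have "x \<otimes> g = y \<otimes> g" using cj_swap[of g x] cj_swap[of g y] assms by simp
  then show ?thesis using assms by simp
qed

text \<open>The product set of H and the cyclic group of x need not be a subgroup. If d is the least
  positive exponent with x^d in H, its elements are h x^i with i < d in just one way, and d divides
  k.\<close>

lemma (in group) card_cyclic_product:
  assumes H: "subgroup H G" and x: "x \<in> carrier G"
    and Q: "Q = {h \<otimes> x [^] i | h i. h \<in> H \<and> i \<in> (UNIV :: nat set)}"
    and k: "x [^] (k::nat) \<in> H" "0 < k"
  shows "card Q dvd card H * k"
proof -
  define d where "d = (LEAST d::nat. 0 < d \<and> x [^] d \<in> H)"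
  have dP: "0 < d \<and> x [^] d \<in> H" unfolding d_def
    by (rule LeastI[of "\<lambda>d::nat. 0 < d \<and> x [^] d \<in> H" k]) (use k in simp)
  then have d: "0 < d" "x [^] d \<in> H" by simp_all
  have dmin: "d \<le> i" if "0 < i" "x [^] i \<in> H" for i :: nat
    unfolding d_def by (rule Least_le) (use that in simp)
  have Hc: "\<And>h. h \<in> H \<Longrightarrow> h \<in> carrier G" by (rule subgroup.mem_carrier[OF H])
  have xd: "x [^] (d * q) \<in> H" for q :: nat
  proof (induction q)
    case (Suc q)
    have "x [^] (d * Suc q) = x [^] d \<otimes> x [^] (d * q)" using x by (simp add: nat_pow_mult)
    then show ?case using subgroup.m_closed[OF H d(2) Suc] by simp
  qed (simp add: subgroup.one_closed[OF H])
  have split: "x [^] i = x [^] (d * (i div d)) \<otimes> x [^] (i mod d)" for i :: nat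
    using x by (simp add: nat_pow_mult)
  have "d dvd k"
  proof (rule ccontr)
    assume "\<not> d dvd k"
    then have "0 < k mod d" by (simp add: mod_greater_zero_iff_not_dvd)
    moreover have "x [^] (k mod d) \<in> H"
    proof -
      have "x [^] (k mod d) = inv (x [^] (d * (k div d))) \<otimes> x [^] k"
        using split[of k] x by (simp add: m_assoc[symmetric])
      then show ?thesis
        using subgroup.m_closed[OF H subgroup.m_inv_closed[OF H xd] k(1)] by simp
    qed
    ultimately show False using dmin[of "k mod d"] d(1) mod_less_divisor by (meson leD)
  qed
  have "bij_betw (\<lambda>(h, i). h \<otimes> x [^] i) (H \<times> {..<d}) Q"
  proof (rule bij_betw_imageI)
    have *: "h = h' \<and> i = j" if "h \<in> H" "h' \<in> H" "i \<le> j" "j < d" "h \<otimes> x [^] i = h' \<otimes> x [^] j" for h h' i j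
    proof -
      have c: "h \<in> carrier G" "h' \<in> carrier G" using that Hc by auto
      have "x [^] j = x [^] (j - i) \<otimes> x [^] i" using that(3) x by (simp add: nat_pow_mult)
      then have "h \<otimes> x [^] i = h' \<otimes> x [^] (j - i) \<otimes> x [^] i" using that(5) c x by (simp add: m_assoc)
      then have e: "h = h' \<otimes> x [^] (j - i)" using c x by simp
      then have "x [^] (j - i) = inv h' \<otimes> h" using c x by simp
      then have "x [^] (j - i) \<in> H"
        using subgroup.m_closed[OF H subgroup.m_inv_closed[OF H that(2)] that(1)] by simp
      then have "j - i = 0" using dmin[of "j - i"] that(4) by fastforce
      then show ?thesis using e c that(3) by simp
    qed
    show "inj_on (\<lambda>(h, i). h \<otimes> x [^] i) (H \<times> {..<d})"
    proof (rule inj_onI, clarsimp)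
      fix h i h' j assume a: "h \<in> H" "h' \<in> H" "i < d" "j < d" "h \<otimes> x [^] i = h' \<otimes> x [^] j"
      show "h = h' \<and> i = j"
      proof (cases "i \<le> j")
        case True
        then show ?thesis using *[of h h' i j] a by simp
      next
        case False
        then show ?thesis using *[of h' h j i] a by simp
      qed
    qed
    show "(\<lambda>(h, i). h \<otimes> x [^] i) ` (H \<times> {..<d}) = Q"
    proof
      show "(\<lambda>(h, i). h \<otimes> x [^] i) ` (H \<times> {..<d}) \<subseteq> Q" by (auto simp: Q)
      show "Q \<subseteq> (\<lambda>(h, i). h \<otimes> x [^] i) ` (H \<times> {..<d})"
      proof
        fix g assume "g \<in> Q"
        then obtain h and i :: nat where h: "h \<in> H" "g = h \<otimes> x [^] i" by (auto simp: Q)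
        then have "g = h \<otimes> x [^] (d * (i div d)) \<otimes> x [^] (i mod d)"
          using split[of i] x Hc by (simp add: m_assoc)
        moreover have "h \<otimes> x [^] (d * (i div d)) \<in> H" by (rule subgroup.m_closed[OF H h(1) xd])
        moreover have "i mod d < d" using d(1) by simp
        ultimately show "g \<in> (\<lambda>(h, i). h \<otimes> x [^] i) ` (H \<times> {..<d})" by force
      qed
    qed
  qed
  then have "card Q = card H * d"
    using bij_betw_same_card by (fastforce simp: card_cartesian_product)
  then show ?thesis using \<open>d dvd k\<close> by simp
qed

lemma exact_prime_power:
  fixes z :: int
  assumes "Factorial_Ring.prime p" "int p ^ r dvd z" "\<not> int p ^ Suc r dvd z"
  obtains z0 where "z = int p ^ r * z0" "coprime z0 (int p)"
proof -
  obtain z0 where z: "z = int p ^ r * z0" using assms(2) by (auto simp: dvd_def)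
  have "\<not> int p dvd z0"
  proof
    assume "int p dvd z0"
    then have "int p ^ r * int p dvd z" unfolding z by (intro mult_dvd_mono) simp_all
    then show False using assms(3) by (simp add: mult.commute)
  qed
  moreover have "Factorial_Ring.prime (int p)" using assms(1) by simp
  ultimately have "coprime z0 (int p)" using prime_imp_coprime coprime_commute by blast
  then show ?thesis using z that by blast
qed

lemma yval_nonpos: "yval n \<le> 0"
proof -
  have "gsum (1 + int n) n \<le> (\<Sum>i=1..n. (1 + int n) ^ Suc n)"
    unfolding gsum_def by (intro sum_mono power_increasing) auto
  then show ?thesis by (simp add: yval_def)
qed

section \<open>The fundamental relation with explicit exponents\<close>

context macdonald_group
begin

lemma CA_pow:
  "(C [^] int D \<otimes> A [^] (v::int)) [^] int k = C [^] int (D * k) \<otimes> A [^] (v * (\<Sum>i<k. (\<alpha> ^ D) ^ i))"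
proof (induction k)
  case (Suc k)
  let ?s = "\<Sum>i<k. (\<alpha> ^ D) ^ i"
  have "(C [^] int D \<otimes> A [^] v) [^] int (Suc k) = (C [^] int (D * k) \<otimes> A [^] (v * ?s)) \<otimes> (C [^] int D \<otimes> A [^] v)"
    by (simp add: int_pow_mult Suc[symmetric] add.commute[of 1] del: of_nat_mult)
  also have "\<dots> = C [^] int (D * k) \<otimes> ((A [^] (v * ?s) \<otimes> C [^] int D) \<otimes> A [^] v)"
    by (simp add: m_assoc)
  also have "\<dots> = C [^] int (D * k) \<otimes> (C [^] int D \<otimes> A [^] (v * ?s * \<alpha> ^ D + v))"
    unfolding A_C_pow by (simp add: m_assoc int_pow_mult)
  also have "\<dots> = C [^] int (D * Suc k) \<otimes> A [^] (v * ?s * \<alpha> ^ D + v)"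
    by (simp add: int_pow_add_left algebra_simps)
  also have "v * ?s * \<alpha> ^ D + v = v * (\<Sum>i<Suc k. (\<alpha> ^ D) ^ i)"
    by (simp add: sum.lessThan_Suc_shift sum_distrib_left sum_distrib_right algebra_simps del: sum.lessThan_Suc)
  finally show ?case .
qed simp

lemma cj_A_C_pow: "cj A (C [^] int k) = C [^] int k \<otimes> A [^] (1 - \<alpha> ^ k)"
proof (rule cj_eqI)
  have "A \<otimes> (C [^] int k \<otimes> A [^] (1 - \<alpha> ^ k)) = (A [^] (1::int) \<otimes> C [^] int k) \<otimes> A [^] (1 - \<alpha> ^ k)"
    by (simp add: m_assoc)
  also have "\<dots> = C [^] int k \<otimes> A"
    unfolding A_C_pow by (simp add: m_assoc int_pow_mult[symmetric])
  finally show "C [^] int k \<otimes> A = A \<otimes> (C [^] int k \<otimes> A [^] (1 - \<alpha> ^ k))" by simp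
qed simp_all

lemma cj_A_C_neg_pow: "cj A (C [^] (- int k)) = A [^] (\<alpha> ^ k - 1) \<otimes> C [^] (- int k)"
proof -
  have "cj A (C [^] (- int k)) = cj A ((C [^] int k) [^] (-1::int))" by (simp add: int_pow_pow)
  also have "\<dots> = inv (C [^] int k \<otimes> A [^] (1 - \<alpha> ^ k))"
    by (subst cj_int_pow) (simp_all add: cj_A_C_pow int_pow_neg)
  also have "\<dots> = A [^] (\<alpha> ^ k - 1) \<otimes> C [^] (- int k)"
    using int_pow_neg[of A "1 - \<alpha> ^ k"] by (simp add: inv_mult_group int_pow_neg)
  finally show ?thesis .
qed

end

text \<open>Here e = \<alpha> - 1 and n = \<beta> - 1, so \<open>2 + e\<close> and
  \<open>2 + n\<close> below are \<alpha> + 1 and \<beta> + 1, and \<open>e - n\<close> is \<alpha>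
  - \<beta> when n is at most e.\<close>

locale macdonald_nat = macdonald_group G A B C "1 + int e" "1 + int n"
  for G (structure) and A B C :: 'a and e n :: nat
begin

text \<open>The exponent of \<open>B\<close> in the fundamental relation. As \<open>yval n\<close>
  is never positive, \<open>nat\<close> truncates nothing.\<close>

definition xv :: nat where "xv = nat (- yval n)"

lemma int_X: "int xv = - yval n"
  using yval_nonpos[of n] by (simp add: xv_def)

text \<open>This is \<open>key_identity\<close> with (A C)^-e and (B C^-1)^n expanded into powers of
  two generators and the powers of \<open>C\<close> pulled through. On each side a geometric sum and
  a power merge into \<open>yval\<close>.\<close>

lemma fundamental: "B [^] int xv \<otimes> C [^] int (2 + n) = C [^] int (2 + e) \<otimes> A [^] yval e"
proof -
  let ?s = "gsum (1 + int e) e" and ?r = "gsum (1 + int n) n"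
  have i0: "1 - (1 + int e) = - int e" by simp
  have i1: "(A \<otimes> C) [^] (- int e) = A [^] (- ?s) \<otimes> C [^] (- int e)"
    by (simp add: int_pow_neg AC_pow inv_mult_group)
  have i2: "(B \<otimes> inv C) [^] int n = C [^] (- int n) \<otimes> B [^] ?r"
    using cj_A_B_pow[of n] by (simp add: cj_int_pow cj_A_B)
  let ?z = "A [^] (- int e * (1 + int e))"
  have "B [^] int n \<otimes> C \<otimes> (A [^] (- ?s) \<otimes> C [^] (- int e))
     = inv C \<otimes> (C [^] (- int n) \<otimes> B [^] ?r) \<otimes> C \<otimes> C \<otimes> ?z"
    using key_identity i1 i2 by (simp only: add_diff_cancel_left' i0)
  then have "B [^] int n \<otimes> (C [^] (1::int) \<otimes> (A [^] (- ?s) \<otimes> C [^] (- int e)))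
     = C [^] (- 1 :: int) \<otimes> (C [^] (- int n) \<otimes> (B [^] ?r \<otimes> (C [^] (1::int) \<otimes> (C [^] (1::int) \<otimes> ?z))))"
    by (simp add: m_assoc int_pow_neg)
  then have k: "B [^] int n \<otimes> (C [^] (1::int) \<otimes> (A [^] (- ?s) \<otimes> C [^] (- int e)))
     = C [^] (- int (1 + n)) \<otimes> (B [^] ?r \<otimes> (C [^] int 2 \<otimes> ?z))"
    by (simp add: int_pow_add_left del: int_pow_1)
  have "C [^] int (1 + n) \<otimes> (B [^] int n \<otimes> (C [^] (1::int) \<otimes> (A [^] (- ?s) \<otimes> C [^] (- int e))))
     = (C [^] int (1 + n) \<otimes> B [^] int n) \<otimes> (C [^] (1::int) \<otimes> (A [^] (- ?s) \<otimes> C [^] (- int e)))"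
    by (simp add: m_assoc)
  also have "\<dots> = B [^] (int n * (1 + int n) ^ (1 + n)) \<otimes> (C [^] int (2 + n) \<otimes> (A [^] (- ?s) \<otimes> C [^] (- int e)))"
    unfolding C_B_pow by (simp add: m_assoc int_pow_add_left del: int_pow_1)
  finally have l: "B [^] ?r \<otimes> (C [^] int 2 \<otimes> ?z)
     = B [^] (int n * (1 + int n) ^ (1 + n)) \<otimes> (C [^] int (2 + n) \<otimes> (A [^] (- ?s) \<otimes> C [^] (- int e)))"
    unfolding k by (simp add: int_pow_add_left)
  have "B [^] (- ?r) \<otimes> (B [^] ?r \<otimes> (C [^] int 2 \<otimes> ?z)) = B [^] int xv \<otimes> (C [^] int (2 + n) \<otimes> (A [^] (- ?s) \<otimes> C [^] (- int e)))"
    unfolding l int_X yval_def by (simp add: int_pow_add_left)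
  then have "C [^] int 2 \<otimes> ?z = B [^] int xv \<otimes> (C [^] int (2 + n) \<otimes> (A [^] (- ?s) \<otimes> C [^] (- int e)))"
    by (simp add: int_pow_add_left)
  then have "(C [^] int 2 \<otimes> ?z) \<otimes> C [^] int e \<otimes> A [^] ?s
     = (B [^] int xv \<otimes> (C [^] int (2 + n) \<otimes> (A [^] (- ?s) \<otimes> C [^] (- int e)))) \<otimes> C [^] int e \<otimes> A [^] ?s"
    by simp
  also have "\<dots> = B [^] int xv \<otimes> C [^] int (2 + n)"
    by (simp add: m_assoc int_pow_add_left int_pow_mult[symmetric])
  finally have "B [^] int xv \<otimes> C [^] int (2 + n) = C [^] int 2 \<otimes> ((?z \<otimes> C [^] int e) \<otimes> A [^] ?s)"
    by (simp add: m_assoc)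
  also have "\<dots> = C [^] int (2 + e) \<otimes> A [^] (- int e * (1 + int e) * (1 + int e) ^ e + ?s)"
    unfolding A_C_pow by (simp add: m_assoc int_pow_add_left int_pow_mult[symmetric])
  also have "- int e * (1 + int e) * (1 + int e) ^ e + ?s = yval e"
    by (simp add: yval_def algebra_simps)
  finally show ?thesis .
qed

lemma B_X: "B [^] int xv = C [^] int (2 + e) \<otimes> A [^] yval e \<otimes> C [^] (- int (2 + n))"
proof -
  have "B [^] int xv = B [^] int xv \<otimes> C [^] int (2 + n) \<otimes> C [^] (- int (2 + n))"
    by (simp add: m_assoc int_pow_mult[symmetric])
  then show ?thesis by (simp only: fundamental)
qed

text \<open>Conjugate \<open>B_X\<close> by \<open>A\<close>. The power of \<open>B\<close> on the
  left becomes C^-xv times a power of \<open>B\<close>. On the right \<open>A\<close> fixes the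
  power of \<open>A\<close>, and the two powers of \<open>C\<close> each acquire a power of
  \<open>A\<close>, whose exponents combine to the difference shown. Then B^xv is cancelled.\<close>

lemma cj_A_relation:
  "C [^] (- int xv) \<otimes> B [^] (gsum (1 + int n) xv - int xv * (1 + int n) ^ xv)
    = cj (C [^] (- int (2 + n))) (A [^] ((1 + int e) ^ (2 + n) - (1 + int e) ^ (2 + e)))"
proof -
  let ?f = "(1 + int e) ^ (2 + n) - (1 + int e) ^ (2 + e)" and ?s = "gsum (1 + int n) xv"
  have "C [^] (- int xv) \<otimes> B [^] ?s = cj A (B [^] int xv)" by (rule cj_A_B_pow[symmetric])
  also have "\<dots> = cj A (C [^] int (2 + e)) \<otimes> A [^] yval e \<otimes> cj A (C [^] (- int (2 + n)))"
    unfolding B_X by (simp only: cj_mult closed int_pow_closed m_closed)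
      (simp only: cj_commute[OF closed(1) int_pow_closed[OF closed(1)]] int_pow_commute[of A _ 1, simplified] closed)
  also have "\<dots> = C [^] int (2 + e) \<otimes> (A [^] (1 - (1 + int e) ^ (2 + e)) \<otimes> (A [^] yval e \<otimes>
       (A [^] ((1 + int e) ^ (2 + n) - 1) \<otimes> C [^] (- int (2 + n)))))"
    unfolding cj_A_C_pow cj_A_C_neg_pow by (simp add: m_assoc)
  also have "\<dots> = C [^] int (2 + e) \<otimes> (A [^] yval e \<otimes> (A [^] ?f \<otimes> C [^] (- int (2 + n))))"
    by (simp add: int_pow_add_left algebra_simps del: power_Suc)
  also have "\<dots> = B [^] int xv \<otimes> (C [^] int (2 + n) \<otimes> A [^] ?f \<otimes> C [^] (- int (2 + n)))"
    unfolding B_X by (simp add: m_assoc int_pow_add_left)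
  finally have "B [^] (- int xv) \<otimes> (C [^] (- int xv) \<otimes> B [^] ?s)
      = B [^] (- int xv) \<otimes> (B [^] int xv \<otimes> (C [^] int (2 + n) \<otimes> A [^] ?f \<otimes> C [^] (- int (2 + n))))"
    by simp
  also have "\<dots> = cj (C [^] (- int (2 + n))) (A [^] ?f)"
  proof -
    have "inv (C [^] (- int (2 + n))) = C [^] int (2 + n)"
      by (simp only: int_pow_neg closed inv_inv int_pow_closed)
    then have "cj (C [^] (- int (2 + n))) (A [^] ?f) = C [^] int (2 + n) \<otimes> A [^] ?f \<otimes> C [^] (- int (2 + n))"
      by (simp only: cj_def)
    then show ?thesis
      by (simp only: int_pow_add_left closed int_pow_closed m_closed) (simp del: of_nat_add)
  qed
  finally have "cj (C [^] (- int (2 + n))) (A [^] ?f) = (B [^] (- int xv) \<otimes> C [^] (- int xv)) \<otimes> B [^] ?s"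
    by (simp add: m_assoc)
  also have "\<dots> = C [^] (- int xv) \<otimes> B [^] (- int xv * (1 + int n) ^ xv + ?s)"
    unfolding B_C_neg_pow by (simp only: m_assoc int_pow_mult[symmetric] closed int_pow_closed)
  finally show ?thesis by (simp add: add.commute)
qed

text \<open>By \<open>fundamental\<close>, a power of \<open>C\<close> conjugates w = B^xv C^-(e-n)
  to a power of \<open>A\<close>; hence \<open>C\<close> raises w to the power \<alpha>, as it does
  with powers of \<open>A\<close>. Thus w = (C w C^-1)^\<alpha>, and expanding the right-hand side
  with the rules for \<open>B\<close> and \<open>C\<close> gives a second expression for w.
  Comparing the two isolates a power of \<open>C\<close>, now with an exponent whose valuation can
  be computed.\<close>

lemma C_pow_in_B:
  assumes "n \<le> e"
  shows "C [^] int ((e - n) * e) = B [^] (int xv * (1 + int n) ^ (e - n) *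
    ((1 + int n) * (\<Sum>i<1 + e. ((1 + int n) ^ (e - n)) ^ i) - 1))"
proof -
  let ?D = "e - n" and ?b = "1 + int n"
  let ?S = "\<Sum>i<1 + e. (?b ^ ?D) ^ i"
  define w where "w = B [^] int xv \<otimes> C [^] (- int ?D)"
  have w [simp]: "w \<in> carrier G" by (simp add: w_def)
  have "w \<otimes> C [^] int (2 + e) = B [^] int xv \<otimes> C [^] int (2 + n)"
    using assms by (simp add: w_def m_assoc int_pow_mult[symmetric] of_nat_diff add.commute)
  then have wA: "cj (C [^] int (2 + e)) w = A [^] yval e"
    by (intro cj_eqI) (simp_all only: fundamental closed int_pow_closed w)
  have com: "C \<otimes> C [^] int (2 + e) = C [^] int (2 + e) \<otimes> C"
    using int_pow_commute[of C 1 "int (2 + e)"] by simp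
  have "cj (C [^] int (2 + e)) (cj C w) = cj C (cj (C [^] int (2 + e)) w)"
    by (simp only: cj_cj closed int_pow_closed w com)
  also have "\<dots> = (cj (C [^] int (2 + e)) w) [^] (1 + int e)"
    unfolding wA by (simp only: cj_C_A int_pow_pow closed)
  also have "\<dots> = cj (C [^] int (2 + e)) (w [^] (1 + int e))"
    by (simp only: cj_int_pow closed int_pow_closed w)
  finally have "cj (C [^] int (2 + e)) (cj C w) = cj (C [^] int (2 + e)) (w [^] (1 + int e))" .
  then have "cj C w = w [^] (1 + int e)"
    by (rule cj_inj[rotated -1]) simp_all
  then have "w = cj (inv C) (w [^] (1 + int e))"
    using cj_inv_cancel[of "inv C" w] by simp
  also have "\<dots> = (cj (inv C) w) [^] int (1 + e)" by (simp add: cj_int_pow)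
  also have "cj (inv C) w = B [^] (int xv * ?b) \<otimes> C [^] (- int ?D)"
  proof -
    have "cj (inv C) (C [^] (- int ?D)) = C [^] (- int ?D)"
      using int_pow_commute[of C "- int ?D" "- 1"] by (intro cj_commute) (simp_all add: int_pow_neg)
    then show ?thesis unfolding w_def by (simp add: cj_mult cj_invC_B del: of_nat_diff)
  qed
  also have "B [^] (int xv * ?b) \<otimes> C [^] (- int ?D) = (inv C) [^] int ?D \<otimes> B [^] (int xv * ?b * ?b ^ ?D)"
    unfolding B_C_neg_pow by (simp add: int_pow_inv int_pow_neg)
  also have "\<dots> [^] int (1 + e) = (inv C) [^] int (?D * (1 + e)) \<otimes> B [^] (int xv * ?b * ?b ^ ?D * ?S)"
    by (rule macdonald_group.CA_pow[OF swap])
  finally have 1: "w = C [^] (- int (?D * (1 + e))) \<otimes> B [^] (int xv * ?b * ?b ^ ?D * ?S)"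
    by (simp only: int_pow_inv int_pow_neg closed)
  have 2: "w = C [^] (- int ?D) \<otimes> B [^] (int xv * ?b ^ ?D)"
    unfolding w_def B_C_neg_pow ..
  have "C [^] int (?D * (1 + e)) \<otimes> (C [^] (- int ?D) \<otimes> B [^] (int xv * ?b ^ ?D)) \<otimes> B [^] (- (int xv * ?b ^ ?D))
     = C [^] int (?D * (1 + e)) \<otimes> (C [^] (- int (?D * (1 + e))) \<otimes> B [^] (int xv * ?b * ?b ^ ?D * ?S)) \<otimes> B [^] (- (int xv * ?b ^ ?D))"
    using 1 2 by simp
  then have "C [^] (int (?D * (1 + e)) + - int ?D) = B [^] (int xv * ?b * ?b ^ ?D * ?S + - (int xv * ?b ^ ?D))"
    by (simp only: m_assoc int_pow_add_left closed int_pow_closed m_closed int_pow_mult[symmetric]) simp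
  moreover have "int (?D * (1 + e)) + - int ?D = int (?D * e)"
    by (simp only: distrib_left mult_1_right of_nat_add)
  moreover have "int xv * ?b * ?b ^ ?D * ?S + - (int xv * ?b ^ ?D) = int xv * ?b ^ ?D * (?b * ?S - 1)"
    by (simp add: algebra_simps)
  ultimately show ?thesis by (simp only:)
qed

end

section \<open>Bounding the p-part of the order\<close>

text \<open>The order is p^K t with t prime to p, so every x^(t r) is a p-element and x^(t p^s) = 1
  says that the p-part of the order of x divides p^s. This replaces projecting to a Sylow subgroup,
  which is not known to be a direct factor.\<close>

locale macdonald_local = macdonald_nat G A B C e n
  for G (structure) and A B C :: 'a and e n :: nat +
  fixes p m l K t :: nat
  assumes p: "Factorial_Ring.prime p" "odd p"
    and m2: "2 \<le> m" and ml: "m < l" and l32: "2 * l < 3 * m"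
    and pe: "p ^ m dvd e" "\<not> p ^ Suc m dvd e"
    and pn: "p ^ m dvd n" "\<not> p ^ Suc m dvd n"
    and en: "n < e"
    and pl: "p ^ l dvd e - n" "\<not> p ^ Suc l dvd e - n"
    and order: "order G = p ^ K * t" "coprime t p" "0 < order G"
begin

lemma m0: "0 < m" using m2 by simp

lemma int_p_dvd: "p ^ r dvd x \<longleftrightarrow> int p ^ r dvd int x"
  by (metis of_nat_dvd_iff of_nat_power)

lemma p_dvd_e: "int p ^ m dvd int e" and p_dvd_n: "int p ^ m dvd int n"
  and p_dvd_D: "int p ^ l dvd int (e - n)"
  using pe(1) pn(1) pl(1) by (simp_all only: int_p_dvd)

lemma prime_int_p: "Factorial_Ring.prime (int p)" using p(1) by simp

lemma pow_order_multiple: "x \<in> carrier G \<Longrightarrow> int p ^ K * int t dvd i \<Longrightarrow> x [^] (i::int) = \<one>"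
proof -
  assume x: "x \<in> carrier G" and i: "int p ^ K * int t dvd i"
  have "int (ord x) dvd int (order G)" using ord_dvd_group_order[OF x] by simp
  also have "int (order G) = int p ^ K * int t" by (simp add: order(1))
  also note i
  finally show ?thesis using x by (simp add: int_pow_eq_id)
qed

lemma p_and_coprime_trivial:
  assumes x: "x \<in> carrier G" and "x [^] (int p ^ K) = \<one>" "x [^] int t = \<one>"
  shows "x = \<one>"
proof -
  have "int (ord x) dvd int p ^ K" "int (ord x) dvd int t"
    using assms by (simp_all add: int_pow_eq_id)
  then have "ord x dvd p ^ K" "ord x dvd t" by (metis of_nat_dvd_iff of_nat_power)+
  moreover have "coprime (p ^ K) t" using order(2) by (simp add: coprime_commute)
  ultimately have "ord x dvd 1" using coprime_common_divisor by blast
  then show ?thesis using ord_eq_1[OF x] by simp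
qed

text \<open>A factor z prime to p has an inverse w modulo p^K, and p^K annihilates all t-th powers;
  so z can be inserted or removed in exponents divisible by t.\<close>

lemma unscale:
  assumes "coprime z (int p)"
  obtains w where "\<And>x r. x \<in> carrier G \<Longrightarrow> x [^] (int t * r) = x [^] (int t * r * z * w)"
proof -
  have "coprime z (int p ^ K)" using assms by simp
  then obtain w where w: "[z * w = 1] (mod int p ^ K)" using cong_solve_coprime_int by blast
  have "x [^] (int t * r) = x [^] (int t * r * z * w)" if x: "x \<in> carrier G" for x r
  proof -
    have "int p ^ K * int t dvd (z * w - 1) * (int t * r)"
      using w by (intro mult_dvd_mono) (simp_all add: cong_iff_dvd_diff)
    then have "x [^] ((z * w - 1) * (int t * r)) = \<one>" by (rule pow_order_multiple[OF x])
    moreover have "int t * r * z * w = (z * w - 1) * (int t * r) + int t * r" by (simp add: algebra_simps)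
    ultimately show ?thesis using x by (simp add: int_pow_mult)
  qed
  then show ?thesis using that by blast
qed

lemma xv_dvd: "int p ^ (2 * m) dvd int xv" "\<not> int p ^ Suc (2 * m) dvd int xv"
  using yval_valuation[OF p m2 pn] by (simp_all add: int_X)

lemma alpha_D_valuation:
  "int p ^ (l + m) dvd (1 + int e) ^ (e - n) - 1" "\<not> int p ^ Suc (l + m) dvd (1 + int e) ^ (e - n) - 1"
proof -
  show "int p ^ (l + m) dvd (1 + int e) ^ (e - n) - 1"
    by (rule one_plus_power_dvd[OF p m0 p_dvd_e pl(1)])
  have "\<not> int p ^ Suc m dvd int e" using pe(2) by (simp only: int_p_dvd) simp
  then show "\<not> int p ^ Suc (l + m) dvd (1 + int e) ^ (e - n) - 1"
    by (rule one_plus_power_not_dvd[OF p m0 p_dvd_e pl(1) _ pl(2)])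
qed

lemma coprime_one_plus:
  assumes "int p ^ m dvd x"
  shows "coprime (1 + x) (int p)"
proof -
  have "int p dvd x" using dvd_trans[OF le_imp_power_dvd[of 1 m "int p"] assms] m0 by simp
  then have "\<not> int p dvd 1 + x"
    using prime_int_p by (metis dvd_add_left_iff not_prime_unit)
  then show ?thesis using prime_imp_coprime[OF prime_int_p] coprime_commute by blast
qed

lemma f_exact:
  obtains f0 where "(1 + int e) ^ (2 + n) - (1 + int e) ^ (2 + e) = int p ^ (l + m) * f0" "coprime f0 (int p)"
proof -
  obtain z where z: "(1 + int e) ^ (e - n) - 1 = int p ^ (l + m) * z" "coprime z (int p)"
    using exact_prime_power[OF p(1) alpha_D_valuation] by blast
  have "(1 + int e) ^ (2 + e) = (1 + int e) ^ (2 + n) * (1 + int e) ^ (e - n)"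
    using en by (simp flip: power_add)
  then have "(1 + int e) ^ (2 + n) - (1 + int e) ^ (2 + e) = - ((1 + int e) ^ (2 + n)) * ((1 + int e) ^ (e - n) - 1)"
    by (simp add: right_diff_distrib)
  also have "\<dots> = int p ^ (l + m) * (- ((1 + int e) ^ (2 + n)) * z)"
    unfolding z(1) by (simp only: mult.assoc mult.left_commute)
  finally have "(1 + int e) ^ (2 + n) - (1 + int e) ^ (2 + e) = int p ^ (l + m) * (- ((1 + int e) ^ (2 + n)) * z)" .
  moreover have "coprime (- ((1 + int e) ^ (2 + n)) * z) (int p)"
    using z(2) coprime_one_plus[OF p_dvd_e] by simp
  ultimately show ?thesis using that by blast
qed

text \<open>The factor \<open>xv\<close> has valuation 2m. In the bracket, modulo p^(m+1), the
  powers of \<beta>^(e-n) are 1 and n may be replaced by e, which leaves (1+e)^2 - 1 = 2e, of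
  valuation m.\<close>

lemma kappa_exact:
  obtains k0 where
    "int xv * (1 + int n) ^ (e - n) * ((1 + int n) * (\<Sum>i<1 + e. ((1 + int n) ^ (e - n)) ^ i) - 1) = int p ^ (3 * m) * k0"
    "coprime k0 (int p)"
proof -
  let ?b = "1 + int n" and ?D = "e - n"
  let ?S = "\<Sum>i<1 + e. (?b ^ ?D) ^ i"
  obtain x0 where x0: "int xv = int p ^ (2 * m) * x0" "coprime x0 (int p)"
    using exact_prime_power[OF p(1) xv_dvd] by blast
  have "int p ^ Suc m dvd int p ^ (l + m)" using ml by (intro le_imp_power_dvd) simp
  moreover have "int p ^ (l + m) dvd ?b ^ ?D - 1"
    by (rule one_plus_power_dvd[OF p m0 p_dvd_n pl(1)])
  ultimately have "int p ^ Suc m dvd ?b ^ ?D - 1" by (rule dvd_trans)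
  then have b1: "[?b ^ ?D = 1] (mod int p ^ Suc m)" by (simp only: cong_iff_dvd_diff)
  have "[?S = (\<Sum>i<1 + e. 1)] (mod int p ^ Suc m)"
    by (rule cong_sum) (use cong_pow[OF b1] in \<open>simp only: power_one\<close>)
  then have S: "[?S = 1 + int e] (mod int p ^ Suc m)" by simp
  have "int p ^ Suc m dvd int p ^ l" using ml by (intro le_imp_power_dvd) simp
  then have "int p ^ Suc m dvd int e - int n" using p_dvd_D en dvd_trans by (simp add: of_nat_diff)
  then have ee: "[int n = int e] (mod int p ^ Suc m)" by (simp add: cong_iff_dvd_diff dvd_diff_commute)
  have "[?b * ?S - 1 = (1 + int e) * (1 + int e) - 1] (mod int p ^ Suc m)"
    by (intro cong_diff cong_mult cong_add cong_refl ee S)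
  also have "(1 + int e) * (1 + int e) - 1 = 2 * int e + int e ^ 2"
    by (simp add: algebra_simps power2_eq_square)
  also have "[\<dots> = 2 * int e] (mod int p ^ Suc m)"
  proof -
    have "int p ^ (2 * m) dvd int e ^ 2"
      using dvd_power_same[OF p_dvd_e, of 2] by (simp add: power_mult[symmetric] mult.commute)
    moreover have "int p ^ Suc m dvd int p ^ (2 * m)" using m2 by (intro le_imp_power_dvd) simp
    ultimately have "int p ^ Suc m dvd int e ^ 2" using dvd_trans by blast
    then show ?thesis by (simp only: cong_iff_dvd_diff add_diff_cancel_left')
  qed
  finally have c: "[?b * ?S - 1 = 2 * int e] (mod int p ^ Suc m)" .
  have "\<not> int p ^ Suc m dvd 2 * int e"
    using odd_power_dvd_times_2[OF p(2), of "Suc m" "int e"] pe(2) by (simp only: int_p_dvd) blast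
  then have s2: "\<not> int p ^ Suc m dvd ?b * ?S - 1" using cong_dvd_iff[OF c] by blast
  have "[?b * ?S - 1 = 2 * int e] (mod int p ^ m)"
    using c by (rule cong_dvd_modulus) (simp add: le_imp_power_dvd)
  then have s1: "int p ^ m dvd ?b * ?S - 1" using cong_dvd_iff dvd_mult[OF p_dvd_e] by blast
  obtain s0 where s0: "?b * ?S - 1 = int p ^ m * s0" "coprime s0 (int p)"
    using exact_prime_power[OF p(1) s1 s2] by blast
  have "int xv * ?b ^ ?D * (?b * ?S - 1) = (int p ^ (2 * m) * int p ^ m) * (x0 * ?b ^ ?D * s0)"
    unfolding x0(1) s0(1) by (simp only: mult_ac)
  also have "int p ^ (2 * m) * int p ^ m = int p ^ (3 * m)" by (simp flip: power_add)
  finally have "int xv * ?b ^ ?D * (?b * ?S - 1) = int p ^ (3 * m) * (x0 * ?b ^ ?D * s0)" .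
  moreover have "coprime (x0 * ?b ^ ?D * s0) (int p)"
    using x0(2) s0(2) coprime_one_plus[OF p_dvd_n] by simp
  ultimately show ?thesis using that by blast
qed

text \<open>The \<open>t\<close>-th power of the relation \<open>cj_A_relation\<close> expresses a \<open>p\<close>-element of \<open>\<langle>A\<rangle>\<close> as a \<open>p\<close>-element
  of \<open>\<langle>C\<rangle>\<close> times an element \<open>b2\<close> of \<open>\<langle>B\<rangle>\<close> of order prime to \<open>p\<close>. Comparing with the conjugate by
  \<open>C\<close> shows that \<open>b2\<close> commutes with \<open>C\<close>, and then \<open>b2\<close> must be trivial.\<close>

lemma A_pow_in_C:
  "\<exists>w::int. A [^] (int t * int p ^ (l + m)) = C [^] (int t * (int p ^ (2 * m) * w))"
proof -
  let ?b = "1 + int n"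
  define f where "f = (1 + int e) ^ (2 + n) - (1 + int e) ^ (2 + e)"
  define g where "g = gsum ?b xv - int xv * ?b ^ xv"
  define \<nu> where "\<nu> = (\<Sum>i<t. (?b ^ xv) ^ i)"
  define g' where "g' = g * \<nu>"
  define c1 where "c1 = C [^] (- int (2 + n))"
  have c1 [simp]: "c1 \<in> carrier G" by (simp add: c1_def)
  define a1 where "a1 = cj c1 (A [^] (f * int t))"
  have a1 [simp]: "a1 \<in> carrier G" by (simp add: a1_def)
  have rel: "C [^] (- int xv) \<otimes> B [^] g = cj c1 (A [^] f)"
    unfolding c1_def f_def g_def by (rule cj_A_relation)
  have "a1 = (cj c1 (A [^] f)) [^] int t"
    unfolding a1_def by (simp add: cj_int_pow int_pow_pow)
  also have "\<dots> = (inv C [^] int xv \<otimes> B [^] g) [^] int t"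
    unfolding rel[symmetric] by (simp add: int_pow_inv int_pow_neg)
  also have "\<dots> = inv C [^] int (xv * t) \<otimes> B [^] g'"
    unfolding g'_def \<nu>_def by (rule macdonald_group.CA_pow[OF swap])
  finally have a1_eq: "a1 = C [^] (- int (xv * t)) \<otimes> B [^] g'"
    by (simp only: int_pow_inv int_pow_neg closed)
  \<comment> \<open>Bezout splits B^g' into its p-part, with exponent g' v t, and the factor
    \<open>b2\<close> of order prime to p, with exponent g' u p^K.\<close>
  have "coprime (int p ^ K) (int t)"
    using order(2) by (simp add: coprime_commute)
  then obtain u v where uv: "u * int p ^ K + v * int t = 1"
    using bezout_int[of "int p ^ K" "int t"] by (auto simp: coprime_iff_gcd_eq_1)
  define b2 where "b2 = B [^] (g' * (u * int p ^ K))"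
  have b2 [simp]: "b2 \<in> carrier G" by (simp add: b2_def)
  have b2t: "b2 [^] int t = \<one>"
  proof -
    have "int p ^ K * int t dvd (int p ^ K * int t) * (g' * u)" by simp
    then have "int p ^ K * int t dvd g' * (u * int p ^ K) * int t" by (simp only: mult_ac)
    then show ?thesis
      unfolding b2_def by (simp only: int_pow_pow closed) (rule pow_order_multiple[OF closed(2)])
  qed
  obtain k0 where k0: "int xv * ?b ^ (e - n) * (?b * (\<Sum>i<1 + e. (?b ^ (e - n)) ^ i) - 1) = int p ^ (3 * m) * k0"
    "coprime k0 (int p)" using kappa_exact by blast
  obtain w0 where w0: "\<And>x r. x \<in> carrier G \<Longrightarrow> x [^] (int t * r) = x [^] (int t * r * k0 * w0)"
    using unscale[OF k0(2)] by blast
  have Ck: "C [^] int ((e - n) * e) = B [^] (int p ^ (3 * m) * k0)"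
    using C_pow_in_B en unfolding k0(1) by simp
  \<comment> \<open>The exponent of \<open>B\<close> in \<open>Ck\<close> has valuation 3m; since
    p^(3m) divides g, the p-part of B^g' is a power of \<open>C\<close>.\<close>
  have "int p ^ (3 * m) dvd g"
    unfolding g_def using xv_dvd(1) by (intro gsum_minus_power_dvd[OF p m2 p_dvd_n]) (simp only: int_p_dvd)
  then obtain g0 where g0: "g' = int p ^ (3 * m) * g0"
    unfolding g'_def by (metis dvd_mult2 dvdE)
  define q where "q = w0 * g0 * v"
  have "B [^] (g' * (v * int t)) = B [^] (int t * (int p ^ (3 * m) * g0 * v))"
    unfolding g0 by (simp only: mult_ac)
  also have "\<dots> = B [^] (int t * (int p ^ (3 * m) * g0 * v) * k0 * w0)" by (rule w0) simp
  also have "\<dots> = B [^] ((int p ^ (3 * m) * k0) * (int t * q))" unfolding q_def by (simp only: mult_ac)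
  also have "\<dots> = C [^] (int ((e - n) * e) * (int t * q))"
    by (simp only: int_pow_pow[symmetric] closed Ck)
  finally have b1: "B [^] (g' * (v * int t)) = C [^] (int ((e - n) * e) * (int t * q))" .
  define s where "s = - int (xv * t) + int ((e - n) * e) * (int t * q)"
  have "g' = g' * (v * int t) + g' * (u * int p ^ K)"
    using uv by (metis add.commute distrib_left mult.right_neutral)
  then have "B [^] g' = B [^] (g' * (v * int t)) \<otimes> b2"
    unfolding b2_def by (metis int_pow_mult closed(2))
  then have a1s: "a1 = C [^] s \<otimes> b2"
    unfolding a1_eq s_def b1 by (simp only: int_pow_add_left closed b2)
  have ED: "int p ^ (2 * m) dvd int ((e - n) * e)"
  proof -
    have "int p ^ m dvd int (e - n)"
      using p_dvd_D ml by (elim dvd_trans[rotated]) (simp add: le_imp_power_dvd)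
    then have "int p ^ m * int p ^ m dvd int (e - n) * int e" using p_dvd_e by (rule mult_dvd_mono)
    then show ?thesis by (simp only: mult_2 power_add of_nat_mult)
  qed
  have "s = int t * (int ((e - n) * e) * q - int xv)" unfolding s_def by (simp add: algebra_simps)
  moreover have "int p ^ (2 * m) dvd int ((e - n) * e) * q - int xv"
    by (intro dvd_diff dvd_mult2 ED xv_dvd)
  ultimately obtain s0 where s0: "s = int t * (int p ^ (2 * m) * s0)" by (metis dvdE)
  have Cs: "(C [^] s) [^] (int p ^ K) = \<one>"
    unfolding s0 by (simp only: int_pow_pow closed) (rule pow_order_multiple, simp_all)
  have a1K: "a1 [^] (int p ^ K) = \<one>"
  proof -
    have "a1 [^] (int p ^ K) = cj c1 (A [^] (f * int t * int p ^ K))"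
      unfolding a1_def by (simp add: cj_int_pow int_pow_pow)
    also have "A [^] (f * int t * int p ^ K) = \<one>" by (rule pow_order_multiple) simp_all
    finally show ?thesis by (simp add: cj_def)
  qed
  define a2 where "a2 = cj (inv C) a1"
  have a2 [simp]: "a2 \<in> carrier G" by (simp add: a2_def)
  have a2K: "a2 [^] (int p ^ K) = \<one>"
    unfolding a2_def using a1K cj_int_pow[of "inv C" a1 "int p ^ K"] by (simp add: cj_def)
  have invCc1: "c1 \<otimes> inv C = inv C \<otimes> c1"
    unfolding c1_def using int_pow_commute[of C "- int (2 + n)" "- 1"] by (simp only: int_pow_neg closed int_pow_1)
  have a2_eq: "a2 = cj (inv C \<otimes> c1) (A [^] (f * int t))"
    unfolding a2_def a1_def by (simp only: cj_cj closed inv_closed c1 int_pow_closed invCc1)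
  have "a2 [^] (1 + int e) = cj (inv C \<otimes> c1) ((A [^] (f * int t)) [^] (1 + int e))"
    unfolding a2_eq by (simp add: cj_int_pow)
  also have "(A [^] (f * int t)) [^] (1 + int e) = cj C (A [^] (f * int t))"
    by (simp only: cj_C_A int_pow_pow closed)
  also have "cj (inv C \<otimes> c1) (cj C (A [^] (f * int t))) = a1"
    unfolding a1_def by (simp add: cj_cj)
  finally have a12: "a2 [^] (1 + int e) = a1" .
  have a2b: "a2 = C [^] s \<otimes> b2 [^] (1 + int n)"
  proof -
    have "cj (inv C) (C [^] s) = C [^] s"
      using int_pow_commute[of C s "- 1"] by (intro cj_commute) (simp_all add: int_pow_neg)
    moreover have "cj (inv C) b2 = b2 [^] (1 + int n)"
      unfolding b2_def by (simp only: cj_invC_B int_pow_pow closed)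
    ultimately show ?thesis unfolding a2_def a1s by (simp add: cj_mult)
  qed
  \<comment> \<open>The quotient is computed twice: as a power of \<open>b2\<close>, of order prime
    to p, and as a power of the p-element \<open>a2\<close>. Both must be trivial, so b2^\<beta> =
    b2 and \<open>b2\<close> commutes with \<open>C\<close>.\<close>
  have "inv a1 \<otimes> a2 = b2 [^] int n"
  proof -
    have "inv a1 \<otimes> a2 = inv b2 \<otimes> b2 [^] (1 + int n)"
      unfolding a1s a2b by (simp add: inv_mult_group m_assoc)
    also have "\<dots> = b2 [^] int n" by (simp add: int_pow_mult)
    finally show ?thesis .
  qed
  moreover have "inv a1 \<otimes> a2 = a2 [^] (- int e)"
  proof -
    have "inv a1 \<otimes> a2 = a2 [^] (- (1 + int e)) \<otimes> a2 [^] (1::int)"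
      unfolding a12[symmetric] by (simp only: int_pow_neg a2 int_pow_1)
    then show ?thesis by (simp only: int_pow_mult[symmetric] a2) simp
  qed
  ultimately have bn: "b2 [^] int n = a2 [^] (- int e)" by simp
  have "b2 [^] int n = \<one>"
  proof (rule p_and_coprime_trivial)
    have "(a2 [^] (- int e)) [^] (int p ^ K) = (a2 [^] (int p ^ K)) [^] (- int e)"
      by (simp add: int_pow_pow mult.commute)
    then show "(b2 [^] int n) [^] (int p ^ K) = \<one>" by (simp add: bn a2K)
    have "(b2 [^] int n) [^] int t = (b2 [^] int t) [^] int n"
      by (simp add: int_pow_pow mult.commute)
    then show "(b2 [^] int n) [^] int t = \<one>" by (simp add: b2t)
  qed simp
  then have bb: "b2 [^] (1 + int n) = b2" by (simp add: int_pow_mult)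
  have Cb: "cj (inv C) b2 = b2"
    using bb unfolding b2_def by (simp only: cj_invC_B int_pow_pow closed)
  have "cj C b2 = b2" using cj_inv_cancel[of C b2] Cb by simp
  then have "b2 \<otimes> C = C \<otimes> b2" using cj_swap[of C b2] by simp
  then have "cj b2 C = C" by (intro cj_commute) simp_all
  then have "cj b2 (C [^] s) = C [^] s" by (simp add: cj_int_pow)
  then have comm: "C [^] s \<otimes> b2 = b2 \<otimes> C [^] s" using cj_swap[of b2 "C [^] s"] by simp
  \<comment> \<open>The factors of \<open>a1\<close> commute and both \<open>a1\<close> and C^s are
    p-elements, so \<open>b2\<close> is a p-element too.\<close>
  have "a1 [^] (int p ^ K) = (C [^] s) [^] (int p ^ K) \<otimes> b2 [^] (int p ^ K)"
    unfolding a1s by (rule int_pow_mult_distrib[OF comm]) simp_all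
  then have "b2 [^] (int p ^ K) = \<one>" by (simp add: a1K Cs)
  then have "b2 = \<one>" by (rule p_and_coprime_trivial[OF b2 _ b2t])
  then have "cj c1 (A [^] (f * int t)) = C [^] s" using a1s by (simp add: a1_def)
  moreover have "cj c1 (C [^] s) = C [^] s"
    unfolding c1_def by (intro cj_commute int_pow_commute) simp_all
  ultimately have Af: "A [^] (f * int t) = C [^] s"
    using cj_inj[of c1 "A [^] (f * int t)" "C [^] s"] by simp
  obtain f0 where f0: "f = int p ^ (l + m) * f0" "coprime f0 (int p)"
    unfolding f_def using f_exact by blast
  obtain w1 where w1: "\<And>x r. x \<in> carrier G \<Longrightarrow> x [^] (int t * r) = x [^] (int t * r * f0 * w1)"
    using unscale[OF f0(2)] by blast
  have "A [^] (int t * int p ^ (l + m)) = A [^] (int t * int p ^ (l + m) * f0 * w1)" by (rule w1) simp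
  also have "\<dots> = A [^] (f * int t * w1)" unfolding f0(1) by (simp only: mult_ac)
  also have "\<dots> = C [^] (s * w1)" by (simp only: int_pow_pow[symmetric] closed Af)
  also have "s * w1 = int t * (int p ^ (2 * m) * (s0 * w1))" unfolding s0 by (simp only: mult_ac)
  finally show ?thesis by blast
qed

text \<open>The fundamental relation says that (B^xv) conjugated by C^(2+n) is C^(e-n) A^(yval e).
  Its power with exponent t p^j kills the left side, as p^(2m) divides \<open>xv\<close>, and turns
  the exponent of \<open>A\<close> into \<open>yval e\<close> times a sum \<nu> with (\<alpha>^(e-n)
  - 1) \<nu> = \<alpha>^((e-n) t p^j) - 1, so p^j divides \<nu>. The remaining power of
  \<open>C\<close> is a p-element and is killed by t, hence trivial.\<close>

lemma C_pow_trivial: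
  assumes "A [^] (int t * int p ^ (2 * m + j)) = \<one>" "B [^] (int t * int p ^ (2 * m + j)) = \<one>"
  shows "C [^] (int t * int p ^ (l + j)) = \<one>"
proof -
  let ?N = "t * p ^ j" and ?D = "e - n"
  define \<nu> where "\<nu> = (\<Sum>i<?N. ((1 + int e) ^ ?D) ^ i)"
  obtain z where z: "(1 + int e) ^ ?D - 1 = int p ^ (l + m) * z" "coprime z (int p)"
    using exact_prime_power[OF p(1) alpha_D_valuation] by blast
  have "p ^ (l + j) dvd ?D * ?N"
    using pl(1) by (simp add: power_add mult_dvd_mono)
  then have "int p ^ (l + j + m) dvd (1 + int e) ^ (?D * ?N) - 1"
    by (rule one_plus_power_dvd[OF p m0 p_dvd_e])
  also have "(1 + int e) ^ (?D * ?N) - 1 = ((1 + int e) ^ ?D - 1) * \<nu>"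
    unfolding \<nu>_def power_mult[of _ ?D ?N] by (rule power_diff_1_eq)
  also have "\<dots> = int p ^ (l + m) * (z * \<nu>)" by (simp only: z mult.assoc)
  finally have "int p ^ (l + m) * int p ^ j dvd int p ^ (l + m) * (z * \<nu>)"
    by (simp only: power_add[symmetric] add.commute add.left_commute)
  then have "int p ^ j dvd z * \<nu>" using p(1) by (simp only: dvd_mult_cancel_left) (auto simp: prime_gt_0_nat)
  moreover have "coprime (int p ^ j) z" using z(2) by (simp add: coprime_commute)
  ultimately have nu: "int p ^ j dvd \<nu>" using coprime_dvd_mult_right_iff by blast
  have "int p ^ (2 * m) dvd yval e" using yval_valuation[OF p m2 pe] by simp
  then have "int p ^ (2 * m) * int p ^ j dvd yval e * \<nu>" using nu by (rule mult_dvd_mono)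
  then obtain y0 where y0: "yval e * \<nu> = int p ^ (2 * m + j) * y0"
    by (auto simp: power_add elim: dvdE)
  obtain x0 where x0: "int xv = int p ^ (2 * m) * x0" using xv_dvd(1) by (auto elim: dvdE)
  have "B [^] int xv \<otimes> C [^] int (2 + n) = C [^] int (2 + n) \<otimes> (C [^] int ?D \<otimes> A [^] yval e)"
    unfolding fundamental using en by (simp add: int_pow_add_left of_nat_diff add.commute)
  then have "cj (C [^] int (2 + n)) (B [^] int xv) = C [^] int ?D \<otimes> A [^] yval e"
    by (intro cj_eqI) (simp_all del: of_nat_add)
  then have "cj (C [^] int (2 + n)) ((B [^] int xv) [^] int ?N) = (C [^] int ?D \<otimes> A [^] yval e) [^] int ?N"
    by (simp add: cj_int_pow)
  also have "\<dots> = C [^] int (?D * ?N) \<otimes> A [^] (yval e * \<nu>)"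
    unfolding \<nu>_def by (rule CA_pow)
  also have "(B [^] int xv) [^] int ?N = (B [^] (int t * int p ^ (2 * m + j))) [^] x0"
    unfolding int_pow_pow[OF closed(2)] x0 by (simp add: power_add mult_ac)
  finally have "\<one> = C [^] int (?D * ?N) \<otimes> A [^] (yval e * \<nu>)"
    using assms(2) by (simp add: cj_def)
  then have CA: "C [^] int (?D * ?N) = A [^] (- (yval e * \<nu>))"
    using inv_equality[of "C [^] int (?D * ?N)" "A [^] (yval e * \<nu>)"] by (simp add: int_pow_neg)
  have C1: "C [^] int (?D * ?N) = \<one>"
  proof (rule p_and_coprime_trivial)
    show "(C [^] int (?D * ?N)) [^] (int p ^ K) = \<one>"
      unfolding int_pow_pow[OF closed(3)] by (rule pow_order_multiple) (simp_all add: mult_ac)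
    have "(C [^] int (?D * ?N)) [^] int t = (A [^] (int t * int p ^ (2 * m + j))) [^] (- y0)"
      unfolding CA y0 int_pow_pow[OF closed(1)] by (simp add: mult_ac)
    then show "(C [^] int (?D * ?N)) [^] int t = \<one>" using assms(1) by simp
  qed simp
  obtain d0 where d0: "int ?D = int p ^ l * d0" "coprime d0 (int p)"
  proof -
    have "\<not> int p ^ Suc l dvd int ?D" using pl(2) by (simp only: int_p_dvd) simp
    then show ?thesis using exact_prime_power[OF p(1) p_dvd_D] that by blast
  qed
  obtain w where w: "\<And>x r. x \<in> carrier G \<Longrightarrow> x [^] (int t * r) = x [^] (int t * r * d0 * w)"
    using unscale[OF d0(2)] by blast
  have "C [^] (int t * int p ^ (l + j)) = C [^] (int t * int p ^ (l + j) * d0 * w)" by (rule w) simp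
  also have "int t * int p ^ (l + j) * d0 * w = int (?D * ?N) * w"
    unfolding of_nat_mult d0(1) by (simp add: power_add mult_ac)
  finally show ?thesis by (simp only: int_pow_pow[symmetric] closed int_pow_one C1)
qed

end

section \<open>Change of parameters and the bound on the p-part of the group order\<close>

lemma (in group) int_pow_eq_nat_pow:
  assumes "x \<in> carrier G" "finite (carrier G)"
  obtains t :: nat where "x [^] (i::int) = x [^] t"
proof -
  have N: "0 < ord x" using assms ord_ge_1[of x] by simp
  have "int (ord x) dvd i mod int (ord x) - i" by (simp add: mod_eq_dvd_iff[symmetric])
  then have "x [^] i = x [^] (i mod int (ord x))" using int_pow_eq[OF assms(1)] by blast
  moreover have "0 \<le> i mod int (ord x)" using N by simp
  ultimately have "x [^] i = x [^] nat (i mod int (ord x))" by (simp add: pow_nat)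
  then show ?thesis using that by blast
qed

definition exact_val :: "nat \<Rightarrow> nat \<Rightarrow> int \<Rightarrow> bool" where
  "exact_val p r z \<longleftrightarrow> int p ^ r dvd z \<and> \<not> int p ^ Suc r dvd z"

lemma exact_val_shift:
  assumes "exact_val p r z" "int p ^ Suc r dvd x"
  shows "exact_val p r (z + x)"
proof -
  have "int p ^ r dvd x" using assms(2) by (rule dvd_trans[rotated]) (simp add: le_imp_power_dvd)
  then show ?thesis using assms dvd_add_left_iff unfolding exact_val_def by blast
qed

lemma exact_val_minus: "exact_val p r (a - b) \<longleftrightarrow> exact_val p r (b - a)"
  unfolding exact_val_def by (simp only: dvd_diff_commute)

lemma exact_val_nat: "exact_val p r (int x) \<longleftrightarrow> p ^ r dvd x \<and> \<not> p ^ Suc r dvd x"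
  unfolding exact_val_def by (metis of_nat_dvd_iff of_nat_power)

text \<open>The arithmetic hypotheses in a form that is symmetric in \<alpha> and \<beta> and stable
  under adding multiples of p^(l+1) to them.\<close>

definition macdonald_parameters :: "nat \<Rightarrow> nat \<Rightarrow> nat \<Rightarrow> int \<Rightarrow> int \<Rightarrow> bool" where
  "macdonald_parameters p m l \<alpha> \<beta> \<longleftrightarrow> Factorial_Ring.prime p \<and> odd p \<and> 2 \<le> m \<and> m < l \<and> 2 * l < 3 * m \<and>
     exact_val p m (\<alpha> - 1) \<and> exact_val p m (\<beta> - 1) \<and> exact_val p l (\<alpha> - \<beta>)"

lemma macdonald_parameters_swap: "macdonald_parameters p m l \<alpha> \<beta> \<Longrightarrow> macdonald_parameters p m l \<beta> \<alpha>"
  unfolding macdonald_parameters_def using exact_val_minus by blast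

lemma macdonald_parameters_shift:
  assumes "macdonald_parameters p m l \<alpha> \<beta>" "int p ^ Suc l dvd x" "int p ^ Suc l dvd y"
  shows "macdonald_parameters p m l (\<alpha> + x) (\<beta> + y)"
proof -
  have ml: "m < l" using assms(1) by (simp add: macdonald_parameters_def)
  have x: "int p ^ Suc m dvd x" "int p ^ Suc m dvd y"
    using assms(2,3) ml by (auto elim!: dvd_trans[rotated] intro!: le_imp_power_dvd simp del: power_Suc)
  have "exact_val p m (\<alpha> - 1 + x)" "exact_val p m (\<beta> - 1 + y)"
    using assms(1) x by (auto simp: macdonald_parameters_def intro: exact_val_shift)
  moreover have "exact_val p l (\<alpha> - \<beta> + (x - y))"
    using assms by (intro exact_val_shift dvd_diff) (auto simp: macdonald_parameters_def)
  moreover have "\<alpha> - 1 + x = \<alpha> + x - 1" "\<beta> - 1 + y = \<beta> + y - 1" "\<alpha> - \<beta> + (x - y) = \<alpha> + x - (\<beta> + y)"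
    by simp_all
  ultimately show ?thesis using assms(1) unfolding macdonald_parameters_def by simp
qed

lemma large_shift:
  fixes \<beta> b N :: int
  assumes "0 < N"
  obtains z where "b < \<beta> + N * z"
proof -
  define u where "u = \<bar>\<beta>\<bar> + \<bar>b\<bar> + 1"
  have "1 * u \<le> N * u" using assms by (intro mult_right_mono) (auto simp: u_def)
  moreover have "b < \<beta> + u" by (simp add: u_def)
  ultimately have "b < \<beta> + N * u" by linarith
  then show ?thesis using that by blast
qed

context macdonald_group
begin

text \<open>Once the group is finite, \<open>\<alpha>\<close> and \<open>\<beta>\<close> may be replaced by large natural numbers with \<open>\<beta> < \<alpha>\<close>,
  so that all exponents below are natural numbers.\<close>

lemma change_parameters:
  assumes "finite (carrier G)" "int (order G) dvd x" "int (order G) dvd y"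
  shows "macdonald_group G A B C (\<alpha> + x) (\<beta> + y)"
proof unfold_locales
  have *: "g [^] (i + x) = g [^] i" if "g \<in> carrier G" "int (order G) dvd x" for g i x
  proof -
    have "int (ord g) dvd x" using that ord_dvd_group_order[OF that(1)] by (meson dvd_trans of_nat_dvd_iff)
    then have "g [^] x = \<one>" using that(1) by (simp add: int_pow_eq_id)
    then show ?thesis using that(1) by (simp add: int_pow_mult)
  qed
  show "A \<otimes> B = B \<otimes> A \<otimes> C" by (rule AB)
  show "A \<otimes> C = C \<otimes> A [^] (\<alpha> + x)" using AC * assms by simp
  show "C \<otimes> B = B [^] (\<beta> + y) \<otimes> C" using CB * assms by simp
qed simp_all

text \<open>The parameters are changed by multiples of |G| p^(l+1): the factor |G| keeps the
  relations, the factor p^(l+1) keeps the valuations. First \<beta> is pushed above 1, then \<alpha>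
  above the new \<beta>.\<close>

lemma obtain_local:
  assumes fin: "finite (carrier G)" and par: "macdonald_parameters p m l \<alpha> \<beta>"
    and ord: "order G = p ^ K * t" "coprime t p"
  obtains e n where "macdonald_local G A B C e n p m l K t"
proof -
  have o: "0 < order G" using fin by (simp add: order_gt_0_iff_finite)
  have p0: "0 < p" using par by (simp add: macdonald_parameters_def prime_gt_0_nat)
  define N where "N = int (order G) * int p ^ Suc l"
  have N: "0 < N" "int (order G) dvd N * z" "int p ^ Suc l dvd N * z" for z
    using o p0 by (simp_all add: N_def del: power_Suc)
  obtain z1 where z1: "1 < \<beta> + N * z1" using large_shift[OF N(1)] by blast
  obtain z2 where z2: "\<beta> + N * z1 < \<alpha> + N * z2" using large_shift[OF N(1)] by blast
  define e n where "e = nat (\<alpha> + N * z2 - 1)" and "n = nat (\<beta> + N * z1 - 1)"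
  have e: "1 + int e = \<alpha> + N * z2" and n: "1 + int n = \<beta> + N * z1" and ne: "n < e"
    using z1 z2 by (simp_all add: e_def n_def)
  have mg: "macdonald_group G A B C (1 + int e) (1 + int n)"
    unfolding e n by (rule change_parameters[OF fin N(2) N(2)])
  have par': "macdonald_parameters p m l (1 + int e) (1 + int n)"
    unfolding e n by (rule macdonald_parameters_shift[OF par N(3) N(3)])
  have eqs: "1 + int e - (1 + int n) = int (e - n)" "1 + int e - 1 = int e" "1 + int n - 1 = int n"
    using ne by (simp_all add: of_nat_diff)
  have ev: "exact_val p m (int e)" "exact_val p m (int n)" "exact_val p l (int (e - n))"
    using par' unfolding macdonald_parameters_def eqs by blast+
  have "macdonald_local G A B C e n p m l K t"
  proof (intro macdonald_local.intro macdonald_nat.intro mg macdonald_local_axioms.intro)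
    show "Factorial_Ring.prime p" "odd p" "2 \<le> m" "m < l" "2 * l < 3 * m"
      using par by (simp_all add: macdonald_parameters_def)
    show "p ^ m dvd e" "\<not> p ^ Suc m dvd e" "p ^ m dvd n" "\<not> p ^ Suc m dvd n"
      "p ^ l dvd e - n" "\<not> p ^ Suc l dvd e - n"
      using ev unfolding exact_val_nat by blast+
  qed (use ne ord o in auto)
  then show ?thesis using that by blast
qed

text \<open>The rule C^k B^j = B^(j \<beta>^k) C^k shows that the product set of the two cyclic
  groups is closed under multiplication; by finiteness inverses of \<open>C\<close> are natural
  powers of it, so it is also closed under inversion.\<close>

lemma BC_subgroup:
  assumes fin: "finite (carrier G)"
  defines "Q \<equiv> {h \<otimes> C [^] i | h i. h \<in> generate G {B} \<and> i \<in> (UNIV :: nat set)}"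
  shows "subgroup Q G" "card Q dvd ord B * ord C" "B \<in> Q" "C \<in> Q"
proof -
  have H: "subgroup (generate G {B}) G" by (rule generate_is_subgroup) simp
  have o: "0 < ord B" "0 < ord C" using fin ord_ge_1[of B] ord_ge_1[of C] by simp_all
  have Q: "Q = {B [^] (j::int) \<otimes> C [^] int k | j k. True}"
    unfolding Q_def generate_pow[OF closed(2)] by (auto simp: int_pow_int)
  have mult: "B [^] (j::int) \<otimes> C [^] int k \<otimes> (B [^] (j'::int) \<otimes> C [^] int k') \<in> Q" for j k j' k'
  proof -
    have "B [^] j \<otimes> C [^] int k \<otimes> (B [^] j' \<otimes> C [^] int k') = B [^] j \<otimes> ((C [^] int k \<otimes> B [^] j') \<otimes> C [^] int k')"
      by (simp add: m_assoc)
    also have "\<dots> = B [^] (j + j' * \<beta> ^ k) \<otimes> C [^] int (k + k')"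
      unfolding C_B_pow by (simp add: m_assoc int_pow_add_left int_pow_mult[symmetric])
    finally show ?thesis unfolding Q by blast
  qed
  show "subgroup Q G"
  proof (rule subgroupI)
    show "Q \<subseteq> carrier G" by (auto simp: Q)
    show "Q \<noteq> {}" by (auto simp: Q)
    fix x assume "x \<in> Q"
    then obtain j k where x: "x = B [^] (j::int) \<otimes> C [^] int k" by (auto simp: Q)
    obtain k' where k': "C [^] (- int k) = C [^] (k' :: nat)"
      using int_pow_eq_nat_pow[OF closed(3) fin] by blast
    have "inv x = C [^] int k' \<otimes> B [^] (- j)"
      unfolding x int_pow_int k'[symmetric] by (simp add: inv_mult_group int_pow_neg int_pow_int)
    also have "\<dots> = B [^] (- j * \<beta> ^ k') \<otimes> C [^] int k'" by (rule C_B_pow)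
    finally show "inv x \<in> Q" by (auto simp: Q)
    fix y assume "y \<in> Q"
    then obtain j' k' where "y = B [^] (j'::int) \<otimes> C [^] int k'" by (auto simp: Q)
    then show "x \<otimes> y \<in> Q" unfolding x using mult by simp
  qed
  have "generate G {B} = {h \<otimes> B [^] i | h i. h \<in> {\<one>} \<and> i \<in> (UNIV :: nat set)}"
  proof
    show "generate G {B} \<subseteq> {h \<otimes> B [^] i | h i. h \<in> {\<one>} \<and> i \<in> (UNIV :: nat set)}"
    proof
      fix x assume "x \<in> generate G {B}"
      then obtain i :: int where "x = B [^] i" using generate_pow[OF closed(2)] by auto
      then show "x \<in> {h \<otimes> B [^] i | h i. h \<in> {\<one>} \<and> i \<in> (UNIV :: nat set)}"
        using int_pow_eq_nat_pow[OF closed(2) fin, of i] by fastforce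
    qed
    show "{h \<otimes> B [^] i | h i. h \<in> {\<one>} \<and> i \<in> (UNIV :: nat set)} \<subseteq> generate G {B}"
      unfolding generate_pow[OF closed(2)] by (auto simp flip: int_pow_int)
  qed
  from card_cyclic_product[OF triv_subgroup closed(2) this, of "ord B"] o
  have "card (generate G {B}) dvd ord B" by simp
  moreover have "card Q dvd card (generate G {B}) * ord C"
    by (rule card_cyclic_product[OF H closed(3)]) (simp_all add: Q_def o subgroup.one_closed[OF H])
  ultimately show "card Q dvd ord B * ord C" by (meson dvd_refl dvd_trans mult_dvd_mono)
  show "B \<in> Q" unfolding Q by (intro CollectI exI[of _ 1] exI[of _ 0]) simp
  show "C \<in> Q" unfolding Q by (intro CollectI exI[of _ 0] exI[of _ 1]) simp
qed

text \<open>By \<open>carrier_BCA\<close> the group is the product set of the subgroup generated by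
  \<open>B\<close> and \<open>C\<close> and the cyclic group of \<open>A\<close>, so
  \<open>card_cyclic_product\<close> applies with that subgroup.\<close>

lemma order_dvd_ord_mult:
  assumes fin: "finite (carrier G)" and gen: "carrier G = generate G {A, B}"
    and k: "0 < k" "A [^] (k::nat) \<in> {h \<otimes> C [^] i | h i. h \<in> generate G {B} \<and> i \<in> (UNIV :: nat set)}"
  shows "order G dvd ord B * ord C * k"
proof -
  define Q where "Q = {h \<otimes> C [^] i | h i. h \<in> generate G {B} \<and> i \<in> (UNIV :: nat set)}"
  have Q: "subgroup Q G" "card Q dvd ord B * ord C" "B \<in> Q" "C \<in> Q"
    unfolding Q_def by (rule BC_subgroup[OF fin])+
  have o: "0 < ord A" "0 < ord B" using fin ord_ge_1[of A] ord_ge_1[of B] by simp_all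
  have oA: "A [^] int (ord A) = \<one>" and oB: "B [^] int (ord B) = \<one>" by (simp_all add: int_pow_eq_id)
  have "carrier G = {h \<otimes> A [^] i | h i. h \<in> Q \<and> i \<in> (UNIV :: nat set)}"
  proof
    show "carrier G \<subseteq> {h \<otimes> A [^] i | h i. h \<in> Q \<and> i \<in> (UNIV :: nat set)}"
    proof
      fix g assume "g \<in> carrier G"
      then obtain j k i :: nat where g: "g = B [^] int j \<otimes> C [^] int k \<otimes> A [^] int i"
        using carrier_BCA[OF gen o(1) oA o(2) oB] by blast
      have "B [^] int j \<otimes> C [^] int k \<in> Q"
        using subgroup.m_closed[OF Q(1) subgroup_int_pow_closed[OF Q(1) Q(3)] subgroup_int_pow_closed[OF Q(1) Q(4)]] .
      then show "g \<in> {h \<otimes> A [^] i | h i. h \<in> Q \<and> i \<in> (UNIV :: nat set)}"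
        unfolding g by (auto simp: int_pow_int)
    qed
    show "{h \<otimes> A [^] i | h i. h \<in> Q \<and> i \<in> (UNIV :: nat set)} \<subseteq> carrier G"
      using subgroup.mem_carrier[OF Q(1)] by auto
  qed
  from card_cyclic_product[OF Q(1) closed(1) this, of k] k
  have "order G dvd card Q * k" by (simp add: order_def Q_def)
  then show ?thesis using Q(2) by (meson dvd_refl dvd_trans mult_dvd_mono)
qed

text \<open>The exponents m + l and 2l - m for the orders of \<open>B\<close> and \<open>C\<close>,
  and 2m for \<open>A\<close> modulo the subgroup of \<open>B\<close> and \<open>C\<close>, add up
  to 2m + 3l.\<close>

lemma order_valuation:
  assumes fin: "finite (carrier G)" and gen: "carrier G = generate G {A, B}"
    and par: "macdonald_parameters p m l \<alpha> \<beta>"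
  shows "\<not> p ^ Suc (2 * m + 3 * l) dvd order G"
proof -
  have o: "order G \<noteq> 0" using fin order_gt_0_iff_finite by simp
  have p: "Factorial_Ring.prime p" "m < l" "2 * l < 3 * m" "2 \<le> m" "odd p"
    using par by (simp_all add: macdonald_parameters_def)
  obtain t where t: "order G = p ^ multiplicity p (order G) * t" "\<not> p dvd t"
    using multiplicity_decompose'[OF o, of p] p(1) not_prime_unit by blast
  define K where "K = multiplicity p (order G)"
  have ord: "order G = p ^ K * t" "coprime t p"
    using t p(1) prime_imp_coprime coprime_commute unfolding K_def by blast+
  obtain e n where en: "macdonald_local G A B C e n p m l K t"
    using obtain_local[OF fin par ord] by blast
  interpret L: macdonald_local G A B C e n p m l K t by (rule en)
  define Pa Pb Pc where "Pa s \<longleftrightarrow> A [^] (int t * int p ^ s) = \<one>"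
    and "Pb s \<longleftrightarrow> B [^] (int t * int p ^ s) = \<one>" and "Pc s \<longleftrightarrow> C [^] (int t * int p ^ s) = \<one>" for s
  have mono: "x [^] (int t * int p ^ s') = \<one>" if "x \<in> carrier G" "x [^] (int t * int p ^ s) = \<one>" "s \<le> s'" for x s s'
  proof -
    have "int p ^ s' = int p ^ s * int p ^ (s' - s)" using that(3) by (simp flip: power_add)
    then have "x [^] (int t * int p ^ s') = (x [^] (int t * int p ^ s)) [^] (int p ^ (s' - s))"
      using that(1) by (simp add: int_pow_pow mult.assoc)
    then show ?thesis using that(2) by simp
  qed
  have cp: "Pa (2 * m + j) \<Longrightarrow> Pb (2 * m + j) \<Longrightarrow> Pc (l + j)" for j
    unfolding Pa_def Pb_def Pc_def by (rule L.C_pow_trivial)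
  have raise: "x [^] (int t * int p ^ (l + m + j)) = \<one>"
    if "x \<in> carrier G" "y \<in> carrier G" "x [^] (int t * int p ^ (l + m)) = y [^] (int t * (int p ^ (2 * m) * w))"
      "y [^] (int t * int p ^ (2 * m + j)) = \<one>" for x y w j
  proof -
    have "x [^] (int t * int p ^ (l + m + j)) = (x [^] (int t * int p ^ (l + m))) [^] (int p ^ j)"
      using that(1) by (simp add: int_pow_pow power_add mult.assoc)
    also have "\<dots> = (y [^] (int t * int p ^ (2 * m + j))) [^] w"
      unfolding that(3) using that(2) by (simp add: int_pow_pow power_add mult_ac)
    finally show ?thesis using that(4) by simp
  qed
  have pa: "Pc (2 * m + j) \<Longrightarrow> Pa (l + m + j)" for j
    unfolding Pa_def Pc_def using L.A_pow_in_C raise[OF closed(1) closed(3)] by blast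
  have pb: "Pb (l + m + j)" if "Pc (2 * m + j)" for j
  proof -
    obtain e' n' where "macdonald_local G B A (inv C) e' n' p m l K t"
      using macdonald_group.obtain_local[OF swap fin macdonald_parameters_swap[OF par] ord] by blast
    then interpret S: macdonald_local G B A "inv C" e' n' p m l K t .
    have "inv C [^] (int t * int p ^ (2 * m + j)) = \<one>"
      using that by (simp add: Pc_def int_pow_inv)
    then show ?thesis
      unfolding Pb_def using S.A_pow_in_C raise[OF closed(2) inv_closed[OF closed(3)]] by blast
  qed
  have ex: "Pa K \<and> Pb K"
    unfolding Pa_def Pb_def by (simp add: L.pow_order_multiple mult.commute)
  define S where "S = (LEAST s. Pa s \<and> Pb s)"
  have S: "Pa S" "Pb S" using LeastI[of "\<lambda>s. Pa s \<and> Pb s", OF ex] by (simp_all add: S_def)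
  have Smin: "S \<le> s" if "Pa s" "Pb s" for s
    unfolding S_def by (rule Least_le) (use that in simp)
  \<comment> \<open>Descent: if S = 2m + j exceeds l + m, then \<open>C\<close> is killed at level l
    + j, and so \<open>A\<close> and \<open>B\<close> at level l + m + (l + j - 2m) = S - (3m - 2l),
    below S. If l + j < 2m, level l + m is reached at once.\<close>
  have "S \<le> l + m"
  proof (rule ccontr)
    assume "\<not> S \<le> l + m"
    then have s: "l + m < S" by simp
    define j where "j = S - 2 * m"
    have "S = 2 * m + j" using s p(2) by (simp add: j_def)
    then have c: "Pc (l + j)" using cp S by simp
    show False
    proof (cases "2 * m \<le> l + j")
      case True
      define j' where "j' = l + j - 2 * m"
      have "l + j = 2 * m + j'" using True by (simp add: j'_def)
      then have "S \<le> l + m + j'" using Smin pa pb c by simp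
      then show False using True s p \<open>S = 2 * m + j\<close> by (simp add: j'_def)
    next
      case False
      then have "Pc (2 * m + 0)" using c mono[OF closed(3)] unfolding Pc_def by auto
      then have "S \<le> l + m + 0" using Smin pa pb by blast
      then show False using s by simp
    qed
  qed
  then have Pab: "Pa (l + m)" "Pb (l + m)"
    using S mono[OF closed(1)] mono[OF closed(2)] unfolding Pa_def Pb_def by auto
  moreover have "l + m = 2 * m + (l - m)" using p(2) by simp
  ultimately have "Pc (l + (l - m))" using cp by metis
  then have "Pc (2 * l - m)" using p(2) by (simp add: mult_2)
  then have oC: "ord C dvd t * p ^ (2 * l - m)"
    unfolding Pc_def int_pow_eq_id[OF closed(3)] by (metis of_nat_dvd_iff of_nat_mult of_nat_power)
  have oB: "ord B dvd t * p ^ (l + m)"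
    using Pab(2) unfolding Pb_def int_pow_eq_id[OF closed(2)] by (metis of_nat_dvd_iff of_nat_mult of_nat_power)
  \<comment> \<open>By \<open>fundamental\<close> the power A^Y lies in the subgroup of
    \<open>B\<close> and \<open>C\<close>; so \<open>A\<close> contributes only p^(2m) to the order,
    less than its own order allows.\<close>
  define Y where "Y = nat \<bar>yval e\<bar>"
  have yv: "int p ^ (2 * m) dvd yval e" "\<not> int p ^ Suc (2 * m) dvd yval e"
    using yval_valuation[OF p(1,5,4) L.pe] by simp_all
  then have Y0: "0 < Y" by (auto simp: Y_def)
  define Q where "Q = {h \<otimes> C [^] i | h i. h \<in> generate G {B} \<and> i \<in> (UNIV :: nat set)}"
  have Q: "subgroup Q G" "B \<in> Q" "C \<in> Q"
    unfolding Q_def by (rule BC_subgroup[OF fin])+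
  have Qp: "x [^] (i::int) \<in> Q" if "x \<in> Q" for x i
    using subgroup_int_pow_closed[OF Q(1) that] .
  have "A [^] yval e = C [^] (- int (2 + e)) \<otimes> (B [^] int L.xv \<otimes> C [^] int (2 + n))"
    unfolding L.fundamental by (simp add: int_pow_add_left del: of_nat_add)
  also have "\<dots> \<in> Q" by (intro subgroup.m_closed[OF Q(1)] Qp Q)
  finally have "A [^] yval e \<in> Q" .
  then have "(A [^] yval e) [^] (sgn (yval e)) \<in> Q" by (rule Qp)
  then have "A [^] Y \<in> Q"
    by (simp add: int_pow_pow Y_def pow_nat mult_sgn_abs abs_sgn[symmetric])
  then have "order G dvd ord B * ord C * Y"
    unfolding Q_def by (rule order_dvd_ord_mult[OF fin gen Y0])
  also have "\<dots> dvd (t * p ^ (l + m)) * (t * p ^ (2 * l - m)) * Y"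
    by (intro mult_dvd_mono oB oC dvd_refl)
  finally have d: "order G dvd (t * p ^ (l + m)) * (t * p ^ (2 * l - m)) * Y" .
  have "exact_val p (2 * m) (int Y)"
    using yv unfolding exact_val_def Y_def by simp
  then obtain y where y: "Y = p ^ (2 * m) * y" "\<not> p dvd y"
    unfolding exact_val_nat by (metis dvdE mult.commute mult_dvd_mono dvd_refl power_Suc)
  have "(t * p ^ (l + m)) * (t * p ^ (2 * l - m)) * Y = p ^ (l + m + (2 * l - m) + 2 * m) * (t * t * y)"
    unfolding y by (simp only: power_add mult_ac)
  also have "l + m + (2 * l - m) + 2 * m = 2 * m + 3 * l" using p(2) by simp
  finally have d2: "order G dvd p ^ (2 * m + 3 * l) * (t * t * y)" using d by (simp only:)
  show ?thesis
  proof
    assume "p ^ Suc (2 * m + 3 * l) dvd order G"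
    then have "p ^ Suc (2 * m + 3 * l) dvd p ^ (2 * m + 3 * l) * (t * t * y)"
      using d2 by (rule dvd_trans)
    then have "p ^ (2 * m + 3 * l) * p dvd p ^ (2 * m + 3 * l) * (t * t * y)"
      by (simp only: power_Suc2)
    then have "p dvd t * t * y" using p(1) by (simp only: dvd_mult_cancel_left nat_mult_dvd_cancel_disj) auto
    then show False using p(1) t(2) y(2) prime_dvd_mult_iff by blast
  qed
qed

end

section \<open>A permutation model\<close>

lemma cong_scale:
  fixes a b c k :: int
  assumes "c' dvd c" "[a = b] (mod k)"
  shows "[c * a = c * b] (mod c' * k)"
  using assms by (simp add: cong_iff_dvd_diff mult_dvd_mono flip: right_diff_distrib)

lemma cong_halve:
  fixes a b :: int
  assumes "odd p" "[2 * a = 2 * b] (mod int p ^ r)"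
  shows "[a = b] (mod int p ^ r)"
  using odd_power_dvd_times_2[OF assms(1), of r "a - b"] assms(2)
  by (simp add: cong_iff_dvd_diff right_diff_distrib)

lemma sum_of_nat_lessThan: "(\<Sum>r<t. int r) = int (t choose 2)"
  by (induction t) (simp_all add: numeral_2_eq_2)

lemma sum_choose_2_lessThan: "(\<Sum>r<t. int (r choose 2)) = int (t choose 3)"
  by (induction t) (simp_all add: numeral_3_eq_3 numeral_2_eq_2)

text \<open>With e = \<alpha> - 1, n = \<beta> - 1 and \<alpha> - \<beta> = p^l d, the congruence
  for h encodes C^(p^l) = B^h A^h. The factor p^(2m) of h makes most multiples of h vanish modulo
  p^(m+l).\<close>

locale macdonald_arith =
  fixes p m l e n h :: nat and d :: int
  assumes p: "Factorial_Ring.prime p" "odd p"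
    and m2: "2 \<le> m" and ml: "m < l" and l32: "2 * l < 3 * m"
    and pe: "p ^ m dvd e" and pn: "p ^ m dvd n"
    and en: "int e - int n = int p ^ l * d"
    and h: "[2 * int h * d = int e ^ 2] (mod int p ^ (m + l))" "p ^ (2 * m) dvd h"
begin

lemma m0: "0 < m" using m2 by simp

lemma p_dvd_e: "int p ^ m dvd int e" and p_dvd_n: "int p ^ m dvd int n"
  and p_dvd_h: "int p ^ (2 * m) dvd int h"
  using pe pn h(2) by (metis of_nat_dvd_iff of_nat_power)+

lemma p_dvd_e2: "int p ^ (2 * m) dvd int e ^ 2" and p_dvd_n2: "int p ^ (2 * m) dvd int n ^ 2"
  using dvd_power_same[OF p_dvd_e, of 2] dvd_power_same[OF p_dvd_n, of 2]
  by (simp_all add: power_mult[symmetric] mult.commute)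

lemma p_dvd_e3: "int p ^ (3 * m) dvd int e ^ 3" and p_dvd_n3: "int p ^ (3 * m) dvd int n ^ 3"
  using dvd_power_same[OF p_dvd_e, of 3] dvd_power_same[OF p_dvd_n, of 3]
  by (simp_all add: power_mult[symmetric] mult.commute)

lemma P_dvd: "m + l \<le> k \<Longrightarrow> int p ^ (m + l) dvd int p ^ k"
  by (rule le_imp_power_dvd)

lemma cong_P: "[a = b] (mod int p ^ k) \<Longrightarrow> m + l \<le> k \<Longrightarrow> [a = b] (mod int p ^ (m + l))"
  using P_dvd cong_dvd_modulus by blast

text \<open>These inequalities make the errors vanish modulo p^(m+l): p^(3m) and p^(3m-1) come from
  the expansions, and p^(4m-l) divides h p^(2m-l).\<close>

lemma P_bounds: "m + l \<le> 3 * m - 1" "m + l \<le> 3 * m" "m + l \<le> 4 * m - l" "l \<le> 2 * m"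
  using m2 ml l32 by simp_all

lemma e2_cong_n2: "[int n ^ 2 = int e ^ 2] (mod int p ^ (m + l))"
  and ne_cong_e2: "[int n * int e = int e ^ 2] (mod int p ^ (m + l))"
proof -
  have "int p ^ l dvd int e - int n" by (simp add: en)
  then have "int p ^ l dvd int n - int e" by (simp add: dvd_diff_commute)
  then have a: "int p ^ m * int p ^ l dvd int e * (int n - int e)" "int p ^ m * int p ^ l dvd int n * (int n - int e)"
    using p_dvd_e p_dvd_n mult_dvd_mono by blast+
  from a(1) show 1: "[int n * int e = int e ^ 2] (mod int p ^ (m + l))"
    by (simp add: cong_iff_dvd_diff power_add power2_eq_square algebra_simps)
  from a(2) have "[int n ^ 2 = int n * int e] (mod int p ^ (m + l))"
    by (simp add: cong_iff_dvd_diff power_add power2_eq_square algebra_simps)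
  then show "[int n ^ 2 = int e ^ 2] (mod int p ^ (m + l))" using 1 cong_trans by blast
qed

text \<open>\<open>gsum\<close> for \<alpha> = 1 + e with natural values, so that it can be iterated
  and used as a coordinate.\<close>

definition gs :: "nat \<Rightarrow> nat" where
  "gs i = (\<Sum>t=1..i. (1 + e) ^ t)"

lemma int_gs: "int (gs i) = gsum (1 + int e) i"
  by (simp add: gs_def gsum_def)

lemma gs_expand: "[int (gs i) = int i + int (Suc i choose 2) * int e + int (Suc i choose 3) * int e ^ 2] (mod int p ^ (3 * m))"
  unfolding int_gs cong_iff_dvd_diff by (rule dvd_trans[OF p_dvd_e3 gsum_cube_dvd])

lemma gs_expand1: "[int (gs i) = int i + int (Suc i choose 2) * int e] (mod int p ^ (2 * m))"
proof -
  have "[int (gs i) = int i + int (Suc i choose 2) * int e + int (Suc i choose 3) * int e ^ 2] (mod int p ^ (2 * m))"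
    using gs_expand by (rule cong_dvd_modulus) (simp add: le_imp_power_dvd)
  also have "[int i + int (Suc i choose 2) * int e + int (Suc i choose 3) * int e ^ 2
      = int i + int (Suc i choose 2) * int e] (mod int p ^ (2 * m))"
    by (simp add: cong_iff_dvd_diff p_dvd_e2)
  finally show ?thesis .
qed

text \<open>The sum up to i + b is the sum up to i plus \<alpha>^i times the sum up to b, and for
  p^(2m) | b the last product is b modulo p^(3m).\<close>

lemma gs_shift:
  assumes "p ^ (2 * m) dvd b"
  shows "[int (gs (i + b)) = int (gs i) + int b] (mod int p ^ (m + l))"
proof -
  have b: "int p ^ (2 * m) dvd int b" using assms by (metis of_nat_dvd_iff of_nat_power)
  have s: "3 * m = 2 * m + m" by simp
  have "int p ^ (2 * m) dvd 2 * int (Suc b choose 2)" using b by (simp add: two_choose_2)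
  then have "int p ^ (2 * m) dvd int (Suc b choose 2)" by (rule odd_power_dvd_times_2[OF p(2)])
  then have a1: "int p ^ (3 * m) dvd int (Suc b choose 2) * int e"
    unfolding s power_add using p_dvd_e by (rule mult_dvd_mono)
  have "int p ^ Suc m dvd int b"
    using b m2 dvd_trans[OF le_imp_power_dvd[of "Suc m" "2 * m" "int p"]] by simp
  then have "int p ^ m dvd int (Suc b choose 3)"
    by (intro prime_power_dvd_choose_3[OF p]) simp
  then have "int p ^ m * int p ^ (2 * m) dvd int (Suc b choose 3) * int e ^ 2"
    using p_dvd_e2 by (rule mult_dvd_mono)
  then have a2: "int p ^ (3 * m) dvd int (Suc b choose 3) * int e ^ 2"
    by (simp add: power_add[symmetric])
  have "[int (gs b) = int b + int (Suc b choose 2) * int e + int (Suc b choose 3) * int e ^ 2] (mod int p ^ (3 * m))"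
    by (rule gs_expand)
  also have "[int b + int (Suc b choose 2) * int e + int (Suc b choose 3) * int e ^ 2 = int b] (mod int p ^ (3 * m))"
    unfolding cong_iff_dvd_diff using dvd_add[OF a1 a2] by (simp add: algebra_simps)
  finally have gb: "[int (gs b) = int b] (mod int p ^ (3 * m))" .
  have "int p ^ m dvd (1 + int e) ^ i - 1"
    using one_plus_power_dvd[OF p m0 p_dvd_e, of 0 i] by simp
  then have "int p ^ m * int p ^ (2 * m) dvd ((1 + int e) ^ i - 1) * int b"
    using b by (rule mult_dvd_mono)
  then have c: "[(1 + int e) ^ i * int b = int b] (mod int p ^ (3 * m))"
    by (simp add: cong_iff_dvd_diff power_add[symmetric] left_diff_distrib)
  have "int (gs (i + b)) = int (gs i) + (1 + int e) ^ i * int (gs b)"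
    by (simp add: int_gs gsum_add)
  also have "[\<dots> = int (gs i) + int b] (mod int p ^ (3 * m))"
    using cong_trans[OF cong_mult[OF cong_refl gb] c] by (intro cong_add cong_refl)
  finally show ?thesis using P_bounds(2) cong_P by blast
qed

lemma gs_cong:
  assumes "int p ^ (2 * m) dvd int i' - int i"
  shows "[int (gs i') - int (gs i) = int i' - int i] (mod int p ^ (m + l))"
proof (cases "i \<le> i'")
  case True
  then obtain b where b: "i' = i + b" using le_Suc_ex by blast
  then have "p ^ (2 * m) dvd b" using assms by (metis add_diff_cancel_left' of_nat_add of_nat_dvd_iff of_nat_power)
  then show ?thesis using gs_shift[of b i] by (simp add: b cong_iff_dvd_diff algebra_simps)
next
  case False
  then obtain b where b: "i = i' + b" using le_Suc_ex nat_le_linear by blast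
  then have "int p ^ (2 * m) dvd int b" using assms by simp
  then have "p ^ (2 * m) dvd b" by (metis of_nat_dvd_iff of_nat_power)
  from gs_shift[OF this, of i'] show ?thesis unfolding b cong_iff_dvd_diff
    by (subst dvd_diff_commute) (simp add: algebra_simps)
qed

text \<open>A factor (1+x)^(p^l q) is 1 modulo p^(m+l). Hence \<beta>^k depends only on k modulo p^l
  and does not notice a shift by a lattice vector.\<close>

lemma power_cong_P:
  assumes "int k' = int k + int p ^ l * q" "int p ^ m dvd x"
  shows "[(1 + x) ^ k' = (1 + x) ^ k] (mod int p ^ (m + l))"
proof -
  have *: "[(1 + x) ^ (a + b) = (1 + x) ^ a] (mod int p ^ (m + l))" if "int p ^ l dvd int b" for a b
  proof -
    have "p ^ l dvd b" using that by (metis of_nat_dvd_iff of_nat_power)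
    then have "int p ^ (l + m) dvd (1 + x) ^ b - 1" by (rule one_plus_power_dvd[OF p m0 assms(2)])
    then show ?thesis
      by (simp add: cong_iff_dvd_diff power_add[of "1 + x"] add.commute[of m] flip: right_diff_distrib
          mult_cancel_left1 [of "(1 + x) ^ a"])
         (metis dvd_mult mult.right_neutral right_diff_distrib)
  qed
  show ?thesis
  proof (cases "k \<le> k'")
    case True
    then obtain b where "k' = k + b" using le_Suc_ex by blast
    with assms *[of b k] show ?thesis by simp
  next
    case False
    then obtain b where b: "k = k' + b" using le_Suc_ex nat_le_linear by blast
    have "int b = int p ^ l * (- q)" using assms(1) b by simp
    then have "int p ^ l dvd int b" by (metis dvd_triv_left)
    with *[of b k'] b show ?thesis by (simp add: cong_sym)
  qed
qed

end

section \<open>Iterated right multiplication by \<open>B\<close>, modulo powers of p\<close>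

context macdonald_arith
begin

lemma choose_2_cong:
  assumes "[int x = int y] (mod int p ^ r)"
  shows "[int (x choose 2) = int (y choose 2)] (mod int p ^ r)"
  by (rule cong_halve[OF p(2)]) (unfold two_choose_2, intro cong_mult cong_diff cong_refl assms)

text \<open>One step adds e C(i+1,2) modulo p^(2m). The orbit is constant modulo p^m, so with the
  factor e the increment is constant modulo p^(2m) and accumulates linearly.\<close>

lemma it_cong1:
  "[int ((gs ^^ t) i) = int i + int t * (int e * int (Suc i choose 2))] (mod int p ^ (2 * m))"
proof (induction t)
  case (Suc t)
  let ?x = "(gs ^^ t) i" and ?T = "int (Suc i choose 2)"
  have "[int ?x = int i + int t * (int e * ?T)] (mod int p ^ m)"
    using Suc.IH by (rule cong_dvd_modulus) (simp add: le_imp_power_dvd)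
  also have "[int i + int t * (int e * ?T) = int i] (mod int p ^ m)"
    by (simp add: cong_iff_dvd_diff p_dvd_e)
  finally have "[int (Suc ?x) = int (Suc i)] (mod int p ^ m)"
    using cong_add[OF cong_refl[of 1]] by simp
  then have "[int (Suc ?x choose 2) = ?T] (mod int p ^ m)" by (rule choose_2_cong)
  then have "[int e * int (Suc ?x choose 2) = int e * ?T] (mod int p ^ m * int p ^ m)"
    by (rule cong_scale[OF p_dvd_e])
  then have c: "[int e * int (Suc ?x choose 2) = int e * ?T] (mod int p ^ (2 * m))"
    by (simp add: mult_2 power_add)
  have "[int (gs ?x) = int ?x + int e * int (Suc ?x choose 2)] (mod int p ^ (2 * m))"
    using gs_expand1[of ?x] by (simp add: mult.commute)
  also have "[int ?x + int e * int (Suc ?x choose 2)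
     = (int i + int t * (int e * ?T)) + int e * ?T] (mod int p ^ (2 * m))"
    by (rule cong_add[OF Suc.IH c])
  finally show ?case by (simp add: algebra_simps)
qed simp

lemma it_cong0: "[int ((gs ^^ t) i) = int i] (mod int p ^ m)"
proof -
  have "[int ((gs ^^ t) i) = int i + int t * (int e * int (Suc i choose 2))] (mod int p ^ m)"
    using it_cong1 by (rule cong_dvd_modulus) (simp add: le_imp_power_dvd)
  also have "[int i + int t * (int e * int (Suc i choose 2)) = int i] (mod int p ^ m)"
    by (simp add: cong_iff_dvd_diff p_dvd_e)
  finally show ?thesis .
qed

lemma p_dvd_choose_2: "p ^ m dvd N \<Longrightarrow> int p ^ m dvd int (N choose 2)"
  using odd_power_dvd_choose_2[OF p(2), of m N] by (metis of_nat_dvd_iff of_nat_power)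

lemma p_dvd_choose_3: "p ^ m dvd N \<Longrightarrow> int p ^ (m - 1) dvd int (N choose 3)"
proof -
  assume "p ^ m dvd N"
  then have "int p ^ m dvd int N" by (metis of_nat_dvd_iff of_nat_power)
  moreover have "Suc (m - 1) = m" using m0 by simp
  ultimately show ?thesis by (intro prime_power_dvd_choose_3[OF p]) simp
qed

text \<open>Sum the increments along the orbit to second order. Their drift adds up to a multiple of
  e^2 C(N,2), which vanishes because p^m | N; the binomials C(.,3) are controlled only after
  multiplication by 6, whence the precision p^(3m-1).\<close>

lemma it_cong2:
  assumes "p ^ m dvd N"
  shows "[int ((gs ^^ N) i) = int i + int N * (int e * int (Suc i choose 2))] (mod int p ^ (m + l))"
proof -
  let ?x = "\<lambda>r. (gs ^^ r) i" and ?T = "int (Suc i choose 2)"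
  have N: "int p ^ m dvd int N" using assms by (metis of_nat_dvd_iff of_nat_power)
  have tele: "int (?x N) = int i + (\<Sum>r<N. int (gs (?x r)) - int (?x r))" for N
    by (induction N) simp_all
  have a: "[int (gs (?x r)) - int (?x r) = int e * int (Suc (?x r) choose 2) + int e ^ 2 * int (Suc (?x r) choose 3)]
     (mod int p ^ (3 * m))" for r
    using gs_expand[of "?x r"] by (simp add: cong_iff_dvd_diff algebra_simps)
  have "[(\<Sum>r<N. 2 * int (Suc (?x r) choose 2)) = (\<Sum>r<N. 2 * ?T + int r * (int e * ?T * (2 * int i + 1)))] (mod int p ^ (2 * m))"
  proof (rule cong_sum)
    fix r
    have "2 * int (Suc (?x r) choose 2) = int (?x r) * (int (?x r) + 1)"
      by (simp add: two_choose_2 mult.commute)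
    also have "[int (?x r) * (int (?x r) + 1) =
        (int i + int r * (int e * ?T)) * ((int i + int r * (int e * ?T)) + 1)] (mod int p ^ (2 * m))"
      by (intro cong_mult cong_add cong_refl it_cong1)
    also have "(int i + int r * (int e * ?T)) * ((int i + int r * (int e * ?T)) + 1)
      = int i * (int i + 1) + int r * (int e * ?T * (2 * int i + 1)) + int e ^ 2 * (int r * ?T) ^ 2"
      by (simp add: algebra_simps power2_eq_square)
    also have "[\<dots> = int i * (int i + 1) + int r * (int e * ?T * (2 * int i + 1))] (mod int p ^ (2 * m))"
      by (simp add: cong_iff_dvd_diff p_dvd_e2)
    also have "int i * (int i + 1) = 2 * ?T" by (simp add: two_choose_2 mult.commute)
    finally show "[2 * int (Suc (?x r) choose 2) = 2 * ?T + int r * (int e * ?T * (2 * int i + 1))] (mod int p ^ (2 * m))" .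
  qed
  also have "(\<Sum>r<N. 2 * ?T + int r * (int e * ?T * (2 * int i + 1)))
     = 2 * (int N * ?T) + (int (N choose 2) * int e) * (?T * (2 * int i + 1))"
    by (simp add: sum.distrib sum_distrib_right[symmetric] sum_of_nat_lessThan mult.assoc)
  also have "[\<dots> = 2 * (int N * ?T)] (mod int p ^ (2 * m))"
  proof -
    have "int p ^ m * int p ^ m dvd int (N choose 2) * int e"
      using p_dvd_choose_2[OF assms] p_dvd_e by (rule mult_dvd_mono)
    then have "int p ^ (2 * m) dvd int (N choose 2) * int e"
      by (simp only: mult_2 power_add)
    then show ?thesis by (simp only: cong_iff_dvd_diff add_diff_cancel_left' dvd_mult2)
  qed
  finally have "[2 * (\<Sum>r<N. int (Suc (?x r) choose 2)) = 2 * (int N * ?T)] (mod int p ^ (2 * m))"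
    by (simp only: sum_distrib_left)
  then have "[(\<Sum>r<N. int (Suc (?x r) choose 2)) = int N * ?T] (mod int p ^ (2 * m))"
    by (rule cong_halve[OF p(2)])
  then have "[int e * (\<Sum>r<N. int (Suc (?x r) choose 2)) = int e * (int N * ?T)] (mod int p ^ m * int p ^ (2 * m))"
    by (rule cong_scale[OF p_dvd_e])
  then have b: "[int e * (\<Sum>r<N. int (Suc (?x r) choose 2)) = int e * (int N * ?T)] (mod int p ^ (3 * m))"
    by (simp add: power_add[symmetric])
  have "[(\<Sum>r<N. 6 * int (Suc (?x r) choose 3)) = (\<Sum>r<N. (int i + 1) * int i * (int i - 1))] (mod int p ^ m)"
  proof (rule cong_sum)
    fix r
    have "6 * int (Suc (?x r) choose 3) = (int (?x r) + 1) * int (?x r) * (int (?x r) - 1)"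
      by (simp add: six_choose_3 algebra_simps)
    also have "[\<dots> = (int i + 1) * int i * (int i - 1)] (mod int p ^ m)"
      by (intro cong_mult cong_add cong_diff cong_refl it_cong0)
    finally show "[6 * int (Suc (?x r) choose 3) = (int i + 1) * int i * (int i - 1)] (mod int p ^ m)" .
  qed
  then have "[6 * (\<Sum>r<N. int (Suc (?x r) choose 3)) = int N * ((int i + 1) * int i * (int i - 1))] (mod int p ^ m)"
    by (simp only: sum_distrib_left sum_constant card_lessThan)
  then have "int p ^ m dvd 6 * (\<Sum>r<N. int (Suc (?x r) choose 3))"
    using N cong_dvd_iff dvd_mult2 by blast
  moreover have "Suc (m - 1) = m" using m0 by simp
  ultimately have "int p ^ (m - 1) dvd (\<Sum>r<N. int (Suc (?x r) choose 3))"
    using prime_power_dvd_times_6[OF p, of "m - 1"] by simp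
  then have "int p ^ (2 * m) * int p ^ (m - 1) dvd int e ^ 2 * (\<Sum>r<N. int (Suc (?x r) choose 3))"
    using p_dvd_e2 by (rule mult_dvd_mono[rotated])
  moreover have "int p ^ (2 * m) * int p ^ (m - 1) = int p ^ (3 * m - 1)"
    using m0 by (simp add: power_add[symmetric])
  ultimately have c: "[int e ^ 2 * (\<Sum>r<N. int (Suc (?x r) choose 3)) = 0] (mod int p ^ (3 * m - 1))"
    by (simp add: cong_iff_dvd_diff)
  have "[(\<Sum>r<N. int (gs (?x r)) - int (?x r))
     = (\<Sum>r<N. int e * int (Suc (?x r) choose 2) + int e ^ 2 * int (Suc (?x r) choose 3))] (mod int p ^ (3 * m))"
    by (rule cong_sum) (rule a)
  then have "[int (?x N) = int i + (int e * (\<Sum>r<N. int (Suc (?x r) choose 2)) + int e ^ 2 * (\<Sum>r<N. int (Suc (?x r) choose 3)))]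
     (mod int p ^ (3 * m))"
    unfolding tele[of N] by (intro cong_add cong_refl) (simp add: sum.distrib sum_distrib_left)
  then have "[int (?x N) = int i + (int e * (\<Sum>r<N. int (Suc (?x r) choose 2)) + int e ^ 2 * (\<Sum>r<N. int (Suc (?x r) choose 3)))]
     (mod int p ^ (m + l))" using P_bounds(2) by (rule cong_P)
  also have "[int i + (int e * (\<Sum>r<N. int (Suc (?x r) choose 2)) + int e ^ 2 * (\<Sum>r<N. int (Suc (?x r) choose 3)))
     = int i + (int e * (int N * ?T) + 0)] (mod int p ^ (m + l))"
    by (intro cong_add cong_refl cong_P[OF b P_bounds(2)] cong_P[OF c P_bounds(1)])
  finally show ?thesis by (simp add: algebra_simps)
qed

text \<open>Each multiplication by \<open>B\<close> adds the current exponent of \<open>A\<close> to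
  that of \<open>C\<close> and applies \<open>gs\<close> to it; so this is what B^t adds to the
  exponent of \<open>C\<close>.\<close>

definition xs :: "nat \<Rightarrow> nat \<Rightarrow> nat" where
  "xs i t = (\<Sum>r<t. (gs ^^ r) i)"

lemma xs_cong:
  "[int (xs i t) = int t * int i + int (t choose 2) * (int e * int (Suc i choose 2))] (mod int p ^ (2 * m))"
proof -
  let ?T = "int (Suc i choose 2)"
  have "[(\<Sum>r<t. int ((gs ^^ r) i)) = (\<Sum>r<t. int i + int r * (int e * ?T))] (mod int p ^ (2 * m))"
    by (rule cong_sum) (rule it_cong1)
  moreover have "(\<Sum>r<t. int i + int r * (int e * ?T)) = int t * int i + int (t choose 2) * (int e * ?T)"
    by (simp add: sum.distrib sum_distrib_right[symmetric] sum_of_nat_lessThan)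
  ultimately show ?thesis by (simp add: xs_def)
qed

lemma xs_cong_mult:
  assumes "p ^ m dvd N"
  shows "[int (xs i N) = int N * int i] (mod int p ^ (2 * m))"
proof -
  have "int p ^ m * int p ^ m dvd int (N choose 2) * int e"
    using p_dvd_choose_2[OF assms] p_dvd_e by (rule mult_dvd_mono)
  then have "int p ^ (2 * m) dvd int (N choose 2) * (int e * int (Suc i choose 2))"
    by (simp add: mult_2 power_add mult.assoc[symmetric])
  then have "[int N * int i + int (N choose 2) * (int e * int (Suc i choose 2)) = int N * int i] (mod int p ^ (2 * m))"
    by (simp add: cong_iff_dvd_diff)
  with xs_cong show ?thesis by (rule cong_trans)
qed

lemma be_expand: "[(1 + int n) ^ x = 1 + int x * int n + int (x choose 2) * int n ^ 2] (mod int p ^ (3 * m))"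
  unfolding cong_iff_dvd_diff by (rule dvd_trans[OF p_dvd_n3 one_plus_power_cube_dvd])

text \<open>The left side is what B^N adds to the exponent of \<open>B\<close>, starting from C^0
  A^i. After expanding to second order, the linear part of \<open>xs\<close> contributes i n C(N,2);
  the terms with C(N,3) and the quadratic ones are divisible by p^(3m-1).\<close>

lemma js_cong:
  assumes "p ^ m dvd N"
  shows "[(\<Sum>t<N. (1 + int n) ^ xs i t) = int N + int i * int n * int (N choose 2)] (mod int p ^ (m + l))"
proof -
  let ?T = "int (Suc i choose 2)"
  have "[(\<Sum>t<N. int (xs i t)) = (\<Sum>t<N. int t * int i + int (t choose 2) * (int e * ?T))] (mod int p ^ (2 * m))"
    by (rule cong_sum) (rule xs_cong)
  also have "(\<Sum>t<N. int t * int i + int (t choose 2) * (int e * ?T)) = int (N choose 2) * int i + int (N choose 3) * (int e * ?T)"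
    by (simp add: sum.distrib sum_distrib_right[symmetric] sum_of_nat_lessThan sum_choose_2_lessThan)
  finally have "[int n * (\<Sum>t<N. int (xs i t)) = int n * (int (N choose 2) * int i + int (N choose 3) * (int e * ?T))] (mod int p ^ m * int p ^ (2 * m))"
    by (rule cong_scale[OF p_dvd_n])
  then have b: "[int n * (\<Sum>t<N. int (xs i t)) = int n * (int (N choose 2) * int i + int (N choose 3) * (int e * ?T))] (mod int p ^ (3 * m))"
    by (simp add: power_add[symmetric])
  have p3: "int p ^ m * int p ^ m * int p ^ (m - 1) = int p ^ (3 * m - 1)"
    "int p ^ (2 * m) * int p ^ (m - 1) = int p ^ (3 * m - 1)"
  proof -
    have "m + m + (m - 1) = 3 * m - 1" "2 * m + (m - 1) = 3 * m - 1" using m0 by simp_all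
    then show "int p ^ m * int p ^ m * int p ^ (m - 1) = int p ^ (3 * m - 1)"
      "int p ^ (2 * m) * int p ^ (m - 1) = int p ^ (3 * m - 1)"
      by (simp_all only: power_add[symmetric])
  qed
  have "int p ^ m * int p ^ m * int p ^ (m - 1) dvd int n * int e * int (N choose 3)"
    by (intro mult_dvd_mono p_dvd_n p_dvd_e p_dvd_choose_3 assms)
  then have "int p ^ (3 * m - 1) dvd (int n * int e * int (N choose 3)) * ?T"
    unfolding p3 by (rule dvd_mult2)
  then have "int p ^ (3 * m - 1) dvd int n * (int (N choose 3) * (int e * ?T))"
    by (simp only: mult.assoc mult.commute mult.left_commute)
  then have b2: "[int n * (int (N choose 2) * int i + int (N choose 3) * (int e * ?T)) = int i * int n * int (N choose 2)] (mod int p ^ (3 * m - 1))"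
    by (simp add: cong_iff_dvd_diff algebra_simps)
  have sq: "(\<Sum>t<N. int t * int t) = 2 * int (N choose 3) + int (N choose 2)"
  proof -
    have "int t * int t = 2 * int (t choose 2) + int t" for t
      by (simp add: two_choose_2 algebra_simps)
    then show ?thesis
      by (simp add: sum.distrib sum_distrib_left[symmetric] sum_choose_2_lessThan sum_of_nat_lessThan)
  qed
  have "[(\<Sum>t<N. 2 * int (xs i t choose 2)) = (\<Sum>t<N. (int t * int i) * (int t * int i - 1))] (mod int p ^ m)"
  proof (rule cong_sum)
    fix t
    have "[int (xs i t) = int t * int i + int (t choose 2) * (int e * ?T)] (mod int p ^ m)"
      using xs_cong by (rule cong_dvd_modulus) (simp add: le_imp_power_dvd)
    also have "[int t * int i + int (t choose 2) * (int e * ?T) = int t * int i] (mod int p ^ m)"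
      by (simp add: cong_iff_dvd_diff p_dvd_e)
    finally have "[int (xs i t) = int t * int i] (mod int p ^ m)" .
    then show "[2 * int (xs i t choose 2) = (int t * int i) * (int t * int i - 1)] (mod int p ^ m)"
      unfolding two_choose_2 by (intro cong_mult cong_diff cong_refl)
  qed
  moreover have "(\<Sum>t<N. (int t * int i) * (int t * int i - 1)) = (2 * int (N choose 3) + int (N choose 2)) * int i ^ 2 - int (N choose 2) * int i"
  proof -
    have "(int t * int i) * (int t * int i - 1) = (int t * int t) * int i ^ 2 - int t * int i" for t
      by (simp add: algebra_simps power2_eq_square)
    then show ?thesis
      by (simp only: sum_subtractf sum_distrib_right[symmetric] sq sum_of_nat_lessThan)
  qed
  moreover have "(\<Sum>t<N. 2 * int (xs i t choose 2)) = 2 * (\<Sum>t<N. int (xs i t choose 2))"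
    by (rule sum_distrib_left[symmetric])
  ultimately have "[2 * (\<Sum>t<N. int (xs i t choose 2)) = (2 * int (N choose 3) + int (N choose 2)) * int i ^ 2 - int (N choose 2) * int i] (mod int p ^ m)"
    by (simp only:)
  then have c: "[2 * (\<Sum>t<N. int (xs i t choose 2)) = (2 * int (N choose 3) + int (N choose 2)) * int i ^ 2 - int (N choose 2) * int i] (mod int p ^ (m - 1))"
    by (rule cong_dvd_modulus) (simp add: le_imp_power_dvd)
  have c2: "int p ^ (m - 1) dvd int (N choose 2)"
    using p_dvd_choose_2[OF assms] by (rule dvd_trans[OF le_imp_power_dvd, rotated]) simp
  have "int p ^ (m - 1) dvd (2 * int (N choose 3) + int (N choose 2)) * int i ^ 2 - int (N choose 2) * int i"
    by (intro dvd_diff dvd_mult2 dvd_add dvd_mult c2 p_dvd_choose_3 assms)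
  then have "int p ^ (m - 1) dvd 2 * (\<Sum>t<N. int (xs i t choose 2))"
    using cong_dvd_iff[OF c] by blast
  then have "int p ^ (m - 1) dvd (\<Sum>t<N. int (xs i t choose 2))"
    by (rule odd_power_dvd_times_2[OF p(2)])
  then have "int p ^ (2 * m) * int p ^ (m - 1) dvd int n ^ 2 * (\<Sum>t<N. int (xs i t choose 2))"
    using p_dvd_n2 by (rule mult_dvd_mono[rotated])
  then have b3: "[int n ^ 2 * (\<Sum>t<N. int (xs i t choose 2)) = 0] (mod int p ^ (3 * m - 1))"
    by (simp only: p3 cong_iff_dvd_diff diff_zero)
  have "[(\<Sum>t<N. (1 + int n) ^ xs i t) = (\<Sum>t<N. 1 + int (xs i t) * int n + int (xs i t choose 2) * int n ^ 2)] (mod int p ^ (3 * m))"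
    by (rule cong_sum) (rule be_expand)
  also have "(\<Sum>t<N. 1 + int (xs i t) * int n + int (xs i t choose 2) * int n ^ 2)
     = int N + int n * (\<Sum>t<N. int (xs i t)) + int n ^ 2 * (\<Sum>t<N. int (xs i t choose 2))"
    by (simp add: sum.distrib sum_distrib_left mult.commute)
  finally have "[(\<Sum>t<N. (1 + int n) ^ xs i t) = int N + int n * (\<Sum>t<N. int (xs i t)) + int n ^ 2 * (\<Sum>t<N. int (xs i t choose 2))] (mod int p ^ (m + l))"
    using P_bounds(2) by (rule cong_P)
  also have "[int N + int n * (\<Sum>t<N. int (xs i t)) + int n ^ 2 * (\<Sum>t<N. int (xs i t choose 2))
     = int N + int i * int n * int (N choose 2) + 0] (mod int p ^ (m + l))"
    by (intro cong_add cong_refl cong_trans[OF cong_P[OF b P_bounds(2)] cong_P[OF b2 P_bounds(1)]] cong_P[OF b3 P_bounds(1)])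
  finally show ?thesis by simp
qed

end

section \<open>Triples modulo the lattice and the maps on them\<close>

context macdonald_arith
begin

lemma h_mult_cong_0:
  assumes "int p ^ r dvd z" "m + l \<le> 2 * m + r"
  shows "[int h * z = 0] (mod int p ^ (m + l))"
proof -
  have "int p ^ (2 * m) * int p ^ r dvd int h * z"
    using p_dvd_h assms(1) by (rule mult_dvd_mono)
  then have "int p ^ (2 * m + r) dvd int h * z" by (simp only: power_add)
  then show ?thesis
    using dvd_trans[OF P_dvd[OF assms(2)]] by (simp only: cong_iff_dvd_diff diff_zero)
qed

text \<open>The triple \<open>(j, k, i)\<close> stands for \<open>B^j C^k A^i\<close>. Two triples are identified when they differ by a
  vector of the lattice spanned by \<open>(p^(m+l), 0, 0)\<close>, \<open>(0, 0, p^(m+l))\<close> and \<open>(h, -p^l, h)\<close>.\<close>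

definition steq :: "nat \<times> nat \<times> nat \<Rightarrow> nat \<times> nat \<times> nat \<Rightarrow> bool" where
  "steq x y = (case x of (j, k, i) \<Rightarrow> case y of (j', k', i') \<Rightarrow>
     \<exists>q. int k' = int k + int p ^ l * q \<and> [int j' + int h * q = int j] (mod int p ^ (m + l))
        \<and> [int i' + int h * q = int i] (mod int p ^ (m + l)))"

text \<open>The representative of a lattice class in a box: add \<open>k div p ^ l\<close> copies of
  (h, -p^l, h), then reduce the outer coordinates modulo p^(m+l).\<close>

definition nf :: "nat \<times> nat \<times> nat \<Rightarrow> nat \<times> nat \<times> nat" where
  "nf x = (case x of (j, k, i) \<Rightarrow>
     ((j + h * (k div p ^ l)) mod p ^ (m + l), k mod p ^ l, (i + h * (k div p ^ l)) mod p ^ (m + l)))"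

lemma nf_eq_iff: "nf x = nf y \<longleftrightarrow> steq x y"
proof -
  obtain j k i j' k' i' where xy: "x = (j, k, i)" "y = (j', k', i')" by (cases x, cases y)
  have *: "(a + h * u) mod p ^ (m + l) = (b + h * v) mod p ^ (m + l) \<longleftrightarrow>
      [int b + int h * (int v - int u) = int a] (mod int p ^ (m + l))" for a b u v
  proof -
    have "(a + h * u) mod p ^ (m + l) = (b + h * v) mod p ^ (m + l)
       \<longleftrightarrow> [b + h * v = a + h * u] (mod p ^ (m + l))"
      by (auto simp: cong_def)
    also have "\<dots> \<longleftrightarrow> [int b + int h * int v = int a + int h * int u] (mod int p ^ (m + l))"
      by (simp only: cong_int_iff[symmetric] of_nat_add of_nat_mult of_nat_power)
    also have "\<dots> \<longleftrightarrow> [int b + int h * (int v - int u) = int a] (mod int p ^ (m + l))"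
      by (simp add: cong_iff_dvd_diff algebra_simps)
    finally show ?thesis .
  qed
  have p0: "int p ^ l \<noteq> 0" using p(1) by auto
  have kd: "int a = int (a mod p ^ l) + int p ^ l * int (a div p ^ l)" for a
    by (metis mod_mult_div_eq of_nat_add of_nat_mult of_nat_power)
  show ?thesis
  proof
    assume n: "nf x = nf y"
    then have "k mod p ^ l = k' mod p ^ l" by (simp add: nf_def xy)
    then have "int k' = int k + int p ^ l * (int (k' div p ^ l) - int (k div p ^ l))"
      using kd[of k] kd[of k'] by (simp add: right_diff_distrib)
    moreover have "[int j' + int h * (int (k' div p ^ l) - int (k div p ^ l)) = int j] (mod int p ^ (m + l))"
      "[int i' + int h * (int (k' div p ^ l) - int (k div p ^ l)) = int i] (mod int p ^ (m + l))"
      using n by (simp_all add: nf_def xy *)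
    ultimately show "steq x y" by (auto simp: steq_def xy)
  next
    assume "steq x y"
    then obtain q where q: "int k' = int k + int p ^ l * q"
      "[int j' + int h * q = int j] (mod int p ^ (m + l))"
      "[int i' + int h * q = int i] (mod int p ^ (m + l))"
      by (auto simp: steq_def xy)
    have "int (k' mod p ^ l) = int (k mod p ^ l)"
      using q(1) by (simp add: zmod_int)
    then have km: "k' mod p ^ l = k mod p ^ l" by simp
    have "int (k' div p ^ l) = int (k div p ^ l) + q"
      using q(1) p0 by (simp add: zdiv_int)
    then have "q = int (k' div p ^ l) - int (k div p ^ l)" by simp
    then show "nf x = nf y" using q(2,3) km by (simp add: nf_def xy *)
  qed
qed

lemma steq_sym: "steq x y \<Longrightarrow> steq y x"
  using nf_eq_iff by metis

text \<open>Right multiplication of \<open>B^j C^k A^i\<close> by \<open>A\<close>, \<open>B\<close> and \<open>C\<close>.\<close>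

definition fA :: "nat \<times> nat \<times> nat \<Rightarrow> nat \<times> nat \<times> nat" where
  "fA x = (case x of (j, k, i) \<Rightarrow> (j, k, i + 1))"
definition fB :: "nat \<times> nat \<times> nat \<Rightarrow> nat \<times> nat \<times> nat" where
  "fB x = (case x of (j, k, i) \<Rightarrow> (j + (1 + n) ^ k, k + i, gs i))"
definition fC :: "nat \<times> nat \<times> nat \<Rightarrow> nat \<times> nat \<times> nat" where
  "fC x = (case x of (j, k, i) \<Rightarrow> (j, k + 1, (1 + e) * i))"

lemma steq_fA: "steq x y \<Longrightarrow> steq (fA x) (fA y)"
proof -
  assume a: "steq x y"
  obtain j k i j' k' i' where xy: "x = (j, k, i)" "y = (j', k', i')" by (cases x, cases y)
  from a obtain q where q: "int k' = int k + int p ^ l * q"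
    "[int j' + int h * q = int j] (mod int p ^ (m + l))"
    "[int i' + int h * q = int i] (mod int p ^ (m + l))"
    by (auto simp: steq_def xy)
  have "[int (i' + 1) + int h * q = int (i + 1)] (mod int p ^ (m + l))"
    using q(3) by (simp add: cong_iff_dvd_diff algebra_simps)
  then show ?thesis using q by (auto simp: steq_def xy fA_def)
qed

lemma steq_fC: "steq x y \<Longrightarrow> steq (fC x) (fC y)"
proof -
  assume a: "steq x y"
  obtain j k i j' k' i' where xy: "x = (j, k, i)" "y = (j', k', i')" by (cases x, cases y)
  from a obtain q where q: "int k' = int k + int p ^ l * q"
    "[int j' + int h * q = int j] (mod int p ^ (m + l))"
    "[int i' + int h * q = int i] (mod int p ^ (m + l))"
    by (auto simp: steq_def xy)
  have z: "[int h * (int e * q) = 0] (mod int p ^ (m + l))"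
    using P_bounds(2) by (intro h_mult_cong_0[of m]) (simp_all add: p_dvd_e)
  have "[(1 + int e) * (int i' + int h * q) = (1 + int e) * int i] (mod int p ^ (m + l))"
    using q(3) by (intro cong_mult cong_refl)
  from cong_diff[OF this z]
  have "[int ((1 + e) * i') + int h * q = int ((1 + e) * i)] (mod int p ^ (m + l))"
    by (simp add: cong_iff_dvd_diff algebra_simps)
  moreover have "int (k' + 1) = int (k + 1) + int p ^ l * q" using q(1) by simp
  ultimately show ?thesis using q(2) unfolding steq_def xy fC_def by (simp only: prod.case) blast
qed

text \<open>The map adds i to the middle coordinate, and i is only known up to a multiple of p^(2m)
  = p^l p^(2m-l). The resulting extra lattice steps are harmless, since h p^(2m-l) vanishes modulo
  p^(m+l). The outer coordinates are covered by \<open>power_cong_P\<close> and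
  \<open>gs_cong\<close>.\<close>

lemma steq_fB: "steq x y \<Longrightarrow> steq (fB x) (fB y)"
proof -
  assume a: "steq x y"
  obtain j k i j' k' i' where xy: "x = (j, k, i)" "y = (j', k', i')" by (cases x, cases y)
  from a obtain q where q: "int k' = int k + int p ^ l * q"
    "[int j' + int h * q = int j] (mod int p ^ (m + l))"
    "[int i' + int h * q = int i] (mod int p ^ (m + l))"
    by (auto simp: steq_def xy)
  have "[int i' + int h * q = int i] (mod int p ^ (2 * m))"
    using ml by (intro cong_dvd_modulus[OF q(3) le_imp_power_dvd]) simp
  then have "int p ^ (2 * m) dvd (int i' + int h * q - int i) - int h * q"
    unfolding cong_iff_dvd_diff by (rule dvd_diff[OF _ dvd_mult2[OF p_dvd_h]])
  then have i2: "int p ^ (2 * m) dvd int i' - int i" by simp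
  have "int p ^ (2 * m) = int p ^ l * int p ^ (2 * m - l)"
    using P_bounds(4) by (simp flip: power_add)
  then obtain z where z: "int i' - int i = int p ^ l * (int p ^ (2 * m - l) * z)"
    using i2 by (metis dvdE mult.assoc)
  let ?w = "int p ^ (2 * m - l) * z"
  have hz: "[int h * ?w = 0] (mod int p ^ (m + l))"
    using P_bounds(3,4) by (intro h_mult_cong_0[of "2 * m - l"]) simp_all
  have hw: "[int h * (q + ?w) = int h * q] (mod int p ^ (m + l))"
    using cong_add[OF cong_refl[of "int h * q"] hz] by (simp add: distrib_left)
  have "int (k' + i') = int (k + i) + int p ^ l * (q + ?w)"
    using q(1) z by (simp add: distrib_left)
  moreover have "[int (j' + (1 + n) ^ k') + int h * (q + ?w) = int (j + (1 + n) ^ k)] (mod int p ^ (m + l))"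
    using cong_add[OF cong_trans[OF cong_add[OF cong_refl[of "int j'"] hw] q(2)] power_cong_P[OF q(1) p_dvd_n]]
    by (simp add: algebra_simps)
  moreover have "[int (gs i') + int h * (q + ?w) = int (gs i)] (mod int p ^ (m + l))"
  proof -
    have "[int (gs i') - int (gs i) + int h * (q + ?w) = int i' - int i + int h * q] (mod int p ^ (m + l))"
      by (intro cong_add gs_cong i2 hw)
    also have "[int i' - int i + int h * q = 0] (mod int p ^ (m + l))"
      using q(3) by (simp add: cong_iff_dvd_diff algebra_simps)
    finally show ?thesis by (simp add: cong_iff_dvd_diff algebra_simps)
  qed
  ultimately show ?thesis unfolding steq_def xy fB_def by (simp only: prod.case) blast
qed

lemma fA_pow: "(fA ^^ t) (j, k, i) = (j, k, i + t)"
  by (induction t) (simp_all add: fA_def)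

lemma fC_pow: "(fC ^^ t) (j, k, i) = (j, k + t, (1 + e) ^ t * i)"
  by (induction t) (simp_all add: fC_def algebra_simps)

lemma fB_pow: "(fB ^^ t) (j, k, i) = (j + (\<Sum>r<t. (1 + n) ^ (k + xs i r)), k + xs i t, (gs ^^ t) i)"
  by (induction t) (simp_all add: fB_def xs_def)

lemma fB_pow_0: "(fB ^^ t) (j, 0, 0) = (j + t, 0, 0)"
  by (induction t) (simp_all add: fB_def gs_def)

lemma steq_shift_k:
  assumes "int k' = int k + int p ^ (2 * m) * z"
    "[int j' = int j] (mod int p ^ (m + l))" "[int i' = int i] (mod int p ^ (m + l))"
  shows "steq (j, k, i) (j', k', i')"
proof -
  have "int p ^ (2 * m) = int p ^ l * int p ^ (2 * m - l)"
    using P_bounds(4) by (simp flip: power_add)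
  then have "int k' = int k + int p ^ l * (int p ^ (2 * m - l) * z)"
    using assms(1) by (simp add: mult.assoc)
  moreover have hz: "[int h * (int p ^ (2 * m - l) * z) = 0] (mod int p ^ (m + l))"
    using P_bounds(3,4) by (intro h_mult_cong_0[of "2 * m - l"]) simp_all
  ultimately show ?thesis
    using cong_add[OF assms(2) hz] cong_add[OF assms(3) hz] unfolding steq_def by auto
qed

lemma fA_order: "steq x ((fA ^^ (p ^ (m + l))) x)"
proof -
  obtain j k i where x: "x = (j, k, i)" by (cases x)
  show ?thesis unfolding x fA_pow
    by (rule steq_shift_k[of _ _ 0]) (simp_all add: cong_iff_dvd_diff)
qed

text \<open>The formulas for N steps leave the outer coordinates fixed when N = p^(m+l) and change
  the middle one by a multiple of p^(2m), which \<open>steq_shift_k\<close> absorbs.\<close>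

lemma fB_order: "steq x ((fB ^^ (p ^ (m + l))) x)"
proof -
  obtain j k i where x: "x = (j, k, i)" by (cases x)
  let ?P = "p ^ (m + l)"
  have mP: "p ^ m dvd ?P" by (simp add: le_imp_power_dvd)
  have "[int (xs i ?P) = int ?P * int i] (mod int p ^ (2 * m))" by (rule xs_cong_mult[OF mP])
  moreover have "[int ?P * int i = 0] (mod int p ^ (2 * m))"
    using ml by (auto simp: cong_iff_dvd_diff intro!: dvd_mult2 le_imp_power_dvd)
  ultimately have "[int (xs i ?P) = 0] (mod int p ^ (2 * m))" by (rule cong_trans)
  then obtain z where z: "int (k + xs i ?P) = int k + int p ^ (2 * m) * z"
    by (auto simp: cong_iff_dvd_diff dvd_def)
  have "[int ((gs ^^ ?P) i) = int i + int ?P * (int e * int (Suc i choose 2))] (mod int p ^ (m + l))"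
    by (rule it_cong2[OF mP])
  also have "[int i + int ?P * (int e * int (Suc i choose 2)) = int i] (mod int p ^ (m + l))"
    by (simp add: cong_iff_dvd_diff)
  finally have i: "[int ((gs ^^ ?P) i) = int i] (mod int p ^ (m + l))" .
  have "int (\<Sum>r<?P. (1 + n) ^ (k + xs i r)) = (1 + int n) ^ k * (\<Sum>r<?P. (1 + int n) ^ xs i r)"
    by (simp add: sum_distrib_left power_add)
  also have "[\<dots> = (1 + int n) ^ k * (int ?P + int i * int n * int (?P choose 2))] (mod int p ^ (m + l))"
    by (intro cong_mult cong_refl js_cong[OF mP])
  also have "[(1 + int n) ^ k * (int ?P + int i * int n * int (?P choose 2)) = 0] (mod int p ^ (m + l))"
  proof -
    have "int p ^ (m + l) dvd int (?P choose 2)"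
      using odd_power_dvd_choose_2[OF p(2), of "m + l" ?P] by (metis dvd_refl of_nat_dvd_iff of_nat_power)
    then have "int p ^ (m + l) dvd (1 + int n) ^ k * (int ?P + int i * int n * int (?P choose 2))"
      by (intro dvd_mult dvd_add) simp_all
    then show ?thesis by (simp only: cong_iff_dvd_diff diff_zero)
  qed
  finally have "[int j + int (\<Sum>r<?P. (1 + n) ^ (k + xs i r)) = int j + 0] (mod int p ^ (m + l))"
    by (intro cong_add cong_refl)
  then have j: "[int (j + (\<Sum>r<?P. (1 + n) ^ (k + xs i r))) = int j] (mod int p ^ (m + l))"
    by simp
  show ?thesis unfolding x fB_pow by (rule steq_shift_k[OF z j i])
qed

text \<open>Adding p^(2l-m) = p^l p^(l-m) to the middle coordinate amounts to p^(l-m) lattice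
  vectors, and p^(m+l) divides h p^(l-m).\<close>

lemma fC_order: "steq x ((fC ^^ (p ^ (2 * l - m))) x)"
proof -
  obtain j k i where x: "x = (j, k, i)" by (cases x)
  let ?N = "p ^ (2 * l - m)"
  have "l + (l - m) = 2 * l - m" using ml by simp
  then have k: "int (k + ?N) = int k + int p ^ l * int p ^ (l - m)"
    by (simp flip: power_add)
  have "int p ^ (2 * l - m + m) dvd (1 + int e) ^ ?N - 1"
    by (rule one_plus_power_dvd[OF p m0 p_dvd_e]) simp
  then have "int p ^ (m + l) dvd (1 + int e) ^ ?N - 1"
    using ml by (elim dvd_trans[OF P_dvd, rotated]) simp
  then have i: "[int ((1 + e) ^ ?N * i) = int i] (mod int p ^ (m + l))"
    using dvd_mult2[of _ "(1 + int e) ^ ?N - 1" "int i"] by (simp add: cong_iff_dvd_diff left_diff_distrib)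
  have hz: "[int h * int p ^ (l - m) = 0] (mod int p ^ (m + l))"
    using ml by (intro h_mult_cong_0[of "l - m"]) simp_all
  show ?thesis unfolding x fC_pow steq_def prod.case
    using k cong_add[OF i hz] cong_add[OF cong_refl[of "int j"] hz] by auto
qed

text \<open>Twice the difference of the exponents of \<open>B\<close> on the two sides of C B =
  B^\<beta> C, applied to (j, k, i); doubling clears the denominator of C(n,2). The sum contributes
  i n^2 (n-1) and the last power 2 n^2 i, which is n^2 i up to p^(3m), and n^2 may be replaced by
  e^2.\<close>

lemma first_coordinate_cong:
  "[2 * ((1 + int n) ^ k * ((\<Sum>r<n. (1 + int n) ^ xs i r) + (1 + int n) ^ xs i n - (1 + int n)))
     = int e ^ 2 * int i] (mod int p ^ (m + l))"
proof -
  have P3: "int p ^ (m + l) dvd int p ^ (3 * m)" by (rule P_dvd[OF P_bounds(2)])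
  have xn: "[int (xs i n) = int n * int i] (mod int p ^ (2 * m))" by (rule xs_cong_mult[OF pn])
  then have "[int n * int (xs i n) = int n * (int n * int i)] (mod int p ^ m * int p ^ (2 * m))"
    by (rule cong_scale[OF p_dvd_n])
  then have a: "[int (xs i n) * int n = int n ^ 2 * int i] (mod int p ^ (3 * m))"
    by (simp add: power_add[symmetric] power2_eq_square mult.commute mult.left_commute)
  have "[int (xs i n) = int n * int i] (mod int p ^ m)"
    using xn by (rule cong_dvd_modulus) (simp add: le_imp_power_dvd)
  then have "int p ^ m dvd int (xs i n)"
    using cong_dvd_iff dvd_mult2[OF p_dvd_n] by blast
  then have "p ^ m dvd xs i n" by (metis of_nat_dvd_iff of_nat_power)
  then have "int p ^ m * int p ^ (2 * m) dvd int (xs i n choose 2) * int n ^ 2"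
    using p_dvd_choose_2 p_dvd_n2 mult_dvd_mono by blast
  then have b: "[int (xs i n choose 2) * int n ^ 2 = 0] (mod int p ^ (3 * m))"
    by (simp add: cong_iff_dvd_diff power_add[symmetric])
  have c: "[(1 + int n) ^ xs i n = 1 + int n ^ 2 * int i + 0] (mod int p ^ (3 * m))"
    by (rule cong_trans[OF be_expand]) (intro cong_add cong_refl a b)
  have "[(\<Sum>r<n. (1 + int n) ^ xs i r) + (1 + int n) ^ xs i n - (1 + int n)
     = (int n + int i * int n * int (n choose 2)) + (1 + int n ^ 2 * int i + 0) - (1 + int n)] (mod int p ^ (m + l))"
    by (intro cong_add cong_diff cong_refl js_cong[OF pn] cong_dvd_modulus[OF c P3])
  from cong_mult[OF cong_refl[of 2] this]
  have "[2 * ((\<Sum>r<n. (1 + int n) ^ xs i r) + (1 + int n) ^ xs i n - (1 + int n))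
     = int i * int n * (2 * int (n choose 2)) + 2 * (int n ^ 2 * int i)] (mod int p ^ (m + l))"
    by (simp add: algebra_simps)
  also have "int i * int n * (2 * int (n choose 2)) + 2 * (int n ^ 2 * int i) = int n ^ 2 * int i + int n ^ 3 * int i"
    unfolding two_choose_2 by (simp add: algebra_simps power2_eq_square power3_eq_cube)
  also have "[\<dots> = int n ^ 2 * int i] (mod int p ^ (m + l))"
    using dvd_trans[OF P3 p_dvd_n3] by (simp add: cong_iff_dvd_diff)
  finally have d: "[2 * ((\<Sum>r<n. (1 + int n) ^ xs i r) + (1 + int n) ^ xs i n - (1 + int n))
     = int n ^ 2 * int i] (mod int p ^ (m + l))" .
  have "int p ^ m dvd (1 + int n) ^ k - 1"
    using one_plus_power_dvd[OF p m0 p_dvd_n, of 0 k] by simp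
  then have "int p ^ m * int p ^ (2 * m) dvd ((1 + int n) ^ k - 1) * int n ^ 2"
    using p_dvd_n2 by (rule mult_dvd_mono)
  then have "int p ^ (3 * m) dvd ((1 + int n) ^ k - 1) * int n ^ 2"
    by (simp add: power_add[symmetric])
  then have "int p ^ (m + l) dvd (((1 + int n) ^ k - 1) * int n ^ 2) * int i"
    using dvd_trans[OF P3] dvd_mult2 by blast
  then have f: "[(1 + int n) ^ k * (int n ^ 2 * int i) = int n ^ 2 * int i] (mod int p ^ (m + l))"
    by (simp add: cong_iff_dvd_diff algebra_simps)
  have "[(1 + int n) ^ k * (2 * ((\<Sum>r<n. (1 + int n) ^ xs i r) + (1 + int n) ^ xs i n - (1 + int n)))
     = (1 + int n) ^ k * (int n ^ 2 * int i)] (mod int p ^ (m + l))"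
    by (intro cong_mult cong_refl d)
  also note f
  also have "[int n ^ 2 * int i = int e ^ 2 * int i] (mod int p ^ (m + l))"
    by (intro cong_mult cong_refl e2_cong_n2)
  finally show ?thesis by (simp only: mult.left_commute)
qed

text \<open>The same comparison for the exponents of \<open>A\<close>. Iterating n times contributes
  n e (i^2 + i), the failure of \<open>gs\<close> to commute with multiplication by \<alpha>
  contributes -e^2 i^2. Only the part linear in i survives, as it must to match a multiple of the
  lattice vector.\<close>

lemma third_coordinate_cong:
  "[2 * ((1 + int e) * int (gs ((gs ^^ n) i)) - int (gs ((1 + e) * i))) = int e ^ 2 * int i] (mod int p ^ (m + l))"
proof -
  let ?x = "(gs ^^ n) i" and ?T = "int (Suc i choose 2)" and ?a = "(1 + e) * i"
  let ?P = "int p ^ (m + l)"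
  have P3: "?P dvd int p ^ (3 * m)" by (rule P_dvd[OF P_bounds(2)])
  have "int p ^ m * int p ^ m dvd int n * int e" by (intro mult_dvd_mono p_dvd_n p_dvd_e)
  then have ne: "int p ^ (2 * m) dvd int n * int e" by (simp add: mult_2 power_add)
  then have "int p ^ (2 * m) dvd int n * (int e * ?T)" by (simp only: mult.assoc[symmetric] dvd_mult2)
  then have "[int i + int n * (int e * ?T) = int i] (mod int p ^ (2 * m))"
    by (simp add: cong_iff_dvd_diff)
  then have "[int ?x = int i] (mod int p ^ (2 * m))" using it_cong1 cong_trans by blast
  then have "[int (gs ?x) - int (gs i) = int ?x - int i] (mod ?P)"
    by (intro gs_cong) (simp add: cong_iff_dvd_diff)
  also have "[int ?x - int i = int i + int n * (int e * ?T) - int i] (mod ?P)"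
    by (intro cong_diff cong_refl it_cong2[OF pn])
  finally have "[int (gs ?x) - int (gs i) + int (gs i) = int n * (int e * ?T) + int (gs i)] (mod ?P)"
    by (intro cong_add cong_refl) simp
  then have g1: "[(1 + int e) * int (gs ?x) = (1 + int e) * (int n * (int e * ?T) + int (gs i))] (mod ?P)"
    by (intro cong_mult cong_refl) simp
  have "int p ^ m * int p ^ (2 * m) dvd int e * (int n * int e)"
    by (intro mult_dvd_mono p_dvd_e ne)
  then have "int p ^ (3 * m) dvd int e * (int n * int e)" by (simp add: power_add[symmetric])
  then have "?P dvd (int e * (int n * int e)) * ?T" by (rule dvd_mult2[OF dvd_trans[OF P3]])
  then have g2: "[(1 + int e) * (int n * (int e * ?T)) = int n * int e * ?T] (mod ?P)"
    by (simp add: cong_iff_dvd_diff algebra_simps)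
  have c3: "[int e ^ 2 * ((1 + int e) * int (Suc i choose 3) - int (Suc ?a choose 3)) = 0] (mod ?P)"
  proof -
    have ae: "[1 + int e = 1] (mod int p ^ m)" by (simp add: cong_iff_dvd_diff p_dvd_e)
    have ai: "[int ?a = int i] (mod int p ^ m)"
      using cong_mult[OF ae cong_refl[of "int i"]] by (simp add: distrib_right)
    have "6 * ((1 + int e) * int (Suc i choose 3) - int (Suc ?a choose 3))
       = (1 + int e) * (6 * int (Suc i choose 3)) - 6 * int (Suc ?a choose 3)"
      by (simp add: algebra_simps)
    also have "\<dots> = (1 + int e) * ((int i + 1) * int i * (int i - 1)) - (int ?a + 1) * int ?a * (int ?a - 1)"
      unfolding six_choose_3 by (simp add: algebra_simps)
    also have "[\<dots> = 1 * ((int i + 1) * int i * (int i - 1)) - (int i + 1) * int i * (int i - 1)] (mod int p ^ m)"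
      by (intro cong_diff cong_mult cong_add cong_refl ae ai)
    finally have "int p ^ m dvd 6 * ((1 + int e) * int (Suc i choose 3) - int (Suc ?a choose 3))"
      by (simp add: cong_iff_dvd_diff)
    moreover have "Suc (m - 1) = m" using m0 by simp
    ultimately have "int p ^ (m - 1) dvd (1 + int e) * int (Suc i choose 3) - int (Suc ?a choose 3)"
      using prime_power_dvd_times_6[OF p, of "m - 1"] by simp
    then have "int p ^ (2 * m) * int p ^ (m - 1) dvd int e ^ 2 * ((1 + int e) * int (Suc i choose 3) - int (Suc ?a choose 3))"
      using p_dvd_e2 by (rule mult_dvd_mono[rotated])
    moreover have "2 * m + (m - 1) = 3 * m - 1" using m0 by simp
    ultimately have "int p ^ (3 * m - 1) dvd int e ^ 2 * ((1 + int e) * int (Suc i choose 3) - int (Suc ?a choose 3))"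
      by (simp only: power_add[symmetric])
    then show ?thesis using dvd_trans[OF P_dvd[OF P_bounds(1)]] by (simp only: cong_iff_dvd_diff diff_zero)
  qed
  have "[(1 + int e) * int (gs i) - int (gs ?a)
     = (1 + int e) * (int i + ?T * int e + int (Suc i choose 3) * int e ^ 2)
       - (int ?a + int (Suc ?a choose 2) * int e + int (Suc ?a choose 3) * int e ^ 2)] (mod ?P)"
    by (intro cong_diff cong_mult cong_refl cong_dvd_modulus[OF gs_expand P3])
  from cong_mult[OF cong_refl[of 2] this]
  have "[2 * ((1 + int e) * int (gs i) - int (gs ?a))
     = ((1 + int e) * (2 * ?T) - 2 * int (Suc ?a choose 2)) * int e
       + 2 * (int e ^ 2 * ((1 + int e) * int (Suc i choose 3) - int (Suc ?a choose 3)))] (mod ?P)"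
    by (simp add: algebra_simps)
  also have "[((1 + int e) * (2 * ?T) - 2 * int (Suc ?a choose 2)) * int e
       + 2 * (int e ^ 2 * ((1 + int e) * int (Suc i choose 3) - int (Suc ?a choose 3)))
     = ((1 + int e) * (2 * ?T) - 2 * int (Suc ?a choose 2)) * int e + 2 * 0] (mod ?P)"
    by (intro cong_add cong_mult cong_refl c3)
  also have "((1 + int e) * (2 * ?T) - 2 * int (Suc ?a choose 2)) * int e + 2 * 0
     = - (int e ^ 2 * int i ^ 2) - int e ^ 3 * int i ^ 2"
    unfolding two_choose_2 by (simp add: algebra_simps power2_eq_square power3_eq_cube)
  also have "[\<dots> = - (int e ^ 2 * int i ^ 2)] (mod ?P)"
    using dvd_trans[OF P3 p_dvd_e3] by (simp add: cong_iff_dvd_diff)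
  finally have g3: "[2 * ((1 + int e) * int (gs i) - int (gs ?a)) = - (int e ^ 2 * int i ^ 2)] (mod ?P)" .
  have "[2 * ((1 + int e) * int (gs ?x) - int (gs ?a))
    = 2 * ((1 + int e) * (int n * (int e * ?T) + int (gs i)) - int (gs ?a))] (mod ?P)"
    by (intro cong_mult cong_diff cong_refl g1)
  also have "2 * ((1 + int e) * (int n * (int e * ?T) + int (gs i)) - int (gs ?a))
    = 2 * ((1 + int e) * (int n * (int e * ?T))) + 2 * ((1 + int e) * int (gs i) - int (gs ?a))"
    by (simp only: distrib_left right_diff_distrib)
  also have "[\<dots> = 2 * (int n * int e * ?T) + - (int e ^ 2 * int i ^ 2)] (mod ?P)"
    by (intro cong_add cong_mult[OF cong_refl g2] g3)
  also have "2 * (int n * int e * ?T) + - (int e ^ 2 * int i ^ 2) = int n * int e * (2 * ?T) + - (int e ^ 2 * int i ^ 2)"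
    by simp
  also have "[\<dots> = int e ^ 2 * (2 * ?T) + - (int e ^ 2 * int i ^ 2)] (mod ?P)"
    by (intro cong_add cong_mult cong_refl ne_cong_e2)
  also have "int e ^ 2 * (2 * ?T) + - (int e ^ 2 * int i ^ 2) = int e ^ 2 * int i"
    unfolding two_choose_2 by (simp add: algebra_simps power2_eq_square)
  finally show ?thesis .
qed

text \<open>The two triples differ by \<open>d i\<close> times the lattice vector \<open>(h, -p^l, h)\<close>; this is what determines \<open>h\<close>.\<close>

lemma steq_fB_fC: "steq (fB (fC x)) (fC ((fB ^^ (1 + n)) x))"
proof -
  obtain j k i where x: "x = (j, k, i)" by (cases x)
  let ?P = "int p ^ (m + l)" and ?x = "(gs ^^ n) i"
  let ?j1 = "j + (1 + n) ^ (k + 1)" and ?k1 = "k + 1 + (1 + e) * i" and ?i1 = "gs ((1 + e) * i)"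
  let ?j2 = "j + (\<Sum>r<n. (1 + n) ^ (k + xs i r)) + (1 + n) ^ (k + xs i n)"
  let ?k2 = "k + xs i n + ?x + 1" and ?i2 = "(1 + e) * gs ?x"
  have y1: "fB (fC x) = (?j1, ?k1, ?i1)" by (simp add: x fB_def fC_def)
  have y2: "fC ((fB ^^ (1 + n)) x) = (?j2, ?k2, ?i2)"
    unfolding x by (simp add: fB_pow del: funpow.simps One_nat_def) (simp add: fB_pow fB_def fC_def xs_def)
  have "[int (xs i n) = int n * int i] (mod int p ^ (2 * m))" by (rule xs_cong_mult[OF pn])
  moreover have "[int ?x = int i] (mod int p ^ (2 * m))"
  proof -
    have "int p ^ m * int p ^ m dvd int n * int e" by (intro mult_dvd_mono p_dvd_n p_dvd_e)
    then have ne: "int p ^ (2 * m) dvd int n * int e" by (simp add: mult_2 power_add)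
    then have "int p ^ (2 * m) dvd int n * (int e * int (Suc i choose 2))"
      by (simp only: mult.assoc[symmetric] dvd_mult2)
    then have "[int i + int n * (int e * int (Suc i choose 2)) = int i] (mod int p ^ (2 * m))"
      by (simp add: cong_iff_dvd_diff)
    then show ?thesis using it_cong1 cong_trans by blast
  qed
  ultimately have "[int (xs i n) + int ?x = int n * int i + int i] (mod int p ^ (2 * m))"
    by (rule cong_add)
  then obtain z where z: "int (xs i n) + int ?x = int n * int i + int i + int p ^ (2 * m) * z"
    by (auto simp: cong_iff_dvd_diff dvd_def algebra_simps)
  have "int p ^ (2 * m) = int p ^ l * int p ^ (2 * m - l)"
    using P_bounds(4) by (simp flip: power_add)
  then have "int ?k2 - int ?k1 = - ((int e - int n) * int i) + int p ^ l * (int p ^ (2 * m - l) * z)"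
    using z by (simp add: algebra_simps)
  then have k: "int ?k2 = int ?k1 + int p ^ l * (int p ^ (2 * m - l) * z - d * int i)"
    unfolding en by (simp add: algebra_simps)
  have hz: "[int h * (int p ^ (2 * m - l) * z) = 0] (mod ?P)"
    using P_bounds(3,4) by (intro h_mult_cong_0[of "2 * m - l"]) simp_all
  have hq: "[2 * (int h * (int p ^ (2 * m - l) * z - d * int i)) = - (int e ^ 2 * int i)] (mod ?P)"
  proof -
    have "2 * (int h * (int p ^ (2 * m - l) * z - d * int i))
      = 2 * (int h * (int p ^ (2 * m - l) * z)) - (2 * int h * d) * int i"
      by (simp add: algebra_simps)
    also have "[\<dots> = 2 * 0 - int e ^ 2 * int i] (mod ?P)"
      by (intro cong_diff cong_mult cong_refl hz h)
    finally show ?thesis by simp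
  qed
  have halve: "[u + int h * (int p ^ (2 * m - l) * z - d * int i) = v] (mod ?P)"
    if "[2 * (u - v) = int e ^ 2 * int i] (mod ?P)" for u v
  proof (rule cong_halve[OF p(2)])
    have "[2 * (u - v) + 2 * (int h * (int p ^ (2 * m - l) * z - d * int i)) = int e ^ 2 * int i + - (int e ^ 2 * int i)] (mod ?P)"
      by (intro cong_add that hq)
    then have "[2 * v + (2 * (u - v) + 2 * (int h * (int p ^ (2 * m - l) * z - d * int i))) = 2 * v + 0] (mod ?P)"
      by (intro cong_add cong_refl) simp
    then show "[2 * (u + int h * (int p ^ (2 * m - l) * z - d * int i)) = 2 * v] (mod ?P)"
      by (simp add: algebra_simps)
  qed
  have "int ?j2 - int ?j1 = (1 + int n) ^ k * ((\<Sum>r<n. (1 + int n) ^ xs i r) + (1 + int n) ^ xs i n - (1 + int n))"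
    by (simp add: power_add sum_distrib_left algebra_simps)
  then have j: "[int ?j2 + int h * (int p ^ (2 * m - l) * z - d * int i) = int ?j1] (mod ?P)"
    using halve[of "int ?j2" "int ?j1"] first_coordinate_cong[of k i] by simp
  have i: "[int ?i2 + int h * (int p ^ (2 * m - l) * z - d * int i) = int ?i1] (mod ?P)"
    using third_coordinate_cong[of i] by (intro halve) (simp only: of_nat_mult of_nat_add of_nat_1)
  show ?thesis unfolding y1 y2 steq_def prod.case using k j i by blast
qed

end

lemma (in group) ord_eq_prime_power:
  assumes "Factorial_Ring.prime p" "x \<in> carrier G" "x [^] (p ^ Suc k) = \<one>" "x [^] (p ^ k) \<noteq> \<one>"
  shows "ord x = p ^ Suc k"
proof -
  have "ord x dvd p ^ Suc k" using assms by (simp add: pow_eq_id del: power_Suc)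
  then obtain i where i: "i \<le> Suc k" "ord x = p ^ i" using divides_primepow_nat[OF assms(1)] by blast
  moreover have "\<not> i \<le> k" using assms(2,4) i(2) by (auto simp: pow_eq_id le_imp_power_dvd)
  ultimately show ?thesis using le_antisym not_less_eq_eq by blast
qed

text \<open>Inversion reverses products, so the relations read from right to left for a, b, c are
  the relations for their inverses.\<close>

lemma (in group) macdonald_group_inverses:
  assumes c: "a \<in> carrier G" "b \<in> carrier G" "c \<in> carrier G"
    and "b \<otimes> a = c \<otimes> a \<otimes> b" "c \<otimes> a = a [^] \<alpha> \<otimes> c" "b \<otimes> c = c \<otimes> b [^] \<beta>"
  shows "macdonald_group G (inv a) (inv b) (inv c) \<alpha> \<beta>"
proof unfold_locales
  show "inv a \<otimes> inv b = inv b \<otimes> inv a \<otimes> inv c"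
    using arg_cong[OF assms(4), of "m_inv G"] c by (simp add: inv_mult_group m_assoc)
  show "inv a \<otimes> inv c = inv c \<otimes> inv a [^] \<alpha>"
    using arg_cong[OF assms(5), of "m_inv G"] c by (simp add: inv_mult_group int_pow_inv)
  show "inv c \<otimes> inv b = inv b [^] \<beta> \<otimes> inv c"
    using arg_cong[OF assms(6), of "m_inv G"] c by (simp add: inv_mult_group int_pow_inv)
qed (use c in simp_all)

lemma (in group) macdonald_group_generated:
  assumes "macdonald_group G a b c \<alpha> \<beta>"
  defines "H \<equiv> G\<lparr>carrier := generate G {a, b}\<rparr>"
  shows "macdonald_group H a b c \<alpha> \<beta>" "carrier H = generate H {a, b}"
proof -
  interpret M: macdonald_group G a b c \<alpha> \<beta> by (rule assms(1))
  have sub: "subgroup (generate G {a, b}) G" by (rule generate_is_subgroup) simp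
  then have gH: "group H" unfolding H_def by (rule subgroup.subgroup_is_group[OF _ group_axioms])
  have ab: "a \<in> generate G {a, b}" "b \<in> generate G {a, b}" by (auto intro: generate.incl)
  have "c = inv a \<otimes> (inv b \<otimes> (a \<otimes> b))" by (simp add: M.AB m_assoc)
  also have "\<dots> \<in> generate G {a, b}"
    by (intro subgroup.m_closed[OF sub] subgroup.m_inv_closed[OF sub] ab)
  finally have cg: "c \<in> generate G {a, b}" .
  have pw: "x [^]\<^bsub>H\<^esub> (i::int) = x [^] i" if "x \<in> generate G {a, b}" for x i
    unfolding H_def using int_pow_consistent[OF sub that] by simp
  show "macdonald_group H a b c \<alpha> \<beta>"
  proof (intro macdonald_group.intro gH macdonald_group_axioms.intro)
    show "a \<otimes>\<^bsub>H\<^esub> b = b \<otimes>\<^bsub>H\<^esub> a \<otimes>\<^bsub>H\<^esub> c" using M.AB by (simp add: H_def)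
    show "a \<otimes>\<^bsub>H\<^esub> c = c \<otimes>\<^bsub>H\<^esub> a [^]\<^bsub>H\<^esub> \<alpha>" using M.AC pw[OF ab(1)] by (simp add: H_def)
    show "c \<otimes>\<^bsub>H\<^esub> b = b [^]\<^bsub>H\<^esub> \<beta> \<otimes>\<^bsub>H\<^esub> c" using M.CB pw[OF ab(2)] by (simp add: H_def)
  qed (use ab cg in \<open>simp_all add: H_def\<close>)
  show "carrier H = generate H {a, b}"
    unfolding H_def using generate_consistent[OF _ sub, of "{a, b}"] ab by simp
qed

section \<open>The permutation group on normal forms\<close>

context macdonald_arith
begin

definition Fs :: "(nat \<times> nat \<times> nat) set" where
  "Fs = {..<p ^ (m + l)} \<times> {..<p ^ l} \<times> {..<p ^ (m + l)}"

definition compat :: "(nat \<times> nat \<times> nat \<Rightarrow> nat \<times> nat \<times> nat) \<Rightarrow> bool" where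
  "compat f \<longleftrightarrow> (\<forall>x y. steq x y \<longrightarrow> steq (f x) (f y))"

text \<open>The map induced on lattice classes. The restriction makes it extensional, as elements of
  \<open>BijGroup\<close> have to be.\<close>

definition R :: "(nat \<times> nat \<times> nat \<Rightarrow> nat \<times> nat \<times> nat) \<Rightarrow> nat \<times> nat \<times> nat \<Rightarrow> nat \<times> nat \<times> nat" where
  "R f = restrict (\<lambda>x. nf (f x)) Fs"

lemma p0: "0 < p" using p(1) by (rule prime_gt_0_nat)

lemma nf_in_Fs: "nf x \<in> Fs"
  using p0 by (cases x) (simp add: nf_def Fs_def)

lemma nf_id: "x \<in> Fs \<Longrightarrow> nf x = x"
  by (cases x) (simp add: nf_def Fs_def)

lemma steq_nf: "steq (nf x) x"
  unfolding nf_eq_iff[symmetric] by (rule nf_id[OF nf_in_Fs])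

lemma nf_compat: "compat f \<Longrightarrow> nf (f (nf x)) = nf (f x)"
  using steq_nf unfolding nf_eq_iff compat_def by blast

lemma R_cong: "(\<And>x. steq (f x) (g x)) \<Longrightarrow> R f = R g"
  unfolding R_def by (intro restrict_ext) (simp add: nf_eq_iff)

lemma compose_R: "compat f \<Longrightarrow> compose Fs (R f) (R g) = R (f \<circ> g)"
  unfolding compose_def R_def by (intro restrict_ext) (simp add: nf_in_Fs nf_compat)

lemma compat_funpow: "compat f \<Longrightarrow> compat (f ^^ t)"
  by (induction t) (simp_all add: compat_def del: split_paired_All)

lemma R_id: "R id = (\<lambda>x\<in>Fs. x)"
  unfolding R_def by (intro restrict_ext) (simp add: nf_id)

text \<open>As the N-th iterate acts trivially on classes, the iterate with exponent N - 1 induces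
  the inverse.\<close>

lemma R_in_Bij:
  assumes f: "compat f" and N: "\<And>x. steq x ((f ^^ N) x)" "0 < N"
  shows "R f \<in> Bij Fs"
proof -
  obtain M where M: "N = Suc M" using N(2) gr0_implies_Suc by blast
  have e1: "nf (f (nf ((f ^^ M) x))) = x" if "x \<in> Fs" for x
  proof -
    have "nf (f (nf ((f ^^ M) x))) = nf ((f ^^ N) x)" by (simp add: nf_compat[OF f] M)
    also have "\<dots> = nf x" using N(1)[of x] by (simp add: nf_eq_iff[symmetric])
    finally show ?thesis using nf_id[OF that] by simp
  qed
  have e2: "nf ((f ^^ M) (nf (f x))) = x" if "x \<in> Fs" for x
  proof -
    have "nf ((f ^^ M) (nf (f x))) = nf ((f ^^ N) x)"
      by (simp add: nf_compat[OF compat_funpow[OF f]] M funpow_swap1)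
    also have "\<dots> = nf x" using N(1)[of x] by (simp add: nf_eq_iff[symmetric])
    finally show ?thesis using nf_id[OF that] by simp
  qed
  have "bij_betw (R f) Fs Fs"
    by (rule bij_betw_byWitness[of _ "\<lambda>x. nf ((f ^^ M) x)"]) (auto simp: R_def e1 e2 nf_in_Fs)
  then show ?thesis by (simp add: Bij_def R_def)
qed

abbreviation K where "K \<equiv> BijGroup Fs"

lemma carrier_K: "carrier K = Bij Fs"
  by (simp add: BijGroup_def)

lemma R_mult: "compat f \<Longrightarrow> R f \<in> Bij Fs \<Longrightarrow> R g \<in> Bij Fs \<Longrightarrow> R f \<otimes>\<^bsub>K\<^esub> R g = R (f \<circ> g)"
  by (simp add: BijGroup_def compose_R)

lemma R_one: "\<one>\<^bsub>K\<^esub> = R id"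
  by (simp add: BijGroup_def R_id)

lemma R_pow:
  assumes "compat f" "R f \<in> Bij Fs"
  shows "R f [^]\<^bsub>K\<^esub> t = R (f ^^ t) \<and> R (f ^^ t) \<in> Bij Fs"
proof (induction t)
  case 0
  have "R id \<in> Bij Fs" unfolding R_id by (rule id_Bij)
  moreover have "R f [^]\<^bsub>K\<^esub> (0::nat) = R id" unfolding R_one[symmetric] by (simp add: nat_pow_def)
  ultimately show ?case by (simp only: funpow_0 id_def funpow.simps) 
next
  case (Suc t)
  interpret K: group K by (rule group_BijGroup)
  have "R f [^]\<^bsub>K\<^esub> Suc t = R (f ^^ t) \<otimes>\<^bsub>K\<^esub> R f" using Suc by simp
  also have "\<dots> = R (f ^^ t \<circ> f)" using Suc assms by (intro R_mult compat_funpow) auto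
  also have "f ^^ t \<circ> f = f ^^ Suc t" by (simp only: funpow_Suc_right)
  finally have "R f [^]\<^bsub>K\<^esub> Suc t = R (f ^^ Suc t)" .
  moreover have "R f [^]\<^bsub>K\<^esub> Suc t \<in> carrier K" using assms(2) by (intro K.nat_pow_closed) (simp add: carrier_K)
  ultimately show ?case by (simp only: carrier_K)
qed

lemma compats: "compat fA" "compat fB" "compat fC"
  unfolding compat_def using steq_fA steq_fB steq_fC by blast+

lemma R_Bijs: "R fA \<in> Bij Fs" "R fB \<in> Bij Fs" "R fC \<in> Bij Fs"
  using R_in_Bij[OF compats(1) fA_order] R_in_Bij[OF compats(2) fB_order] R_in_Bij[OF compats(3) fC_order] p0
  by simp_all

text \<open>The maps act from the right, so it is their inverses that satisfy the relations under composition.\<close>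

lemma model_macdonald:
  "macdonald_group K (inv\<^bsub>K\<^esub> (R fA)) (inv\<^bsub>K\<^esub> (R fB)) (inv\<^bsub>K\<^esub> (R fC)) (1 + int e) (1 + int n)"
proof -
  interpret K: group K by (rule group_BijGroup)
  have car: "R f \<in> carrier K" if "R f \<in> Bij Fs" for f using that by (simp add: BijGroup_def)
  note P = R_pow[OF compats(1) R_Bijs(1)] R_pow[OF compats(2) R_Bijs(2)]
  have cB: "R (fA \<circ> fB) \<in> Bij Fs"
    using compose_Bij[OF R_Bijs(1,2)] by (simp add: compose_R compats)
  show ?thesis
  proof (rule K.macdonald_group_inverses)
    show "R fA \<in> carrier K" "R fB \<in> carrier K" "R fC \<in> carrier K" using car R_Bijs by blast+
    have "R fB \<otimes>\<^bsub>K\<^esub> R fA = R (fB \<circ> fA)" by (intro R_mult compats R_Bijs)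
    also have "fB \<circ> fA = fC \<circ> (fA \<circ> fB)"
    proof
      fix x :: "nat \<times> nat \<times> nat"
      obtain j k i where x: "x = (j, k, i)" by (cases x)
      have "int (gs (Suc i)) = int ((1 + e) * (gs i + 1))"
        by (simp add: int_gs gsum_Suc_left algebra_simps)
      then have "gs (Suc i) = (1 + e) * (gs i + 1)" by (simp only: of_nat_eq_iff)
      then show "(fB \<circ> fA) x = (fC \<circ> (fA \<circ> fB)) x" by (simp add: x fA_def fB_def fC_def)
    qed
    also have "R (fC \<circ> (fA \<circ> fB)) = R fC \<otimes>\<^bsub>K\<^esub> (R fA \<otimes>\<^bsub>K\<^esub> R fB)"
      using R_mult[OF compats(1) R_Bijs(1,2)] R_mult[OF compats(3) R_Bijs(3) cB] by simp
    also have "\<dots> = R fC \<otimes>\<^bsub>K\<^esub> R fA \<otimes>\<^bsub>K\<^esub> R fB"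
      by (intro K.m_assoc[symmetric] car R_Bijs)
    finally show "R fB \<otimes>\<^bsub>K\<^esub> R fA = R fC \<otimes>\<^bsub>K\<^esub> R fA \<otimes>\<^bsub>K\<^esub> R fB" .
    have "R fC \<otimes>\<^bsub>K\<^esub> R fA = R (fC \<circ> fA)" by (intro R_mult compats R_Bijs)
    also have "fC \<circ> fA = fA ^^ (1 + e) \<circ> fC"
    proof
      fix x :: "nat \<times> nat \<times> nat"
      obtain j k i where x: "x = (j, k, i)" by (cases x)
      have "(fA ^^ (1 + e)) (j, k + 1, (1 + e) * i) = (j, k + 1, (1 + e) * i + (1 + e))"
        by (rule fA_pow)
      then show "(fC \<circ> fA) x = (fA ^^ (1 + e) \<circ> fC) x" by (simp add: x fA_def fC_def del: funpow.simps)
    qed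
    also have "R (fA ^^ (1 + e) \<circ> fC) = R fA [^]\<^bsub>K\<^esub> (1 + e) \<otimes>\<^bsub>K\<^esub> R fC"
      by (simp only: P(1)[THEN conjunct1] R_mult[OF compat_funpow[OF compats(1)] P(1)[THEN conjunct2] R_Bijs(3)])
    finally show "R fC \<otimes>\<^bsub>K\<^esub> R fA = R fA [^]\<^bsub>K\<^esub> (1 + int e) \<otimes>\<^bsub>K\<^esub> R fC"
      using int_pow_int[of K "R fA" "1 + e"] by simp
    have "R fB \<otimes>\<^bsub>K\<^esub> R fC = R (fB \<circ> fC)" by (intro R_mult compats R_Bijs)
    also have "\<dots> = R (fC \<circ> fB ^^ (1 + n))"
      by (rule R_cong) (simp only: o_apply steq_fB_fC)
    also have "\<dots> = R fC \<otimes>\<^bsub>K\<^esub> R fB [^]\<^bsub>K\<^esub> (1 + n)"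
      by (simp only: P(2)[THEN conjunct1] R_mult[OF compats(3) R_Bijs(3) P(2)[THEN conjunct2]])
    finally show "R fB \<otimes>\<^bsub>K\<^esub> R fC = R fC \<otimes>\<^bsub>K\<^esub> R fB [^]\<^bsub>K\<^esub> (1 + int n)"
      using int_pow_int[of K "R fB" "1 + n"] by simp
  qed
qed

text \<open>The square of e has valuation 2m, less than m + l, so the congruence for h transfers it
  to 2 h d. This is what bounds the order of \<open>C\<close> in the model from below.\<close>

lemma h_exact:
  assumes "\<not> p ^ Suc m dvd e"
  shows "\<not> int p ^ Suc (2 * m) dvd int h"
proof
  assume "int p ^ Suc (2 * m) dvd int h"
  then have "int p ^ Suc (2 * m) dvd 2 * int h * d" by simp
  moreover have "[2 * int h * d = int e ^ 2] (mod int p ^ Suc (2 * m))"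
    using h(1) ml by (elim cong_dvd_modulus) (intro le_imp_power_dvd, simp)
  ultimately have d: "int p ^ Suc (2 * m) dvd int e ^ 2" using cong_dvd_iff by blast
  obtain v where v: "int e = int p ^ m * v" using p_dvd_e by (rule dvdE)
  have "(int p ^ m) ^ 2 = int p ^ (2 * m)" by (simp add: power_mult[symmetric] mult.commute)
  then have "int p ^ (2 * m) * int p dvd int p ^ (2 * m) * v ^ 2"
    using d unfolding v power_mult_distrib by (simp only: power_Suc2)
  then have "int p dvd v ^ 2" using p0 by (simp only: dvd_mult_cancel_left) simp
  moreover have "Factorial_Ring.prime (int p)" using p(1) by simp
  ultimately have "int p dvd v" using prime_dvd_power by blast
  then have "int p ^ m * int p dvd int e" unfolding v by (intro mult_dvd_mono dvd_refl)
  then have "p ^ Suc m dvd e" by (simp only: power_Suc2[symmetric]) (metis of_nat_dvd_iff of_nat_power)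
  then show False using assms by blast
qed

text \<open>All lower bounds are read off from the point (0, 0, 0), which stands for the neutral
  element: applying B^j, then C^k, then A^i takes it to (j, k, i), so the group is transitive on the
  box \<open>Fs\<close>.\<close>

lemma model_exists:
  assumes e: "\<not> p ^ Suc m dvd e"
  shows "\<exists>(H :: (nat \<times> nat \<times> nat \<Rightarrow> nat \<times> nat \<times> nat) monoid) a b c.
    macdonald_group H a b c (1 + int e) (1 + int n) \<and> carrier H = generate H {a, b} \<and> finite (carrier H) \<and>
    group.ord H a = p ^ (m + l) \<and> group.ord H b = p ^ (m + l) \<and> group.ord H c = p ^ (2 * l - m) \<and>
    p ^ (2 * m + 3 * l) \<le> card (carrier H)"
proof -
  interpret K: group K by (rule group_BijGroup)
  define a b c where "a = inv\<^bsub>K\<^esub> (R fA)" and "b = inv\<^bsub>K\<^esub> (R fB)" and "c = inv\<^bsub>K\<^esub> (R fC)"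
  have car: "R fA \<in> carrier K" "R fB \<in> carrier K" "R fC \<in> carrier K"
    using R_Bijs by (simp_all add: BijGroup_def)
  have mK: "macdonald_group K a b c (1 + int e) (1 + int n)"
    unfolding a_def b_def c_def by (rule model_macdonald)
  define H where "H = K\<lparr>carrier := generate K {a, b}\<rparr>"
  have mH: "macdonald_group H a b c (1 + int e) (1 + int n)" and gen: "carrier H = generate H {a, b}"
    using K.macdonald_group_generated[OF mK] unfolding H_def by blast+
  interpret M: macdonald_group H a b c "1 + int e" "1 + int n" by (rule mH)
  have sub: "subgroup (carrier H) K"
    unfolding H_def using car by (simp add: a_def b_def K.generate_is_subgroup)
  have "finite (Bij Fs)"
  proof (rule finite_subset)
    show "Bij Fs \<subseteq> Fs \<rightarrow>\<^sub>E Fs" by (auto simp: Bij_def PiE_def bij_betw_def)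
    show "finite (Fs \<rightarrow>\<^sub>E Fs)" by (intro finite_PiE) (simp_all add: Fs_def)
  qed
  then have fin: "finite (carrier H)"
    using subgroup.subset[OF sub] finite_subset by (auto simp: BijGroup_def)
  have z: "(0, 0, 0) \<in> Fs" using p0 by (simp add: Fs_def)
  have Hpow: "x [^]\<^bsub>H\<^esub> (t::nat) = x [^]\<^bsub>K\<^esub> t" for x t
    unfolding H_def using K.nat_pow_consistent by simp
  have Hone: "\<one>\<^bsub>H\<^esub> = R id" by (simp add: H_def R_one)
  have pow1: "(inv\<^bsub>K\<^esub> (R f)) [^]\<^bsub>H\<^esub> t = \<one>\<^bsub>H\<^esub> \<longleftrightarrow> R (f ^^ t) = R id"
    if f: "compat f" "R f \<in> Bij Fs" for f and t :: nat
  proof -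
    have fc: "R f \<in> carrier K" using f(2) by (simp add: BijGroup_def)
    have "(inv\<^bsub>K\<^esub> (R f)) [^]\<^bsub>H\<^esub> t = inv\<^bsub>K\<^esub> (R (f ^^ t))"
      using R_pow[OF f, of t] fc by (simp add: Hpow K.nat_pow_inv)
    moreover have "R (f ^^ t) \<in> carrier K" using R_pow[OF f, of t] by (simp add: BijGroup_def)
    ultimately show ?thesis
      unfolding Hone R_one[symmetric] by (metis K.inv_eq_1_iff)
  qed
  have triv: "R (f ^^ t) = R id" if "\<And>x. steq x ((f ^^ t) x)" for f t
    by (rule R_cong) (simp add: steq_sym that)
  have nontriv: "R (f ^^ t) \<noteq> R id" if "nf ((f ^^ t) (0, 0, 0)) \<noteq> (0, 0, 0)" for f t
  proof
    assume "R (f ^^ t) = R id"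
    then have "R (f ^^ t) (0, 0, 0) = R id (0, 0, 0)" by simp
    then show False using that z by (simp add: R_def nf_id)
  qed
  have p1: "1 < p" using p(1) prime_gt_1_nat by blast
  have small: "\<not> p ^ Suc r dvd p ^ r" for r
    using p1 by (simp add: dvd_imp_le not_le)
  obtain r where ml1: "m + l = Suc r" using ml by (cases "m + l") auto
  define r' where "r' = 2 * l - m - 1"
  have lm1: "2 * l - m = Suc r'" using ml by (simp add: r'_def)
  have oa: "group.ord H a = p ^ (m + l)"
    unfolding ml1
  proof (rule M.ord_eq_prime_power[OF p(1) M.closed(1)])
    show "a [^]\<^bsub>H\<^esub> (p ^ Suc r) = \<one>\<^bsub>H\<^esub>"
      unfolding a_def pow1[OF compats(1) R_Bijs(1)] ml1[symmetric] by (rule triv[OF fA_order])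
    show "a [^]\<^bsub>H\<^esub> (p ^ r) \<noteq> \<one>\<^bsub>H\<^esub>"
      unfolding a_def pow1[OF compats(1) R_Bijs(1)]
      using small[of r] unfolding ml1[symmetric]
      by (intro nontriv) (simp add: fA_pow nf_def mod_eq_0_iff_dvd)
  qed
  have ob: "group.ord H b = p ^ (m + l)"
    unfolding ml1
  proof (rule M.ord_eq_prime_power[OF p(1) M.closed(2)])
    show "b [^]\<^bsub>H\<^esub> (p ^ Suc r) = \<one>\<^bsub>H\<^esub>"
      unfolding b_def pow1[OF compats(2) R_Bijs(2)] ml1[symmetric] by (rule triv[OF fB_order])
    show "b [^]\<^bsub>H\<^esub> (p ^ r) \<noteq> \<one>\<^bsub>H\<^esub>"
      unfolding b_def pow1[OF compats(2) R_Bijs(2)]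
      using small[of r] unfolding ml1[symmetric]
      by (intro nontriv) (simp add: fB_pow_0 nf_def mod_eq_0_iff_dvd)
  qed
  have oc: "group.ord H c = p ^ (2 * l - m)"
    unfolding lm1
  proof (rule M.ord_eq_prime_power[OF p(1) M.closed(3)])
    show "c [^]\<^bsub>H\<^esub> (p ^ Suc r') = \<one>\<^bsub>H\<^esub>"
      unfolding c_def pow1[OF compats(3) R_Bijs(3)] lm1[symmetric] by (rule triv[OF fC_order])
    \<comment> \<open>One power of p too few: p^l p^(l-m-1) in the middle reduces to outer
      coordinates h p^(l-m-1), of valuation m + l - 1, hence not 0 modulo p^(m+l).\<close>
    let ?t = "p ^ r'"
    have t: "?t = p ^ l * p ^ (l - m - 1)"
    proof -
      have "r' = l + (l - m - 1)" using ml by (simp add: r'_def)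
      then show ?thesis by (simp only: power_add)
    qed
    have "\<not> p ^ (m + l) dvd h * p ^ (l - m - 1)"
    proof
      assume "p ^ (m + l) dvd h * p ^ (l - m - 1)"
      moreover have "m + l = Suc (2 * m) + (l - m - 1)" using ml by simp
      ultimately have "p ^ (l - m - 1) * p ^ Suc (2 * m) dvd p ^ (l - m - 1) * h"
        by (simp only: power_add mult.commute)
      then have "p ^ Suc (2 * m) dvd h" using p0 by (simp only: nat_mult_dvd_cancel_disj) auto
      then have "int p ^ Suc (2 * m) dvd int h" by (metis of_nat_dvd_iff of_nat_power)
      then show False using h_exact[OF e] by blast
    qed
    then have "nf (0, ?t, 0) \<noteq> (0, 0, 0)"
      using p0 by (simp add: nf_def t mod_eq_0_iff_dvd)
    then show "c [^]\<^bsub>H\<^esub> ?t \<noteq> \<one>\<^bsub>H\<^esub>"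
      unfolding c_def pow1[OF compats(3) R_Bijs(3)] by (intro nontriv) (simp add: fC_pow)
  qed
  have rH: "R fA \<in> carrier H" "R fB \<in> carrier H" "R fC \<in> carrier H"
    using subgroup.m_inv_closed[OF sub M.closed(1)] subgroup.m_inv_closed[OF sub M.closed(2)]
      subgroup.m_inv_closed[OF sub M.closed(3)] car by (simp_all add: a_def b_def c_def)
  have "Fs \<subseteq> (\<lambda>g. g (0, 0, 0)) ` carrier H"
  proof
    fix x assume x: "x \<in> Fs"
    obtain j k i where jki: "x = (j, k, i)" by (cases x)
    define g where "g = R fA [^]\<^bsub>H\<^esub> i \<otimes>\<^bsub>H\<^esub> (R fC [^]\<^bsub>H\<^esub> k \<otimes>\<^bsub>H\<^esub> R fB [^]\<^bsub>H\<^esub> j)"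
    have gH: "g \<in> carrier H" unfolding g_def by (intro M.m_closed M.nat_pow_closed rH)
    have "g = R (fA ^^ i) \<otimes>\<^bsub>K\<^esub> (R (fC ^^ k) \<otimes>\<^bsub>K\<^esub> R (fB ^^ j))"
      unfolding g_def Hpow using R_pow compats R_Bijs by (simp add: H_def)
    also have "R (fC ^^ k) \<otimes>\<^bsub>K\<^esub> R (fB ^^ j) = R (fC ^^ k \<circ> fB ^^ j)"
      using R_pow compats R_Bijs by (intro R_mult compat_funpow) auto
    also have "R (fA ^^ i) \<otimes>\<^bsub>K\<^esub> R (fC ^^ k \<circ> fB ^^ j) = R (fA ^^ i \<circ> (fC ^^ k \<circ> fB ^^ j))"
    proof (intro R_mult compat_funpow compats)
      show "R (fA ^^ i) \<in> Bij Fs" using R_pow compats R_Bijs by blast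
      have "compose Fs (R (fC ^^ k)) (R (fB ^^ j)) \<in> Bij Fs"
        using R_pow compats R_Bijs by (intro compose_Bij) blast+
      then show "R (fC ^^ k \<circ> fB ^^ j) \<in> Bij Fs" by (simp add: compose_R compat_funpow compats)
    qed
    finally have "g (0, 0, 0) = nf ((fA ^^ i) ((fC ^^ k) ((fB ^^ j) (0, 0, 0))))"
      using z by (simp add: R_def)
    also have "\<dots> = x" using nf_id[OF x] by (simp add: fB_pow_0 fC_pow fA_pow jki)
    finally show "x \<in> (\<lambda>g. g (0, 0, 0)) ` carrier H" using gH by blast
  qed
  then have "card Fs \<le> card (carrier H)" using fin by (meson card_image_le card_mono finite_imageI le_trans)
  moreover have "card Fs = p ^ (2 * m + 3 * l)"
  proof -
    have "card Fs = p ^ (m + l + (l + (m + l)))"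
      by (simp add: Fs_def card_cartesian_product flip: power_add)
    also have "m + l + (l + (m + l)) = 2 * m + 3 * l" by simp
    finally show ?thesis .
  qed
  ultimately show ?thesis using mH gen fin oa ob oc by metis
qed

end

section \<open>Nilpotency class\<close>

context group
begin

text \<open>The upper central series, compared with \<open>lcs\<close> in
  \<open>lcs_subset_ucs\<close> to bound the class from above.\<close>

fun ucs :: "nat \<Rightarrow> 'a set" where
  "ucs 0 = {\<one>}"
| "ucs (Suc k) = {x \<in> carrier G. \<forall>y\<in>carrier G. comm G x y \<in> ucs k}"

lemma comm_closed [simp]: "x \<in> carrier G \<Longrightarrow> y \<in> carrier G \<Longrightarrow> comm G x y \<in> carrier G"
  by (simp add: comm_def)

lemma comm_cj: "x \<in> carrier G \<Longrightarrow> y \<in> carrier G \<Longrightarrow> comm G x y = inv x \<otimes> cj y x"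
  by (simp add: comm_def cj_def m_assoc)

lemma comm_one_left: "y \<in> carrier G \<Longrightarrow> comm G \<one> y = \<one>"
  by (simp add: comm_def)

text \<open>The commutator identities for inverses and products involve conjugates, so closure and
  normality are proved in one induction.\<close>

lemma ucs_subgroup_cj:
  "subgroup (ucs k) G \<and> (\<forall>x\<in>ucs k. \<forall>g\<in>carrier G. cj g x \<in> ucs k)"
proof (induction k)
  case 0
  show ?case using triv_subgroup by (simp add: cj_def)
next
  case (Suc k)
  have sub: "subgroup (ucs k) G" and cjk: "\<And>x g. x \<in> ucs k \<Longrightarrow> g \<in> carrier G \<Longrightarrow> cj g x \<in> ucs k"
    using Suc by auto
  have "subgroup (ucs (Suc k)) G"
  proof (rule subgroupI)
    show "ucs (Suc k) \<subseteq> carrier G" by auto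
    have "\<one> \<in> ucs (Suc k)" by (simp add: comm_one_left subgroup.one_closed[OF sub])
    then show "ucs (Suc k) \<noteq> {}" by blast
    fix x assume x: "x \<in> ucs (Suc k)"
    then have xc: "x \<in> carrier G" by simp
    show "inv x \<in> ucs (Suc k)"
    proof (simp add: xc, intro ballI)
      fix y assume y: "y \<in> carrier G"
      have "comm G (inv x) y = cj (inv x) (inv (comm G x y))"
        using xc y by (simp add: comm_def cj_def m_assoc inv_mult_group)
      then show "comm G (inv x) y \<in> ucs k"
        using x y xc cjk subgroup.m_inv_closed[OF sub] by simp
    qed
    fix z assume z: "z \<in> ucs (Suc k)"
    then have zc: "z \<in> carrier G" by simp
    show "x \<otimes> z \<in> ucs (Suc k)"
    proof (simp add: xc zc, intro ballI)
      fix y assume y: "y \<in> carrier G"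
      have "comm G (x \<otimes> z) y = cj z (comm G x y) \<otimes> comm G z y"
        using xc zc y by (simp add: comm_def cj_def m_assoc inv_mult_group)
      then show "comm G (x \<otimes> z) y \<in> ucs k"
        using x z y zc cjk subgroup.m_closed[OF sub] by simp
    qed
  qed
  moreover have "cj g x \<in> ucs (Suc k)" if x: "x \<in> ucs (Suc k)" and g: "g \<in> carrier G" for x g
  proof -
    have xc: "x \<in> carrier G" using x by simp
    have "comm G (cj g x) y \<in> ucs k" if y: "y \<in> carrier G" for y
    proof -
      have "comm G (cj g x) y = cj g (comm G x (cj (inv g) y))"
        using xc g y by (simp add: comm_def cj_def m_assoc inv_mult_group)
      then show ?thesis using x y g cjk by simp
    qed
    then show ?thesis using xc g by simp
  qed
  ultimately show ?case by blast
qed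

lemma ucs_subgroup: "subgroup (ucs k) G"
  and ucs_cj: "x \<in> ucs k \<Longrightarrow> g \<in> carrier G \<Longrightarrow> cj g x \<in> ucs k"
  using ucs_subgroup_cj by blast+

lemma ucs_Suc_mono: "ucs k \<subseteq> ucs (Suc k)"
proof (induction k)
  case 0
  show ?case by (simp add: comm_one_left)
next
  case (Suc k)
  then show ?case by auto
qed

text \<open>The identity [x, yz] = [x,z] [x,y]^z and normality of the previous term extend the
  condition from generators to the whole group.\<close>

lemma ucs_generators:
  assumes gen: "carrier G = generate G S" and S: "S \<subseteq> carrier G"
    and x: "x \<in> carrier G" and "\<And>s. s \<in> S \<Longrightarrow> comm G x s \<in> ucs k"
  shows "x \<in> ucs (Suc k)"
proof -
  note sub = ucs_subgroup[of k]
  have "comm G x y \<in> ucs k" if "y \<in> generate G S" for y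
    using that
  proof (induction rule: generate.induct)
    case one
    have "comm G x \<one> = \<one>" using x by (simp add: comm_def)
    then show ?case using subgroup.one_closed[OF sub] by simp
  next
    case (incl h)
    then show ?case using assms(4) by blast
  next
    case (inv h)
    then have h: "h \<in> carrier G" using S by blast
    have "comm G x (inv h) = cj (inv h) (inv (comm G x h))"
      using x h by (simp add: comm_def cj_def m_assoc inv_mult_group)
    then show ?case using assms(4)[OF inv] h ucs_cj subgroup.m_inv_closed[OF sub] by simp
  next
    case (eng y z)
    then have c: "y \<in> carrier G" "z \<in> carrier G" using gen by auto
    have "comm G x (y \<otimes> z) = comm G x z \<otimes> cj z (comm G x y)"
      using x c by (simp add: comm_def cj_def m_assoc inv_mult_group)
    then show ?case using eng.IH c ucs_cj subgroup.m_closed[OF sub] by simp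
  qed
  then show ?thesis using x gen by auto
qed

lemma lcs_subset_ucs:
  assumes "carrier G \<subseteq> ucs N" "k \<le> N"
  shows "lcs G k \<subseteq> ucs (N - k)"
  using assms(2)
proof (induction k)
  case 0
  then show ?case using assms(1) by simp
next
  case (Suc k)
  then have IH: "lcs G k \<subseteq> ucs (N - k)" by simp
  have N: "N - k = Suc (N - Suc k)" using Suc.prems by simp
  have "{comm G x y | x y. x \<in> lcs G k \<and> y \<in> carrier G} \<subseteq> ucs (N - Suc k)"
    using IH unfolding N by auto
  then show ?case by (simp add: generate_subgroup_incl ucs_subgroup)
qed

lemma lcs_closed: "lcs G k \<subseteq> carrier G"
proof (induction k)
  case (Suc k)
  then have "{comm G x y | x y. x \<in> lcs G k \<and> y \<in> carrier G} \<subseteq> carrier G" by auto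
  then show ?case using generate_incl by simp
qed simp

lemma lcs_subgroup: "subgroup (lcs G k) G"
proof (cases k)
  case 0
  then show ?thesis using subgroup_self by simp
next
  case (Suc j)
  have "{comm G x y | x y. x \<in> lcs G j \<and> y \<in> carrier G} \<subseteq> carrier G" using lcs_closed[of j] by auto
  then show ?thesis unfolding Suc lcs.simps by (rule generate_is_subgroup)
qed

lemma comm_lcs: "x \<in> lcs G k \<Longrightarrow> y \<in> carrier G \<Longrightarrow> comm G x y \<in> lcs G (Suc k)"
  by (auto intro: generate.incl)

lemma lcs_trivial_mono:
  assumes "lcs G k = {\<one>}"
  shows "lcs G (k + j) = {\<one>}"
proof (induction j)
  case (Suc j)
  have "{comm G x y | x y. x \<in> lcs G (k + j) \<and> y \<in> carrier G} = {\<one>}"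
  proof
    show "{comm G x y | x y. x \<in> lcs G (k + j) \<and> y \<in> carrier G} \<subseteq> {\<one>}"
      unfolding Suc by (auto simp: comm_one_left)
    have "comm G \<one> \<one> = \<one>" by (simp add: comm_one_left)
    then show "{\<one>} \<subseteq> {comm G x y | x y. x \<in> lcs G (k + j) \<and> y \<in> carrier G}"
      unfolding Suc by force
  qed
  then show ?case using generate_one by simp
qed (use assms in simp)

end

context macdonald_group
begin

text \<open>For k = p^(2m), \<open>B\<close> conjugates A^k to C^k A^(gsum \<alpha> k). Here C^k is
  trivial because 2l - m is at most 2m, and the sum is k modulo p^(3m), which the order of
  \<open>A\<close> divides.\<close>

lemma ucs_A_pow_1:
  assumes gen: "carrier G = generate G {A, B}" and par: "macdonald_parameters p m l \<alpha> \<beta>"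
    and o: "ord A = p ^ (m + l)" "ord C = p ^ (2 * l - m)"
    and i: "int p ^ (2 * m) dvd i"
  shows "A [^] i \<in> ucs 1"
proof -
  have p: "Factorial_Ring.prime p" "odd p" "2 \<le> m" "m < l" "2 * l < 3 * m" "int p ^ m dvd \<alpha> - 1"
    using par by (simp_all add: macdonald_parameters_def exact_val_def)
  let ?k = "p ^ (2 * m)"
  have "comm G (A [^] int ?k) B = \<one>"
  proof -
    have "ord C dvd ?k" unfolding o(2) using p by (intro le_imp_power_dvd) simp
    then have C1: "C [^] int ?k = \<one>" by (simp only: int_pow_int pow_eq_id closed)
    have g: "int p ^ (3 * m) dvd gsum (1 + (\<alpha> - 1)) ?k - int ?k * (1 + (\<alpha> - 1)) ^ ?k"
      by (rule gsum_minus_power_dvd[OF p(1-3,6)]) simp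
    have "int p ^ m dvd (1 + (\<alpha> - 1)) ^ ?k - 1"
      using one_plus_power_dvd[OF p(1,2) _ p(6), of 0 ?k] p(3) by simp
    then have "int p ^ (2 * m) * int p ^ m dvd int ?k * ((1 + (\<alpha> - 1)) ^ ?k - 1)"
      by (intro mult_dvd_mono) simp_all
    then have "int p ^ (3 * m) dvd int ?k * ((1 + (\<alpha> - 1)) ^ ?k - 1)" by (simp flip: power_add)
    from dvd_add[OF g this] have "int p ^ (3 * m) dvd gsum \<alpha> ?k - int ?k" by (simp add: algebra_simps)
    then have "int (ord A) dvd gsum \<alpha> ?k - int ?k"
      unfolding o(1) using p by (elim dvd_trans[rotated]) (simp add: le_imp_power_dvd)
    then have "A [^] (gsum \<alpha> ?k - int ?k) = \<one>" by (simp only: int_pow_eq_id closed)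
    moreover have "comm G (A [^] int ?k) B = A [^] (- int ?k + gsum \<alpha> ?k)"
      unfolding comm_cj[OF int_pow_closed[OF closed(1)] closed(2)] cj_B_A_pow C1
      by (simp only: l_one closed int_pow_closed int_pow_mult int_pow_neg)
    ultimately show ?thesis by simp
  qed
  moreover have "comm G (A [^] int ?k) A = \<one>"
    using int_pow_commute[of A "int ?k" 1] by (simp add: comm_cj cj_commute)
  ultimately have "A [^] int ?k \<in> ucs (Suc 0)"
    by (intro ucs_generators[OF gen]) auto
  then have "(A [^] int ?k) [^] (i div int ?k) \<in> ucs 1"
    using subgroup_int_pow_closed[OF ucs_subgroup] unfolding One_nat_def by blast
  moreover have "int ?k * (i div int ?k) = i" using i by simp
  ultimately show ?thesis by (simp only: int_pow_pow closed)
qed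

text \<open>A ladder in the upper central series: powers of \<open>A\<close> and \<open>B\<close>
  with exponent divisible by p^(2m) lie in term 1, C^(p^m) in term 2, A^(p^m) and B^(p^m) in term 3,
  \<open>C\<close> in term 4, and \<open>A\<close> and \<open>B\<close> in term 5.\<close>

lemma class_at_most_5:
  assumes gen: "carrier G = generate G {A, B}" and par: "macdonald_parameters p m l \<alpha> \<beta>"
    and o: "ord A = p ^ (m + l)" "ord B = p ^ (m + l)" "ord C = p ^ (2 * l - m)"
  shows "lcs G 5 = {\<one>}"
proof -
  interpret S: macdonald_group G B A "inv C" \<beta> \<alpha> by (rule swap)
  have gen': "carrier G = generate G {B, A}" using gen by (simp add: insert_commute)
  have p: "Factorial_Ring.prime p" "odd p" "2 \<le> m" "m < l" "2 * l < 3 * m"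
      "int p ^ m dvd \<alpha> - 1" "int p ^ m dvd \<beta> - 1"
    using par by (simp_all add: macdonald_parameters_def exact_val_def)
  have m0: "0 < m" using p by simp
  have A1: "A [^] i \<in> ucs 1" if "int p ^ (2 * m) dvd i" for i
    by (rule ucs_A_pow_1[OF gen par o(1,3) that])
  have B1: "B [^] i \<in> ucs 1" if "int p ^ (2 * m) dvd i" for i
    using o by (intro S.ucs_A_pow_1[OF gen' macdonald_parameters_swap[OF par] _ _ that]) simp_all
  let ?k = "p ^ m"
  have pw: "int p ^ (2 * m) dvd x ^ ?k - 1" if "int p ^ m dvd x - 1" for x
    using one_plus_power_dvd[OF p(1,2) m0 that, of m ?k] by (simp add: mult_2)
  have C2: "C [^] int ?k \<in> ucs 2"
    unfolding numeral_2_eq_2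
  proof (rule ucs_generators[OF gen])
    fix s assume "s \<in> {A, B}"
    moreover have "comm G (C [^] int ?k) A = A [^] (1 - \<alpha> ^ ?k)"
      by (simp add: comm_cj cj_A_C_pow del: of_nat_power)
    moreover have "A [^] (1 - \<alpha> ^ ?k) \<in> ucs 1"
      using pw[OF p(6)] by (intro A1) (simp add: dvd_diff_commute)
    moreover have "comm G (C [^] int ?k) B = cj (C [^] int ?k) (B [^] (\<beta> ^ ?k - 1))"
    proof -
      have "cj B (C [^] int ?k) = B [^] (\<beta> ^ ?k - 1) \<otimes> C [^] int ?k"
      proof (rule cj_eqI)
        have "B \<otimes> (B [^] (\<beta> ^ ?k - 1) \<otimes> C [^] int ?k) = B [^] (1::int) \<otimes> (B [^] (\<beta> ^ ?k - 1) \<otimes> C [^] int ?k)"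
          by simp
        also have "\<dots> = B [^] (1 * \<beta> ^ ?k) \<otimes> C [^] int ?k"
          by (simp only: int_pow_add_left closed int_pow_closed) simp
        also have "\<dots> = C [^] int ?k \<otimes> B" unfolding C_B_pow[symmetric] by simp
        finally show "C [^] int ?k \<otimes> B = B \<otimes> (B [^] (\<beta> ^ ?k - 1) \<otimes> C [^] int ?k)" by simp
      qed simp_all
      then show ?thesis by (simp add: comm_cj cj_def m_assoc del: of_nat_power)
    qed
    moreover have "cj (C [^] int ?k) (B [^] (\<beta> ^ ?k - 1)) \<in> ucs 1"
      using pw[OF p(7)] by (intro ucs_cj B1) simp_all
    ultimately show "comm G (C [^] int ?k) s \<in> ucs (Suc 0)" by auto
  qed simp_all
  have gs: "int p ^ (2 * m) dvd gsum x ?k - int ?k" if x: "int p ^ m dvd x - 1" for x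
  proof -
    have "int p ^ (2 * m) dvd (x - 1) ^ 2"
      using dvd_power_same[OF x, of 2] by (simp add: power_mult[symmetric] mult.commute)
    moreover have "(x - 1) ^ 2 dvd (x - 1) ^ 3" by (rule le_imp_power_dvd) simp
    ultimately have d: "int p ^ (2 * m) dvd (x - 1) ^ 2" "int p ^ (2 * m) dvd (x - 1) ^ 3"
      using dvd_trans by blast+
    have "int p ^ m dvd 2 * int (Suc ?k choose 2)" by (simp add: two_choose_2)
    then have "int p ^ m dvd int (Suc ?k choose 2)" by (rule odd_power_dvd_times_2[OF p(2)])
    then have "int p ^ m * int p ^ m dvd int (Suc ?k choose 2) * (x - 1)" using x by (rule mult_dvd_mono)
    then have c: "int p ^ (2 * m) dvd int (Suc ?k choose 2) * (x - 1)" by (simp add: mult_2 power_add)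
    have "gsum x ?k - int ?k = (gsum (1 + (x - 1)) ?k - (int ?k + int (Suc ?k choose 2) * (x - 1) + int (Suc ?k choose 3) * (x - 1) ^ 2))
       + int (Suc ?k choose 2) * (x - 1) + int (Suc ?k choose 3) * (x - 1) ^ 2" by simp
    moreover have "int p ^ (2 * m) dvd (gsum (1 + (x - 1)) ?k - (int ?k + int (Suc ?k choose 2) * (x - 1) + int (Suc ?k choose 3) * (x - 1) ^ 2))
       + int (Suc ?k choose 2) * (x - 1) + int (Suc ?k choose 3) * (x - 1) ^ 2"
      by (rule dvd_add[OF dvd_add[OF dvd_trans[OF d(2) gsum_cube_dvd] c] dvd_mult[OF d(1)]])
    ultimately show ?thesis by (simp only:)
  qed
  have u12: "x \<in> ucs 1 \<Longrightarrow> x \<in> ucs 2" for x using ucs_Suc_mono[of 1] unfolding numeral_2_eq_2 One_nat_def by blast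
  have A3k: "A [^] int ?k \<in> ucs 3"
    unfolding numeral_3_eq_3
  proof (rule ucs_generators[OF gen])
    fix s assume "s \<in> {A, B}"
    moreover have "comm G (A [^] int ?k) A = \<one>"
      using int_pow_commute[of A "int ?k" 1] by (simp add: comm_cj cj_commute)
    moreover have "comm G (A [^] int ?k) B = cj (A [^] int ?k) (C [^] int ?k) \<otimes> A [^] (gsum \<alpha> ?k - int ?k)"
    proof -
      have "comm G (A [^] int ?k) B = inv (A [^] int ?k) \<otimes> (C [^] int ?k \<otimes> A [^] (int ?k + (gsum \<alpha> ?k - int ?k)))"
        unfolding comm_cj[OF int_pow_closed[OF closed(1)] closed(2)] cj_B_A_pow by simp
      also have "A [^] (int ?k + (gsum \<alpha> ?k - int ?k)) = A [^] int ?k \<otimes> A [^] (gsum \<alpha> ?k - int ?k)"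
        by (rule int_pow_mult) simp
      finally show ?thesis by (simp add: cj_def m_assoc del: of_nat_power)
    qed
    moreover have "cj (A [^] int ?k) (C [^] int ?k) \<otimes> A [^] (gsum \<alpha> ?k - int ?k) \<in> ucs 2"
      by (intro subgroup.m_closed[OF ucs_subgroup] ucs_cj C2 u12 A1 gs p(6)) simp_all
    moreover have "\<one> \<in> ucs 2" by (rule subgroup.one_closed[OF ucs_subgroup])
    ultimately show "comm G (A [^] int ?k) s \<in> ucs (Suc (Suc 0))" unfolding numeral_2_eq_2 by auto
  qed simp_all
  have B3k: "B [^] int ?k \<in> ucs 3"
    unfolding numeral_3_eq_3
  proof (rule ucs_generators[OF gen])
    fix s assume "s \<in> {A, B}"
    moreover have "comm G (B [^] int ?k) B = \<one>"
      using int_pow_commute[of B "int ?k" 1] by (simp add: comm_cj cj_commute)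
    moreover have "comm G (B [^] int ?k) A = cj (B [^] int ?k) (C [^] (- int ?k)) \<otimes> B [^] (gsum \<beta> ?k - int ?k)"
    proof -
      have "comm G (B [^] int ?k) A = inv (B [^] int ?k) \<otimes> (C [^] (- int ?k) \<otimes> B [^] (int ?k + (gsum \<beta> ?k - int ?k)))"
        unfolding comm_cj[OF int_pow_closed[OF closed(2)] closed(1)] cj_A_B_pow by simp
      also have "B [^] (int ?k + (gsum \<beta> ?k - int ?k)) = B [^] int ?k \<otimes> B [^] (gsum \<beta> ?k - int ?k)"
        by (rule int_pow_mult) simp
      finally show ?thesis by (simp add: cj_def m_assoc del: of_nat_power)
    qed
    moreover have "cj (B [^] int ?k) (C [^] (- int ?k)) \<otimes> B [^] (gsum \<beta> ?k - int ?k) \<in> ucs 2"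
    proof -
      have "C [^] (- int ?k) \<in> ucs 2"
        using subgroup.m_inv_closed[OF ucs_subgroup C2] by (simp only: int_pow_neg closed)
      from subgroup.m_closed[OF ucs_subgroup ucs_cj[OF this] u12[OF B1[OF gs[OF p(7)]]]]
      show ?thesis by simp
    qed
    moreover have "\<one> \<in> ucs 2" by (rule subgroup.one_closed[OF ucs_subgroup])
    ultimately show "comm G (B [^] int ?k) s \<in> ucs (Suc (Suc 0))" unfolding numeral_2_eq_2 by auto
  qed simp_all
  have pow3: "x [^] i \<in> ucs 3" if "x \<in> carrier G" "x [^] int ?k \<in> ucs 3" "int p ^ m dvd i" for x i
  proof -
    have "(x [^] int ?k) [^] (i div int ?k) \<in> ucs 3"
      by (rule subgroup_int_pow_closed[OF ucs_subgroup that(2)])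
    then show ?thesis using that by (simp add: int_pow_pow)
  qed
  have C4: "C \<in> ucs (Suc 3)"
  proof (rule ucs_generators[OF gen])
    fix s assume "s \<in> {A, B}"
    moreover have "comm G C A = A [^] (1 - \<alpha>)" by (simp add: comm_cj cj_A_C)
    moreover have "A [^] (1 - \<alpha>) \<in> ucs 3"
      using p(6) by (intro pow3[OF closed(1) A3k]) (simp add: dvd_diff_commute)
    moreover have "comm G C B = cj C (B [^] (\<beta> - 1))" 
      unfolding comm_cj[OF closed(3,2)] cj_B_C by (simp add: cj_def m_assoc)
    moreover have "cj C (B [^] (\<beta> - 1)) \<in> ucs 3" by (rule ucs_cj[OF pow3[OF closed(2) B3k p(7)] closed(3)])
    ultimately show "comm G C s \<in> ucs 3" by auto
  qed simp_all
  have one: "\<one> \<in> ucs (Suc 3)" by (rule subgroup.one_closed[OF ucs_subgroup])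
  have A5: "A \<in> ucs (Suc (Suc 3))"
  proof (rule ucs_generators[OF gen])
    fix s assume "s \<in> {A, B}"
    moreover have "comm G A B = C" by (simp add: comm_cj cj_B_A)
    moreover have "comm G A A = \<one>" by (simp add: comm_cj cj_commute)
    ultimately show "comm G A s \<in> ucs (Suc 3)" using C4 one by auto
  qed simp_all
  have B5: "B \<in> ucs (Suc (Suc 3))"
  proof (rule ucs_generators[OF gen])
    fix s assume "s \<in> {A, B}"
    moreover have "comm G B A = inv C" by (simp add: comm_cj cj_A_B)
    moreover have "comm G B B = \<one>" by (simp add: comm_cj cj_commute)
    ultimately show "comm G B s \<in> ucs (Suc 3)"
      using subgroup.m_inv_closed[OF ucs_subgroup C4] one by auto
  qed simp_all
  have "carrier G \<subseteq> ucs 5"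
    unfolding gen using generate_subgroup_incl[OF _ ucs_subgroup, of "{A, B}" 5] A5 B5
    by (simp add: eval_nat_numeral)
  then have "lcs G 5 \<subseteq> ucs (5 - 5)" by (rule lcs_subset_ucs) simp
  then show ?thesis using subgroup.one_closed[OF lcs_subgroup[of 5]] by auto
qed

end

text \<open>A nontrivial commutator of weight 5: [C, A] = A^-e has weight 3, and [[A^e, B], A] =
  A^(1 - \<alpha>^e) has an exponent of valuation 2m, below m + l. As \<open>lcs\<close> starts at
  index 0, the weight 5 term is \<open>lcs G 4\<close>.\<close>

lemma (in macdonald_nat) class_5:
  assumes gen: "carrier G = generate G {A, B}" and par: "macdonald_parameters p m l (1 + int e) (1 + int n)"
    and o: "ord A = p ^ (m + l)" "ord B = p ^ (m + l)" "ord C = p ^ (2 * l - m)"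
  shows "nilpotency_class G 5"
proof -
  have p: "Factorial_Ring.prime p" "odd p" "2 \<le> m" "m < l" "exact_val p m (int e)"
    using par by (simp_all add: macdonald_parameters_def)
  have pe: "p ^ m dvd e" "\<not> p ^ Suc m dvd e" "int p ^ m dvd int e" "\<not> int p ^ Suc m dvd int e"
    using p(5) exact_val_nat unfolding exact_val_def by blast+
  have C1: "C \<in> lcs G 1"
    using comm_lcs[of A 0 B] by (simp add: comm_cj cj_B_A)
  have "A [^] (- int e) \<in> lcs G 2"
    using comm_lcs[OF C1 closed(1)] unfolding comm_cj[OF closed(3,1)] cj_A_C by (simp add: numeral_2_eq_2)
  then have A2: "A [^] int e \<in> lcs G 2"
    using subgroup.m_inv_closed[OF lcs_subgroup] by (fastforce simp: int_pow_neg)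
  define x where "x = A [^] (- int e) \<otimes> (C [^] int e \<otimes> A [^] gsum (1 + int e) e)"
  have xc: "x \<in> carrier G" by (simp add: x_def)
  have "x = comm G (A [^] int e) B"
    unfolding comm_cj[OF int_pow_closed[OF closed(1)] closed(2)] cj_B_A_pow x_def by (simp add: int_pow_neg)
  then have x3: "x \<in> lcs G 3"
    using comm_lcs[OF A2 closed(2)] by (simp add: numeral_3_eq_3 numeral_2_eq_2)
  have cjA: "cj A (A [^] i) = A [^] (i::int)" for i
    using int_pow_commute[of A i 1] by (intro cj_commute) simp_all
  have "cj A x = A [^] (- int e) \<otimes> ((C [^] int e \<otimes> A [^] (1 - (1 + int e) ^ e)) \<otimes> A [^] gsum (1 + int e) e)"
    unfolding x_def by (simp add: cj_mult cjA cj_A_C_pow)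
  also have "\<dots> = A [^] (- int e) \<otimes> (C [^] int e \<otimes> (A [^] (1 - (1 + int e) ^ e) \<otimes> A [^] gsum (1 + int e) e))"
    by (simp add: m_assoc)
  also have "A [^] (1 - (1 + int e) ^ e) \<otimes> A [^] gsum (1 + int e) e = A [^] gsum (1 + int e) e \<otimes> A [^] (1 - (1 + int e) ^ e)"
    by (rule int_pow_commute) simp
  also have "A [^] (- int e) \<otimes> (C [^] int e \<otimes> (A [^] gsum (1 + int e) e \<otimes> A [^] (1 - (1 + int e) ^ e)))
     = x \<otimes> A [^] (1 - (1 + int e) ^ e)" by (simp add: x_def m_assoc)
  finally have "comm G x A = A [^] (1 - (1 + int e) ^ e)" using xc by (simp add: comm_cj)
  then have A4: "A [^] (1 - (1 + int e) ^ e) \<in> lcs G 4"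
    using comm_lcs[OF x3 closed(1)] by (simp add: eval_nat_numeral)
  have "\<not> int p ^ Suc (m + m) dvd (1 + int e) ^ e - 1"
    using p(3) by (intro one_plus_power_not_dvd[OF p(1,2) _ pe(3,1) pe(4,2)]) simp
  moreover have "int p ^ Suc (m + m) dvd int p ^ (m + l)"
    using p(4) by (intro le_imp_power_dvd) simp
  ultimately have "\<not> int p ^ (m + l) dvd 1 - (1 + int e) ^ e"
    using dvd_trans dvd_diff_commute by metis
  then have "A [^] (1 - (1 + int e) ^ e) \<noteq> \<one>" by (simp add: int_pow_eq_id o(1))
  then have n4: "lcs G 4 \<noteq> {\<one>}" using A4 by blast
  have "lcs G k \<noteq> {\<one>}" if "k < 5" for k
  proof
    assume "lcs G k = {\<one>}"
    then have "lcs G (k + (4 - k)) = {\<one>}" by (rule lcs_trivial_mono)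
    then show False using n4 that by simp
  qed
  then show ?thesis using class_at_most_5[OF gen par o] by (simp add: nilpotency_class_def)
qed

section \<open>The presented group\<close>

lemma pres_eq_context: "pres_eq R u v \<Longrightarrow> pres_eq R (x @ u @ y) (x @ v @ y)"
proof (induction rule: pres_eq.induct)
  case (cancel u l v)
  then show ?case using pres_eq.cancel[of R "x @ u" l "v @ y"] by simp
next
  case (relator r u v)
  then show ?case using pres_eq.relator[OF relator, of "x @ u" "v @ y"] by simp
qed (auto intro: pres_eq.intros)

lemma pres_eq_append: "pres_eq R u u' \<Longrightarrow> pres_eq R v v' \<Longrightarrow> pres_eq R (u @ v) (u' @ v')"
  using pres_eq_context[of R u u' "[]" v] pres_eq_context[of R v v' u' "[]"] by (auto intro: pres_eq.trans)

lemma pres_class_eq_iff: "pres_class R u = pres_class R v \<longleftrightarrow> pres_eq R u v"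
proof
  assume "pres_class R u = pres_class R v"
  then have "v \<in> pres_class R u" by (simp add: pres_class_def pres_eq.refl)
  then show "pres_eq R u v" by (simp add: pres_class_def)
next
  assume "pres_eq R u v"
  then show "pres_class R u = pres_class R v"
    unfolding pres_class_def by (auto intro: pres_eq.trans pres_eq.sym)
qed

lemma presented_mult: "pres_class R u \<otimes>\<^bsub>presented_group R\<^esub> pres_class R v = pres_class R (u @ v)"
proof -
  have "(\<exists>x\<in>pres_class R u. \<exists>y\<in>pres_class R v. pres_eq R (x @ y) z) \<longleftrightarrow> pres_eq R (u @ v) z" for z
  proof
    assume "\<exists>x\<in>pres_class R u. \<exists>y\<in>pres_class R v. pres_eq R (x @ y) z"
    then obtain x y where "pres_eq R u x" "pres_eq R v y" "pres_eq R (x @ y) z"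
      by (auto simp: pres_class_def)
    then show "pres_eq R (u @ v) z" using pres_eq_append pres_eq.trans by blast
  next
    assume "pres_eq R (u @ v) z"
    then show "\<exists>x\<in>pres_class R u. \<exists>y\<in>pres_class R v. pres_eq R (x @ y) z"
      by (auto simp: pres_class_def intro: pres_eq.refl)
  qed
  then show ?thesis by (simp add: presented_group_def pres_class_def)
qed

definition winv :: "letter list \<Rightarrow> letter list" where
  "winv w = rev (map inv_letter w)"

lemma inv_letter_inv_letter [simp]: "inv_letter (inv_letter x) = x"
  by (cases x) (simp add: inv_letter_def)

lemma pres_eq_winv_left: "pres_eq R (winv w @ w) []"
proof (induction w)
  case (Cons x w)
  have "pres_eq R (winv w @ [inv_letter x, inv_letter (inv_letter x)] @ w) (winv w @ w)"
    by (rule pres_eq.cancel)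
  then have "pres_eq R (winv (x # w) @ (x # w)) (winv w @ w)"
    by (simp add: winv_def)
  then show ?case using Cons pres_eq.trans by blast
qed (simp add: winv_def pres_eq.refl)

lemma group_presented_group: "group (presented_group R)"
proof (rule groupI)
  have one: "\<one>\<^bsub>presented_group R\<^esub> = pres_class R []" by (simp add: presented_group_def)
  have car: "carrier (presented_group R) = range (pres_class R)" by (simp add: presented_group_def)
  show "\<one>\<^bsub>presented_group R\<^esub> \<in> carrier (presented_group R)" by (simp add: one car)
  fix x assume "x \<in> carrier (presented_group R)"
  then obtain u where u: "x = pres_class R u" by (auto simp: car)
  show "\<one>\<^bsub>presented_group R\<^esub> \<otimes>\<^bsub>presented_group R\<^esub> x = x" by (simp add: one u presented_mult)
  show "\<exists>y\<in>carrier (presented_group R). y \<otimes>\<^bsub>presented_group R\<^esub> x = \<one>\<^bsub>presented_group R\<^esub>"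
    using pres_eq_winv_left[of R u]
    by (intro bexI[of _ "pres_class R (winv u)"]) (simp_all only: one u car presented_mult pres_class_eq_iff rangeI)
  fix y assume "y \<in> carrier (presented_group R)"
  then obtain v where v: "y = pres_class R v" by (auto simp: car)
  show "x \<otimes>\<^bsub>presented_group R\<^esub> y \<in> carrier (presented_group R)" by (simp add: car u v presented_mult)
  fix z assume "z \<in> carrier (presented_group R)"
  then obtain w where w: "z = pres_class R w" by (auto simp: car)
  show "x \<otimes>\<^bsub>presented_group R\<^esub> y \<otimes>\<^bsub>presented_group R\<^esub> z = x \<otimes>\<^bsub>presented_group R\<^esub> (y \<otimes>\<^bsub>presented_group R\<^esub> z)"
    by (simp add: u v w presented_mult)
qed

section \<open>Evaluation of words and the universal property\<close>

context group
begin

definition lval :: "'a \<Rightarrow> 'a \<Rightarrow> letter \<Rightarrow> 'a" where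
  "lval x y l = (let z = (if fst l then y else x) in if snd l then inv z else z)"

fun ev :: "'a \<Rightarrow> 'a \<Rightarrow> letter list \<Rightarrow> 'a" where
  "ev x y [] = \<one>"
| "ev x y (l # w) = lval x y l \<otimes> ev x y w"

lemma lval_closed [simp]: "x \<in> carrier G \<Longrightarrow> y \<in> carrier G \<Longrightarrow> lval x y l \<in> carrier G"
  by (simp add: lval_def Let_def)

lemma ev_closed [simp]: "x \<in> carrier G \<Longrightarrow> y \<in> carrier G \<Longrightarrow> ev x y w \<in> carrier G"
  by (induction w) simp_all

lemma ev_append: "x \<in> carrier G \<Longrightarrow> y \<in> carrier G \<Longrightarrow> ev x y (u @ v) = ev x y u \<otimes> ev x y v"
  by (induction u) (simp_all add: m_assoc)

lemma lval_inv_letter: "x \<in> carrier G \<Longrightarrow> y \<in> carrier G \<Longrightarrow> lval x y l \<otimes> lval x y (inv_letter l) = \<one>"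
  by (simp add: lval_def inv_letter_def Let_def)

lemma ev_pres_eq:
  assumes "pres_eq R u v" "x \<in> carrier G" "y \<in> carrier G" "\<And>r. r \<in> R \<Longrightarrow> ev x y r = \<one>"
  shows "ev x y u = ev x y v"
  using assms(1)
proof (induction rule: pres_eq.induct)
  case (cancel u l v)
  have "lval x y l \<otimes> (lval x y (inv_letter l) \<otimes> ev x y v) = ev x y v"
    using assms(2,3) by (simp add: m_assoc[symmetric] lval_inv_letter)
  then show ?case using assms(2,3) by (simp add: ev_append)
next
  case (relator r u v)
  then show ?case using assms by (simp add: ev_append)
qed auto

lemma ev_replicate:
  assumes "x \<in> carrier G" "y \<in> carrier G"
  shows "ev x y (replicate k l) = lval x y l [^] k"
proof (induction k)
  case (Suc k)
  then show ?case using assms nat_pow_Suc2[of "lval x y l" k] by simp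
qed simp

lemma ev_word_pow:
  assumes "x \<in> carrier G" "y \<in> carrier G"
  shows "ev x y (word_pow g k) = (if g then y else x) [^] k"
proof (cases "0 \<le> k")
  case True
  then show ?thesis using assms by (simp add: word_pow_def ev_replicate lval_def pow_nat)
next
  case False
  then have "k = - int (nat (- k))" by simp
  then have "(if g then y else x) [^] k = inv ((if g then y else x) [^] nat (- k))"
    using assms int_pow_neg_int[of "if g then y else x" "nat (- k)"] by simp
  then show ?thesis using assms False by (simp add: word_pow_def ev_replicate lval_def nat_pow_inv int_pow_inv)
qed

text \<open>The relators say that c^-1 x c = x^\<alpha> and c y c^-1 = y^\<beta>; the remaining
  equation x y = y x c holds by the choice of \<open>word_C\<close>.\<close>

lemma macdonald_group_iff_relators:
  assumes xy: "x \<in> carrier G" "y \<in> carrier G"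
  shows "macdonald_group G x y (ev x y word_C) \<alpha> \<beta> \<longleftrightarrow> (\<forall>r\<in>relators \<alpha> \<beta>. ev x y r = \<one>)"
proof -
  define c where "c = ev x y word_C"
  have c [simp]: "c \<in> carrier G" using xy by (simp add: c_def)
  have cdef: "c = inv x \<otimes> (inv y \<otimes> (x \<otimes> y))"
    using xy by (simp add: c_def word_C_def lval_def gA_def gB_def gAi_def gBi_def)
  have ci: "ev x y word_Ci = inv c"
    unfolding cdef using xy by (simp add: word_Ci_def lval_def gA_def gB_def gAi_def gBi_def inv_mult_group m_assoc)
  have 1: "ev x y (word_Ci @ [gA] @ word_C @ word_pow False (- \<alpha>)) = inv c \<otimes> (x \<otimes> (c \<otimes> inv (x [^] \<alpha>)))"
    using xy by (simp add: ev_append ci c_def[symmetric] ev_word_pow int_pow_neg) (simp add: lval_def gA_def)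
  have 2: "ev x y (word_C @ [gB] @ word_Ci @ word_pow True (- \<beta>)) = c \<otimes> (y \<otimes> (inv c \<otimes> inv (y [^] \<beta>)))"
    using xy by (simp add: ev_append ci c_def[symmetric] ev_word_pow int_pow_neg) (simp add: lval_def gB_def)
  have e1: "inv c \<otimes> (x \<otimes> (c \<otimes> inv (x [^] \<alpha>))) = \<one> \<longleftrightarrow> x \<otimes> c = c \<otimes> x [^] \<alpha>"
  proof
    assume a: "inv c \<otimes> (x \<otimes> (c \<otimes> inv (x [^] \<alpha>))) = \<one>"
    have "x \<otimes> c = c \<otimes> (inv c \<otimes> (x \<otimes> (c \<otimes> inv (x [^] \<alpha>)))) \<otimes> x [^] \<alpha>"
      using xy by (simp add: m_assoc)
    then show "x \<otimes> c = c \<otimes> x [^] \<alpha>" unfolding a using xy by simp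
  next
    assume a: "x \<otimes> c = c \<otimes> x [^] \<alpha>"
    have "inv c \<otimes> (x \<otimes> (c \<otimes> inv (x [^] \<alpha>))) = inv c \<otimes> ((x \<otimes> c) \<otimes> inv (x [^] \<alpha>))"
      using xy by (simp add: m_assoc)
    then show "inv c \<otimes> (x \<otimes> (c \<otimes> inv (x [^] \<alpha>))) = \<one>" unfolding a using xy by (simp add: m_assoc)
  qed
  have e2: "c \<otimes> (y \<otimes> (inv c \<otimes> inv (y [^] \<beta>))) = \<one> \<longleftrightarrow> c \<otimes> y = y [^] \<beta> \<otimes> c"
  proof
    assume a: "c \<otimes> (y \<otimes> (inv c \<otimes> inv (y [^] \<beta>))) = \<one>"
    have "c \<otimes> y = (c \<otimes> (y \<otimes> (inv c \<otimes> inv (y [^] \<beta>)))) \<otimes> (y [^] \<beta> \<otimes> c)"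
      using xy by (simp add: m_assoc)
    then show "c \<otimes> y = y [^] \<beta> \<otimes> c" unfolding a using xy by simp
  next
    assume a: "c \<otimes> y = y [^] \<beta> \<otimes> c"
    have "c \<otimes> (y \<otimes> (inv c \<otimes> inv (y [^] \<beta>))) = (c \<otimes> y) \<otimes> (inv c \<otimes> inv (y [^] \<beta>))"
      using xy by (simp add: m_assoc)
    then show "c \<otimes> (y \<otimes> (inv c \<otimes> inv (y [^] \<beta>))) = \<one>" unfolding a using xy by (simp add: m_assoc)
  qed
  have e0: "x \<otimes> y = y \<otimes> x \<otimes> c" unfolding cdef using xy by (simp add: m_assoc)
  have "(\<forall>r\<in>relators \<alpha> \<beta>. ev x y r = \<one>) \<longleftrightarrow>
      ev x y (word_Ci @ [gA] @ word_C @ word_pow False (- \<alpha>)) = \<one> \<and>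
      ev x y (word_C @ [gB] @ word_Ci @ word_pow True (- \<beta>)) = \<one>"
    unfolding relators_def by blast
  then show ?thesis
    unfolding c_def[symmetric] macdonald_group_def macdonald_group_axioms_def 1 2 e1 e2
    using xy e0 c group_axioms by blast
qed

text \<open>The theorem of von Dyck: evaluation is constant on classes by \<open>ev_pres_eq\<close>,
  so it may be read off from an arbitrary representative.\<close>

lemma ev_hom:
  assumes xy: "x \<in> carrier G" "y \<in> carrier G" and R: "\<And>r. r \<in> R \<Longrightarrow> ev x y r = \<one>"
  obtains \<phi> where "\<phi> \<in> hom (presented_group R) G" "\<And>w. \<phi> (pres_class R w) = ev x y w"
proof -
  define \<phi> where "\<phi> U = ev x y (SOME w. w \<in> U)" for U
  have *: "\<phi> (pres_class R w) = ev x y w" for w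
  proof -
    have "w \<in> pres_class R w" by (simp add: pres_class_def pres_eq.refl)
    then have "(SOME v. v \<in> pres_class R w) \<in> pres_class R w" by (rule someI)
    then have "pres_eq R w (SOME v. v \<in> pres_class R w)" by (simp add: pres_class_def)
    then show ?thesis unfolding \<phi>_def using ev_pres_eq[OF _ xy R] by metis
  qed
  have "\<phi> \<in> hom (presented_group R) G"
    unfolding hom_def
  proof (intro CollectI conjI ballI Pi_I)
    fix U assume "U \<in> carrier (presented_group R)"
    then obtain u where u: "U = pres_class R u" by (auto simp: presented_group_def)
    show "\<phi> U \<in> carrier G" using xy by (simp add: u *)
    fix V assume "V \<in> carrier (presented_group R)"
    then obtain v where v: "V = pres_class R v" by (auto simp: presented_group_def)
    show "\<phi> (U \<otimes>\<^bsub>presented_group R\<^esub> V) = \<phi> U \<otimes> \<phi> V"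
      using xy by (simp add: u v presented_mult * ev_append)
  qed
  then show ?thesis using * that by blast
qed

end

text \<open>The projection from words to classes is itself an evaluation. This makes relators
  evaluate to the neutral element and shows that the two generators generate.\<close>

lemma presented_group_ev:
  "group.ev (presented_group R) (pres_class R [gA]) (pres_class R [gB]) w = pres_class R w"
proof -
  interpret G: group "presented_group R" by (rule group_presented_group)
  have car: "pres_class R u \<in> carrier (presented_group R)" for u by (simp add: presented_group_def)
  have inv: "inv\<^bsub>presented_group R\<^esub> (pres_class R [(g, False)]) = pres_class R [(g, True)]" for g
  proof (rule G.inv_equality)
    have "pres_eq R ([] @ [(g, True), inv_letter (g, True)] @ []) ([] @ [])" by (rule pres_eq.cancel)
    then have "pres_class R ([(g, True)] @ [(g, False)]) = pres_class R []"
      by (simp add: pres_class_eq_iff inv_letter_def)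
    moreover have "\<one>\<^bsub>presented_group R\<^esub> = pres_class R []" by (simp add: presented_group_def)
    ultimately show "pres_class R [(g, True)] \<otimes>\<^bsub>presented_group R\<^esub> pres_class R [(g, False)] = \<one>\<^bsub>presented_group R\<^esub>"
      by (simp only: presented_mult)
  qed (rule car)+
  have l: "G.lval (pres_class R [gA]) (pres_class R [gB]) l = pres_class R [l]" for l
  proof -
    obtain g i where "l = (g, i)" by (cases l)
    then show ?thesis
      using inv by (cases g; cases i) (simp_all add: G.lval_def gA_def gB_def)
  qed
  show ?thesis
  proof (induction w)
    case Nil
    have "\<one>\<^bsub>presented_group R\<^esub> = pres_class R []" by (simp add: presented_group_def)
    then show ?case by (simp only: G.ev.simps)
  next
    case (Cons a w)
    then show ?case by (simp add: l presented_mult)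
  qed
qed

lemma Gab_macdonald:
  "macdonald_group (Gab \<alpha> \<beta>) (elA \<alpha> \<beta>) (elB \<alpha> \<beta>) (elC \<alpha> \<beta>) \<alpha> \<beta>"
  "carrier (Gab \<alpha> \<beta>) = generate (Gab \<alpha> \<beta>) {elA \<alpha> \<beta>, elB \<alpha> \<beta>}"
proof -
  let ?R = "relators \<alpha> \<beta>"
  interpret G: group "Gab \<alpha> \<beta>" unfolding Gab_def by (rule group_presented_group)
  have car: "pres_class ?R u \<in> carrier (Gab \<alpha> \<beta>)" for u by (simp add: presented_group_def Gab_def)
  have ev: "G.ev (elA \<alpha> \<beta>) (elB \<alpha> \<beta>) w = pres_class ?R w" for w
    unfolding elA_def elB_def Gab_def by (rule presented_group_ev)
  have AB: "elA \<alpha> \<beta> \<in> carrier (Gab \<alpha> \<beta>)" "elB \<alpha> \<beta> \<in> carrier (Gab \<alpha> \<beta>)"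
    unfolding elA_def elB_def by (rule car)+
  have "\<forall>r\<in>?R. G.ev (elA \<alpha> \<beta>) (elB \<alpha> \<beta>) r = \<one>\<^bsub>Gab \<alpha> \<beta>\<^esub>"
  proof
    fix r assume "r \<in> ?R"
    then have "pres_eq ?R ([] @ r @ []) ([] @ [])" by (rule pres_eq.relator)
    then have "pres_class ?R r = pres_class ?R []" by (simp add: pres_class_eq_iff)
    then show "G.ev (elA \<alpha> \<beta>) (elB \<alpha> \<beta>) r = \<one>\<^bsub>Gab \<alpha> \<beta>\<^esub>"
      unfolding ev by (simp add: Gab_def presented_group_def)
  qed
  then show "macdonald_group (Gab \<alpha> \<beta>) (elA \<alpha> \<beta>) (elB \<alpha> \<beta>) (elC \<alpha> \<beta>) \<alpha> \<beta>"
    using G.macdonald_group_iff_relators[OF AB] unfolding elC_def ev by blast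
  have sub: "subgroup (generate (Gab \<alpha> \<beta>) {elA \<alpha> \<beta>, elB \<alpha> \<beta>}) (Gab \<alpha> \<beta>)"
    using AB by (intro G.generate_is_subgroup) simp
  have l: "G.lval (elA \<alpha> \<beta>) (elB \<alpha> \<beta>) l \<in> generate (Gab \<alpha> \<beta>) {elA \<alpha> \<beta>, elB \<alpha> \<beta>}" for l
    unfolding G.lval_def Let_def by (auto intro: generate.incl generate.inv)
  have "G.ev (elA \<alpha> \<beta>) (elB \<alpha> \<beta>) w \<in> generate (Gab \<alpha> \<beta>) {elA \<alpha> \<beta>, elB \<alpha> \<beta>}" for w
    by (induction w) (simp_all add: subgroup.one_closed[OF sub] subgroup.m_closed[OF sub] l)
  then have "carrier (Gab \<alpha> \<beta>) \<subseteq> generate (Gab \<alpha> \<beta>) {elA \<alpha> \<beta>, elB \<alpha> \<beta>}"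
    unfolding ev by (auto simp: Gab_def presented_group_def)
  then show "carrier (Gab \<alpha> \<beta>) = generate (Gab \<alpha> \<beta>) {elA \<alpha> \<beta>, elB \<alpha> \<beta>}"
    using subgroup.subset[OF sub] by blast
qed

lemma Gab_hom:
  assumes "macdonald_group H a b c \<alpha> \<beta>"
  obtains \<phi> where "\<phi> \<in> hom (Gab \<alpha> \<beta>) H" "\<phi> (elA \<alpha> \<beta>) = a" "\<phi> (elB \<alpha> \<beta>) = b" "\<phi> (elC \<alpha> \<beta>) = c"
proof -
  interpret M: macdonald_group H a b c \<alpha> \<beta> by (rule assms)
  have "c = inv\<^bsub>H\<^esub> a \<otimes>\<^bsub>H\<^esub> (inv\<^bsub>H\<^esub> b \<otimes>\<^bsub>H\<^esub> (a \<otimes>\<^bsub>H\<^esub> b))" by (simp add: M.AB M.m_assoc)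
  then have c: "M.ev a b word_C = c"
    by (simp add: word_C_def M.lval_def gA_def gB_def gAi_def gBi_def)
  have "\<And>r. r \<in> relators \<alpha> \<beta> \<Longrightarrow> M.ev a b r = \<one>\<^bsub>H\<^esub>"
    using M.macdonald_group_iff_relators[OF M.closed(1,2)] assms c by blast
  then obtain \<phi> where "\<phi> \<in> hom (presented_group (relators \<alpha> \<beta>)) H"
      "\<And>w. \<phi> (pres_class (relators \<alpha> \<beta>) w) = M.ev a b w"
    using M.ev_hom[OF M.closed(1,2)] by blast
  then show ?thesis
    using that c by (simp add: Gab_def elA_def elB_def elC_def) (simp add: M.lval_def gA_def gB_def)
qed

section \<open>Sylow subgroups\<close>

text \<open>If x has order p^k t, Bezout u p^k + v t = 1 yields the witness x^(v t) for the
  description in \<open>ppart\<close>. For another candidate x^b, the difference of the exponents is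
  annihilated modulo the order of x both by a power of p and by a number prime to p, so it is 0
  there.\<close>

lemma (in group) ord_ppart:
  assumes fin: "finite (carrier G)" and p: "Factorial_Ring.prime p" and x: "x \<in> carrier G"
  shows "ord (ppart G p x) = p ^ multiplicity p (ord x)"
proof -
  have N0: "ord x \<noteq> 0" using ord_ge_1[OF fin x] by simp
  define k where "k = multiplicity p (ord x)"
  obtain t where t: "ord x = p ^ k * t" "\<not> p dvd t"
    using multiplicity_decompose'[OF N0, of p] p not_prime_unit unfolding k_def by blast
  have cop: "coprime p t" using p t(2) prime_imp_coprime by blast
  then have "coprime (int p ^ k) (int t)" by simp
  then obtain u v where uv: "u * int p ^ k + v * int t = 1"
    using bezout_int[of "int p ^ k" "int t"] by (auto simp: coprime_iff_gcd_eq_1)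
  define a where "a = v * int t"
  define y where "y = x [^] a"
  have y: "y \<in> carrier G" using x by (simp add: y_def)
  have oN: "int (ord x) = int p ^ k * int t" by (simp add: t(1))
  have yk: "y [^] (p ^ k) = \<one>"
  proof -
    have "y [^] int (p ^ k) = x [^] (a * int p ^ k)" using x by (simp add: y_def int_pow_pow)
    also have "\<dots> = \<one>" unfolding int_pow_eq_id[OF x] oN a_def by (simp add: mult_ac)
    finally show ?thesis by (simp only: int_pow_int)
  qed
  have z: "x \<otimes> inv y = x [^] (1 - a)"
    using x by (simp add: y_def int_pow_diff)
  have "1 - a = u * int p ^ k" using uv by (simp add: a_def)
  then have zt: "(x \<otimes> inv y) [^] t = \<one>"
  proof -
    have "(x \<otimes> inv y) [^] int t = x [^] (u * int p ^ k * int t)"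
      unfolding z \<open>1 - a = u * int p ^ k\<close> using x by (simp add: int_pow_pow)
    also have "\<dots> = \<one>" unfolding int_pow_eq_id[OF x] oN by (simp add: mult_ac)
    finally show ?thesis by (simp only: int_pow_int)
  qed
  have zc: "x \<otimes> inv y \<in> carrier G" using x y by simp
  have ozt: "ord (x \<otimes> inv y) dvd t" using zt pow_eq_id[OF zc] by blast
  have copz: "coprime (ord (x \<otimes> inv y)) p"
    using cop ozt coprime_divisors[of "ord (x \<otimes> inv y)" t p p] by (simp add: coprime_commute)
  have oy: "ord y = p ^ k"
  proof (rule dvd_antisym)
    show "ord y dvd p ^ k" using yk pow_eq_id[OF y] by blast
    have cm: "y \<otimes> (x \<otimes> inv y) = (x \<otimes> inv y) \<otimes> y"
      unfolding z unfolding y_def using x by (rule int_pow_commute)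
    have "ord (y \<otimes> (x \<otimes> inv y)) dvd ord y * ord (x \<otimes> inv y)"
      by (rule ord_mul_divides[OF cm y zc])
    moreover have "y \<otimes> (x \<otimes> inv y) = x" unfolding cm using x y by (simp add: m_assoc)
    ultimately have "p ^ k dvd ord y * ord (x \<otimes> inv y)" using t(1) by (metis dvd_mult_left)
    moreover have "coprime (p ^ k) (ord (x \<otimes> inv y))" using copz by (simp add: coprime_commute)
    ultimately show "p ^ k dvd ord y" using coprime_dvd_mult_left_iff by blast
  qed
  have "ppart G p x = y"
    unfolding ppart_def
  proof (rule the_equality)
    show "y \<in> generate G {x} \<and> (\<exists>k. ord y = p ^ k) \<and> coprime (ord (x \<otimes> inv y)) p"
      using oy copz unfolding y_def generate_pow[OF x] by blast
  next
    fix y' assume a': "y' \<in> generate G {x} \<and> (\<exists>k. ord y' = p ^ k) \<and> coprime (ord (x \<otimes> inv y')) p"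
    then obtain b :: int where b: "y' = x [^] b" using generate_pow[OF x] by auto
    obtain j where j: "ord y' = p ^ j" using a' by blast
    have y'c: "y' \<in> carrier G" using b x by simp
    let ?N = "int (ord x)"
    have "y' [^] int (p ^ j) = \<one>" using y'c by (simp only: int_pow_int j[symmetric] pow_ord_eq_1)
    then have Nb: "?N dvd b * int p ^ j" using x by (simp add: b int_pow_pow int_pow_eq_id)
    have "y [^] int (p ^ k) = \<one>" using yk by (simp only: int_pow_int)
    then have Na: "?N dvd a * int p ^ k" using x by (simp add: y_def int_pow_pow int_pow_eq_id)
    have "?N dvd (a * int p ^ k) * int p ^ j - (b * int p ^ j) * int p ^ k"
      by (rule dvd_diff[OF dvd_mult2[OF Na] dvd_mult2[OF Nb]])
    then have d1: "?N dvd (int p ^ k * int p ^ j) * (a - b)" by (simp add: algebra_simps)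
    let ?s = "ord (x \<otimes> inv y)" and ?s' = "ord (x \<otimes> inv y')"
    have z': "x \<otimes> inv y' = x [^] (1 - b)" using x by (simp add: b int_pow_diff)
    have "(x \<otimes> inv y) [^] int ?s = \<one>" "(x \<otimes> inv y') [^] int ?s' = \<one>"
      using zc x y'c by (simp_all only: int_pow_int pow_ord_eq_1 m_closed inv_closed)
    then have Ns: "?N dvd (1 - a) * int ?s" "?N dvd (1 - b) * int ?s'"
      using x by (simp_all only: z z' int_pow_pow int_pow_eq_id)
    have "?N dvd ((1 - b) * int ?s') * int ?s - ((1 - a) * int ?s) * int ?s'"
      by (rule dvd_diff[OF dvd_mult2[OF Ns(2)] dvd_mult2[OF Ns(1)]])
    then have d2: "?N dvd (int ?s * int ?s') * (a - b)" by (simp add: algebra_simps)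
    have "coprime (int p ^ k * int p ^ j) (int ?s * int ?s')"
      using a' copz by (simp add: coprime_commute)
    then obtain g h where "g * (int p ^ k * int p ^ j) + h * (int ?s * int ?s') = 1"
      using bezout_int[of "int p ^ k * int p ^ j" "int ?s * int ?s'"] by (auto simp: coprime_iff_gcd_eq_1)
    then have "a - b = g * ((int p ^ k * int p ^ j) * (a - b)) + h * ((int ?s * int ?s') * (a - b))"
      by (simp only: mult.assoc[symmetric] distrib_right[symmetric]) simp
    moreover have "?N dvd g * ((int p ^ k * int p ^ j) * (a - b)) + h * ((int ?s * int ?s') * (a - b))"
      by (rule dvd_add[OF dvd_mult[OF d1] dvd_mult[OF d2]])
    ultimately have "?N dvd a - b" by (simp only:)
    then show "y' = y" unfolding b y_def int_pow_eq[OF x] .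
  qed
  then show ?thesis using oy k_def by simp
qed

lemma (in group_hom) image_lcs:
  assumes "h ` carrier G = carrier H"
  shows "h ` lcs G k = lcs H k"
proof (induction k)
  case 0
  then show ?case using assms by simp
next
  case (Suc k)
  have cm: "h (comm G x y) = comm H (h x) (h y)" if "x \<in> carrier G" "y \<in> carrier G" for x y
    using that by (simp add: comm_def)
  have sub: "lcs G k \<subseteq> carrier G" by (rule G.lcs_closed)
  have "h ` {comm G x y | x y. x \<in> lcs G k \<and> y \<in> carrier G}
     = {comm H x y | x y. x \<in> h ` lcs G k \<and> y \<in> h ` carrier G}"
  proof (intro equalityI subsetI)
    fix z assume "z \<in> h ` {comm G x y | x y. x \<in> lcs G k \<and> y \<in> carrier G}"
    then obtain x y where "z = h (comm G x y)" "x \<in> lcs G k" "y \<in> carrier G" by blast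
    then show "z \<in> {comm H x y | x y. x \<in> h ` lcs G k \<and> y \<in> h ` carrier G}"
      using cm sub by blast
  next
    fix z assume "z \<in> {comm H x y | x y. x \<in> h ` lcs G k \<and> y \<in> h ` carrier G}"
    then obtain x y where xy: "z = comm H (h x) (h y)" "x \<in> lcs G k" "y \<in> carrier G" by blast
    then have "z = h (comm G x y)" using cm sub by auto
    then show "z \<in> h ` {comm G x y | x y. x \<in> lcs G k \<and> y \<in> carrier G}" using xy by blast
  qed
  moreover have "{comm G x y | x y. x \<in> lcs G k \<and> y \<in> carrier G} \<subseteq> carrier G" using sub by auto
  then have "generate H (h ` {comm G x y | x y. x \<in> lcs G k \<and> y \<in> carrier G})
     = h ` generate G {comm G x y | x y. x \<in> lcs G k \<and> y \<in> carrier G}" by (rule generate_img)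
  ultimately show ?case by (simp only: lcs.simps Suc assms)
qed

lemma (in group_hom) nilpotency_class_iso:
  assumes surj: "h ` carrier G = carrier H" and inj: "inj_on h (carrier G)"
  shows "nilpotency_class G c \<longleftrightarrow> nilpotency_class H c"
proof -
  have "lcs G k = {\<one>} \<longleftrightarrow> lcs H k = {\<one>\<^bsub>H\<^esub>}" for k
  proof
    assume "lcs G k = {\<one>}"
    then show "lcs H k = {\<one>\<^bsub>H\<^esub>}" using image_lcs[OF surj, of k] by simp
  next
    assume a: "lcs H k = {\<one>\<^bsub>H\<^esub>}"
    have "x = \<one>" if "x \<in> lcs G k" for x
    proof -
      have "h x = h \<one>" using image_lcs[OF surj, of k] that a by auto
      moreover have "x \<in> carrier G" using that G.lcs_closed by blast
      ultimately show ?thesis using inj_onD[OF inj] by simp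
    qed
    then show "lcs G k = {\<one>}" using subgroup.one_closed[OF G.lcs_subgroup[of k]] by blast
  qed
  then show ?thesis by (simp add: nilpotency_class_def)
qed

text \<open>The parameters are raised above 1 by multiples of p^(m+l). In the model a and b have
  this order, so the relations hold for the original exponents as well.\<close>

lemma macdonald_model:
  assumes par: "macdonald_parameters p m l \<alpha> \<beta>"
  obtains H :: "(nat \<times> nat \<times> nat \<Rightarrow> nat \<times> nat \<times> nat) monoid" and a b c
  where "macdonald_group H a b c \<alpha> \<beta>" "carrier H = generate H {a, b}" "finite (carrier H)"
    "group.ord H a = p ^ (m + l)" "group.ord H b = p ^ (m + l)" "group.ord H c = p ^ (2 * l - m)"
    "p ^ (2 * m + 3 * l) \<le> card (carrier H)" "nilpotency_class H 5"
proof -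
  have p: "Factorial_Ring.prime p" "odd p" "2 \<le> m" "m < l" "2 * l < 3 * m"
    using par by (simp_all add: macdonald_parameters_def)
  define P where "P = int p ^ (m + l)"
  have P0: "0 < P" using p(1) by (simp add: P_def prime_gt_0_nat)
  have Pl: "int p ^ Suc l dvd P * z" for z
    unfolding P_def using p(3) by (intro dvd_mult2 le_imp_power_dvd) simp
  obtain z1 where z1: "1 < \<beta> + P * z1" using large_shift[OF P0] by blast
  obtain z2 where z2: "1 < \<alpha> + P * z2" using large_shift[OF P0] by blast
  define e n where "e = nat (\<alpha> + P * z2 - 1)" and "n = nat (\<beta> + P * z1 - 1)"
  have e: "1 + int e = \<alpha> + P * z2" and n: "1 + int n = \<beta> + P * z1"
    using z1 z2 by (simp_all add: e_def n_def)
  have par': "macdonald_parameters p m l (1 + int e) (1 + int n)"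
    unfolding e n by (rule macdonald_parameters_shift[OF par Pl Pl])
  have ev: "exact_val p m (int e)" "exact_val p m (int n)" "exact_val p l (int e - int n)"
    using par' by (simp_all add: macdonald_parameters_def)
  obtain d where d: "int e - int n = int p ^ l * d" "coprime d (int p)"
    using exact_prime_power[OF p(1)] ev(3) unfolding exact_val_def by blast
  have "int p ^ m dvd int e" using ev(1) by (simp add: exact_val_def)
  then obtain u where u: "int e = int p ^ m * u" by (rule dvdE)
  have "coprime (2 * d) P" using d(2) p(2) by (simp add: P_def)
  then obtain x where x: "[2 * d * x = 1] (mod P)" using cong_solve_coprime_int by blast
  \<comment> \<open>With e = p^m u, this is u^2 / (2d) modulo p^(m+l), so that h = p^(2m) w solves 2
    h d = e^2.\<close>
  define w where "w = nat ((u ^ 2 * x) mod P)"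
  have "int w = (u ^ 2 * x) mod P" using P0 by (simp add: w_def)
  then have w: "[int w = u ^ 2 * x] (mod P)" by (simp add: cong_def)
  define h where "h = p ^ (2 * m) * w"
  have "2 * int h * d = int p ^ (2 * m) * (2 * d * int w)" by (simp add: h_def)
  also have "[\<dots> = int p ^ (2 * m) * (2 * d * (u ^ 2 * x))] (mod P)"
    by (intro cong_mult cong_refl w)
  also have "int p ^ (2 * m) * (2 * d * (u ^ 2 * x)) = (int p ^ (2 * m) * u ^ 2) * (2 * d * x)"
    by (simp only: mult_ac)
  also have "[\<dots> = (int p ^ (2 * m) * u ^ 2) * 1] (mod P)"
    by (intro cong_mult cong_refl x)
  also have "(int p ^ (2 * m) * u ^ 2) * 1 = int e ^ 2"
    unfolding u by (simp add: power_mult_distrib power_mult[symmetric] mult.commute)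
  finally have h: "[2 * int h * d = int e ^ 2] (mod int p ^ (m + l))" by (simp add: P_def)
  have pe: "p ^ m dvd e" "\<not> p ^ Suc m dvd e" "p ^ m dvd n"
    using ev(1,2) unfolding exact_val_nat by blast+
  interpret M: macdonald_arith p m l e n h d
    by unfold_locales (use p pe d(1) h in \<open>simp_all add: h_def\<close>)
  obtain H :: "(nat \<times> nat \<times> nat \<Rightarrow> nat \<times> nat \<times> nat) monoid" and a b c
    where H: "macdonald_group H a b c (1 + int e) (1 + int n)" "carrier H = generate H {a, b}" "finite (carrier H)"
    "group.ord H a = p ^ (m + l)" "group.ord H b = p ^ (m + l)" "group.ord H c = p ^ (2 * l - m)"
    "p ^ (2 * m + 3 * l) \<le> card (carrier H)"
    using M.model_exists[OF pe(2)] by blast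
  interpret N: macdonald_nat H a b c e n using H(1) by (rule macdonald_nat.intro)
  have cl: "nilpotency_class H 5" by (rule N.class_5[OF H(2) par' H(4-6)])
  have "macdonald_group H a b c \<alpha> \<beta>"
  proof unfold_locales
    show "a \<otimes>\<^bsub>H\<^esub> b = b \<otimes>\<^bsub>H\<^esub> a \<otimes>\<^bsub>H\<^esub> c" by (rule N.AB)
    have "a [^]\<^bsub>H\<^esub> (1 + int e) = a [^]\<^bsub>H\<^esub> \<alpha>"
      unfolding e N.int_pow_eq[OF N.closed(1)] H(4) by (simp add: P_def)
    then show "a \<otimes>\<^bsub>H\<^esub> c = c \<otimes>\<^bsub>H\<^esub> a [^]\<^bsub>H\<^esub> \<alpha>" using N.AC by simp
    have "b [^]\<^bsub>H\<^esub> (1 + int n) = b [^]\<^bsub>H\<^esub> \<beta>"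
      unfolding n N.int_pow_eq[OF N.closed(2)] H(5) by (simp add: P_def)
    then show "c \<otimes>\<^bsub>H\<^esub> b = b [^]\<^bsub>H\<^esub> \<beta> \<otimes>\<^bsub>H\<^esub> c" using N.CB by simp
  qed simp_all
  then show ?thesis using H cl that by blast
qed

lemma exact_val_multiplicity:
  assumes "Factorial_Ring.prime p" "z \<noteq> 0"
  shows "exact_val p (multiplicity (int p) z) z"
proof -
  have "\<not> is_unit (int p)" using assms(1) not_prime_unit[of "int p"] by auto
  then have *: "int p ^ k dvd z \<longleftrightarrow> k \<le> multiplicity (int p) z" for k
    using assms(2) by (intro power_dvd_iff_le_multiplicity) auto
  show ?thesis unfolding exact_val_def * by simp
qed

lemma (in group) subgroup_pow_card:
  assumes "subgroup K G" "x \<in> K"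
  shows "x [^] card K = \<one>"
proof -
  interpret K: group "G\<lparr>carrier := K\<rparr>" by (rule subgroup.subgroup_is_group[OF assms(1) group_axioms])
  have "x [^]\<^bsub>G\<lparr>carrier := K\<rparr>\<^esub> order (G\<lparr>carrier := K\<rparr>) = \<one>\<^bsub>G\<lparr>carrier := K\<rparr>\<^esub>"
    using assms(2) by (intro K.pow_order_eq_1) simp
  then show ?thesis using nat_pow_consistent[of x "card K" K] by (simp add: order_def)
qed

theorem theorem7p2:
  fixes p :: nat and \<alpha> \<beta> :: int and m l :: nat
  assumes "Factorial_Ring.prime p"
    and "\<alpha> \<noteq> 1" and "\<beta> \<noteq> 1"
    and "p > 3 \<or> (p = 3 \<and> \<not> [\<alpha> = 7] (mod 9) \<and> \<not> [\<beta> = 7] (mod 9))"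
    and "multiplicity (int p) (\<alpha> - 1) = m" and "multiplicity (int p) (\<beta> - 1) = m"
    and "m > 0"
    and "l = multiplicity (int p) (\<alpha> - \<beta>)"
    and "m < l" and "l < 2 * m" and "2 * l < 3 * m"
  shows "finite (carrier (Gab \<alpha> \<beta>))
    \<and> (\<forall>P. is_sylow (Gab \<alpha> \<beta>) p P \<longrightarrow>
          card P = p ^ (2 * m + 3 * l)
        \<and> nilpotency_class ((Gab \<alpha> \<beta>)\<lparr>carrier := P\<rparr>) 5)
    \<and> group.ord (Gab \<alpha> \<beta>) (ppart (Gab \<alpha> \<beta>) p (elA \<alpha> \<beta>)) = p ^ (m + l)
    \<and> group.ord (Gab \<alpha> \<beta>) (ppart (Gab \<alpha> \<beta>) p (elB \<alpha> \<beta>)) = p ^ (m + l)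
    \<and> group.ord (Gab \<alpha> \<beta>) (ppart (Gab \<alpha> \<beta>) p (elC \<alpha> \<beta>)) = p ^ (2 * l - m)"
proof -
  have p3: "3 \<le> p" using assms(4) by auto
  have odd: "odd p" using assms(1) p3 by (simp add: prime_odd_nat)
  \<comment> \<open>The multiplicity of p in 0 is 0 by convention, so equality would give l = 0,
    against m < l.\<close>
  have ab: "\<alpha> \<noteq> \<beta>" using assms(8,9) by auto
  have par: "macdonald_parameters p m l \<alpha> \<beta>"
    unfolding macdonald_parameters_def
    using assms odd ab exact_val_multiplicity[OF assms(1), of "\<alpha> - 1"]
      exact_val_multiplicity[OF assms(1), of "\<beta> - 1"] exact_val_multiplicity[OF assms(1), of "\<alpha> - \<beta>"]
    by auto
  \<comment> \<open>A nonzero multiple x - 1 of p has absolute value at least 3, which excludes 0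
    and -1.\<close>
  have big: "1 < \<bar>x\<bar>" if "int p ^ m dvd x - 1" "x \<noteq> 1" for x
  proof (rule ccontr)
    assume "\<not> 1 < \<bar>x\<bar>"
    then have "\<bar>x - 1\<bar> \<le> 2" by linarith
    moreover have "int p dvd x - 1" using that(1) assms(7) by (metis dvd_power dvd_trans)
    then have "int p \<le> \<bar>x - 1\<bar>" using that(2) by (metis dvd_abs_iff eq_iff_diff_eq_0 zdvd_imp_le zero_less_abs_iff)
    ultimately show False using p3 by linarith
  qed
  let ?G = "Gab \<alpha> \<beta>" and ?s = "2 * m + 3 * l"
  interpret G: macdonald_group ?G "elA \<alpha> \<beta>" "elB \<alpha> \<beta>" "elC \<alpha> \<beta>" \<alpha> \<beta> by (rule Gab_macdonald)
  note gen = Gab_macdonald(2)[of \<alpha> \<beta>]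
  have fin: "finite (carrier ?G)"
    using par by (intro G.finite_carrier[OF gen ab assms(2,3)] big assms(2,3))
      (simp_all add: macdonald_parameters_def exact_val_def)
  have up: "\<not> p ^ Suc ?s dvd order ?G" by (rule G.order_valuation[OF fin gen par])
  obtain H :: "(nat \<times> nat \<times> nat \<Rightarrow> nat \<times> nat \<times> nat) monoid" and a b c
    where H: "macdonald_group H a b c \<alpha> \<beta>" "carrier H = generate H {a, b}" "finite (carrier H)"
    "group.ord H a = p ^ (m + l)" "group.ord H b = p ^ (m + l)" "group.ord H c = p ^ (2 * l - m)"
    "p ^ ?s \<le> card (carrier H)" "nilpotency_class H 5"
    using macdonald_model[OF par] by blast
  interpret H: macdonald_group H a b c \<alpha> \<beta> by (rule H(1))
  obtain \<phi> where \<phi>: "\<phi> \<in> hom ?G H" "\<phi> (elA \<alpha> \<beta>) = a" "\<phi> (elB \<alpha> \<beta>) = b" "\<phi> (elC \<alpha> \<beta>) = c"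
    using Gab_hom[OF H(1)] by blast
  interpret h: group_hom ?G H \<phi> using \<phi>(1) by unfold_locales
  have surj: "\<phi> ` carrier ?G = carrier H"
  proof -
    have "{elA \<alpha> \<beta>, elB \<alpha> \<beta>} \<subseteq> carrier ?G" using G.closed by blast
    from h.generate_img[OF this] show ?thesis
      by (simp only: image_insert image_empty \<phi>(2,3) gen[symmetric] H(2)[symmetric])
  qed
  let ?K = "kernel ?G H \<phi>"
  have Ksub: "subgroup ?K ?G" by (rule h.subgroup_kernel)
  have oG: "order ?G = order H * card ?K"
    using G.lagrange[OF Ksub] iso_same_card[OF h.FactGroup_iso[OF surj]] by (simp add: FactGroup_def order_def)
  have "\<one>\<^bsub>H\<^esub> \<in> {h \<otimes>\<^bsub>H\<^esub> c [^]\<^bsub>H\<^esub> i | h i. h \<in> generate H {b} \<and> i \<in> (UNIV :: nat set)}"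
    by (intro CollectI exI[of _ "\<one>\<^bsub>H\<^esub>"] exI[of _ 0]) (simp add: generate.one)
  \<comment> \<open>This serves only to make the order of the model a power of p. Its exponent is
    then squeezed between the number of points and the bound on the order of G(\<alpha>,\<beta>),
    which maps onto the model.\<close>
  then have "order H dvd p ^ (m + l) * p ^ (2 * l - m) * p ^ (m + l)"
    using H.order_dvd_ord_mult[OF H(3,2), of "p ^ (m + l)"] H(4-6) p3 H.pow_ord_eq_1[of a] by simp
  then have "order H dvd p ^ (m + l + (2 * l - m) + (m + l))" by (simp only: power_add)
  then obtain w where w: "order H = p ^ w" using divides_primepow_nat[OF assms(1)] by blast
  have "p ^ ?s \<le> p ^ w" using H(7) w by (simp add: order_def)
  then have sw: "?s \<le> w" using p3 by (simp add: power_le_imp_le_exp)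
  have ws: "w \<le> ?s"
  proof (rule ccontr)
    assume "\<not> w \<le> ?s"
    then have "p ^ Suc ?s dvd p ^ w" by (intro le_imp_power_dvd) simp
    then show False using up oG w by (metis dvd_mult2)
  qed
  have oH: "order H = p ^ ?s" using w sw ws by simp
  \<comment> \<open>The model accounts for the full power of p in the order, so the kernel has order
    prime to p. Therefore p-parts of element orders can be read off in the model, and every Sylow
    p-subgroup maps isomorphically onto it.\<close>
  have pK: "\<not> p dvd card ?K"
  proof
    assume "p dvd card ?K"
    then have "p ^ ?s * p dvd order ?G" unfolding oG oH by (intro mult_dvd_mono dvd_refl)
    then show False using up unfolding power_Suc2 by blast
  qed
  have oG0: "order ?G \<noteq> 0" using fin G.order_gt_0_iff_finite by simp
  have mult: "multiplicity p (order ?G) = ?s"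
  proof (rule multiplicity_eqI)
    show "p ^ ?s dvd order ?G" by (simp add: oG oH)
    show "\<not> p ^ Suc ?s dvd order ?G" by (rule up)
  qed
  have copK: "coprime (p ^ i) (card ?K)" for i
    using pK assms(1) prime_imp_coprime by (intro coprime_power_left_iff[THEN iffD2]) blast
  have ord: "group.ord ?G (ppart ?G p x) = group.ord H (\<phi> x)" if x: "x \<in> carrier ?G" and r: "group.ord H (\<phi> x) = p ^ r" for x r
  proof -
    have "\<phi> x [^]\<^bsub>H\<^esub> G.ord x = \<one>\<^bsub>H\<^esub>" using x by (simp flip: h.hom_nat_pow)
    then have d1: "p ^ r dvd G.ord x" using H.pow_eq_id[of "\<phi> x"] x r by simp
    have "\<phi> (x [^]\<^bsub>?G\<^esub> (p ^ r)) = \<one>\<^bsub>H\<^esub>"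
      using x r H.pow_ord_eq_1[of "\<phi> x"] by (simp add: h.hom_nat_pow)
    then have xk: "x [^]\<^bsub>?G\<^esub> (p ^ r) \<in> ?K" using x by (simp add: kernel_def)
    have "(x [^]\<^bsub>?G\<^esub> (p ^ r)) [^]\<^bsub>?G\<^esub> card ?K = \<one>\<^bsub>?G\<^esub>"
      using G.subgroup_pow_card[OF Ksub xk] .
    then have d2: "G.ord x dvd p ^ r * card ?K" using x by (simp add: G.nat_pow_pow G.pow_eq_id)
    have "multiplicity p (G.ord x) = r"
    proof (rule multiplicity_eqI)
      show "p ^ r dvd G.ord x" by (rule d1)
      show "\<not> p ^ Suc r dvd G.ord x"
      proof
        assume "p ^ Suc r dvd G.ord x"
        then have "p ^ r * p dvd p ^ r * card ?K" using d2 by (metis dvd_trans power_Suc2)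
        then show False using pK p3 by simp
      qed
    qed
    then show ?thesis using G.ord_ppart[OF fin assms(1) x] r by simp
  qed
  have syl: "card P = p ^ ?s \<and> nilpotency_class (?G\<lparr>carrier := P\<rparr>) 5" if "is_sylow ?G p P" for P
  proof -
    have P: "subgroup P ?G" "card P = p ^ ?s" using that mult by (simp_all add: is_sylow_def)
    let ?P = "?G\<lparr>carrier := P\<rparr>"
    interpret P: group ?P by (rule subgroup.subgroup_is_group[OF P(1) G.group_axioms])
    have Pc: "\<And>x. x \<in> P \<Longrightarrow> x \<in> carrier ?G" by (rule subgroup.mem_carrier[OF P(1)])
    interpret hP: group_hom ?P H \<phi>
      by unfold_locales (auto simp: hom_def Pc)
    have triv: "x = \<one>\<^bsub>?G\<^esub>" if x: "x \<in> P" "\<phi> x = \<one>\<^bsub>H\<^esub>" for x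
    proof -
      have xc: "x \<in> carrier ?G" using x(1) by (rule Pc)
      have "x \<in> ?K" using x xc by (simp add: kernel_def)
      then have "G.ord x dvd card ?K" using G.subgroup_pow_card[OF Ksub] G.pow_eq_id[OF xc] by blast
      moreover have "G.ord x dvd p ^ ?s"
        using G.subgroup_pow_card[OF P(1) x(1)] G.pow_eq_id[OF xc] P(2) by simp
      ultimately have "G.ord x dvd 1" using copK[of ?s] coprime_common_divisor by blast
      then show ?thesis using G.ord_eq_1[OF xc] by simp
    qed
    have inj: "inj_on \<phi> (carrier ?P)"
      unfolding hP.inj_on_one_iff using triv by simp
    have finP: "finite P" using fin subgroup.subset[OF P(1)] finite_subset by blast
    have "card (\<phi> ` P) = card (carrier H)"
      using inj card_image[of \<phi> P] P(2) oH by (simp add: order_def)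
    moreover have "\<phi> ` P \<subseteq> carrier H" using Pc by auto
    ultimately have "\<phi> ` carrier ?P = carrier H" using card_subset_eq[OF H(3)] by simp
    then show ?thesis using hP.nilpotency_class_iso inj H(8) P(2) by blast
  qed
  show ?thesis
    using fin syl ord[OF G.closed(1)] ord[OF G.closed(2)] ord[OF G.closed(3)] \<phi>(2-4) H(4-6) by simp
qed

end
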